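(* Let $\boldsymbol\omega_{z,z'}(t)$ be the Markov process in $\Omega$ with transition semigroup $\{T(t)\}_{t\ge0}$ described in the context. (1) The boundary z-measure $P_{z,z'}$ is the unique stationary distribution of the process, i.e. the unique probability measure $P$ on $\Omega$ with $\int T(t)f\,dP=\int f\,dP$ for all $f\in C(\Omega)$, $t\ge0$. (2) $P_{z,z'}$ is a symmetrizing measure: $\int_\Omega(T(t)f)g\,dP_{z,z'}=\int_\Omega f(T(t)g)\,dP_{z,z'}$ for all $f,g\in C(\Omega)$, $t\ge0$ (equivalently, the generator $\bar A_{z,z'}$ is symmetric in $L^2(\Omega,P_{z,z'})$ on its domain). (3) The process is ergodic: for every $f\in C(\Omega)$, $\lim_{t\to+\infty}\big\|T(t)f-\big(\int_\Omega f\,dP_{z,z'}\big)\cdot1\big\|=0$, where $\|\cdot\|$ is the sup norm on $C(\Omega)$.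
   Context: Young diagrams: $\mathbb Y_n$ is the set of Young diagrams with $n$ boxes; $\mu\nearrow\lambda$ (equivalently $\lambda\searrow\mu$) means $\mu\subset\lambda$, $|\lambda|=|\mu|+1$; $(z)_\theta=\prod_{(i,j)\in\theta}(z+j-i)$ for a (skew) diagram $\theta$ ($(i,j)$ = row $i$, column $j$), $(z)_n=z(z+1)\cdots(z+n-1)$; $\dim\lambda$ = number of standard Young tableaux of shape $\lambda$. Modified Frobenius coordinates $\lambda=(a_1,\dots,a_d\mid b_1,\dots,b_d)$: $d$ the number of diagonal boxes, $a_i=\lambda_i-i+\frac12$, $b_i=\lambda'_i-i+\frac12$. $(z,z')$ is fixed in the principal series ($z\notin\mathbb R$, $z'=\bar z$) or complementary series ($z,z'\in(N,N+1)$, $N\in\mathbb Z$). z-measure: $M_n(\lambda)=\frac{(z)_\lambda(z')_\lambda}{(zz')_n}\frac{(\dim\lambda)^2}{n!}$. $p^\downarrow(\nu,\lambda)=\dim\lambda/\dim\nu$ if $\lambda\nearrow\nu$, else 0; for $\lambda\in\mathbb Y_n$, $p^\uparrow(\lambda,\nu)=\frac{(z)_{\nu/\lambda}(z')_{\nu/\lambda}}{zz'+n}\frac{\dim\nu}{(n+1)\dim\lambda}$ if $\nu\searrow\lambda$, else 0; $(T_ng)(\lambda)=\sum_{\nu\in\mathbb Y_{n+1}}p^\uparrow(\lambda,\nu)\sum_{\tilde\lambda\in\mathbb Y_n}p^\downarrow(\nu,\tilde\lambda)g(\tilde\lambda)$ (norm $\|g\|_n=\max|g|$). Thoma simplex $\Omega$: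 pairs $\omega=(\alpha,\beta)$ of nonincreasing sequences of nonnegative reals with $\sum_i(\alpha_i+\beta_i)\le1$ (compact); $C(\Omega)$ with sup norm. $\iota_n(\lambda)$: $\alpha_i=a_i/n$, $\beta_i=b_i/n$ ($i\le d$), 0 otherwise; $\pi_nf=f\circ\iota_n$. $P_{z,z'}$ is the weak limit of $\iota_n(M_n)$. $\Lambda^\circ=\Lambda/(p_1-1)$ ($\Lambda$ = symmetric functions over $\mathbb R$, Schur functions $s_\mu$), realized as a dense subalgebra of $C(\Omega)$ via $p_1^\circ=1$, $p_k^\circ(\omega)=\sum_i\alpha_i^k+(-1)^{k-1}\sum_i\beta_i^k$ ($k\ge2$). $A_{z,z'}:\Lambda^\circ\to\Lambda^\circ$, $A_{z,z'}s^\circ_\mu=-m(m-1+zz')s^\circ_\mu+\sum_{\mu_\bullet\nearrow\mu}(z)_{\mu/\mu_\bullet}(z')_{\mu/\mu_\bullet}s^\circ_{\mu_\bullet}$ ($m=|\mu|$), satisfies $\|n^2(T_n-\mathbf 1)\pi_nf-\pi_n(A_{z,z'}f)\|_n\to0$; its closure $\bar A_{z,z'}$ in $C(\Omega)$ generates the conservative Markov semigroup $\{T(t)\}$ (strongly continuous, contractive, positivity preserving, $T(t)1=1$), which satisfies $\|T_n^{[n^2t]}\pi_nf-\pi_n(T(t)f)\|_n\to0$ for all $f\in C(\Omega)$. *)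

theory Defs
  imports "HOL-Probability.Probability"
begin

section \<open>Young diagrams (as finite sets of boxes (row, column), 1-indexed)\<close>

definition young :: "(nat \<times> nat) set \<Rightarrow> bool" where
  "young D \<longleftrightarrow> finite D \<and> (\<forall>(i,j)\<in>D. 1 \<le> i \<and> 1 \<le> j \<and>
      (\<forall>i' j'. 1 \<le> i' \<and> i' \<le> i \<and> 1 \<le> j' \<and> j' \<le> j \<longrightarrow> (i',j') \<in> D))"

definition YD :: "nat \<Rightarrow> (nat \<times> nat) set set" where
  "YD n = {D. young D \<and> card D = n}"

definition covers :: "(nat \<times> nat) set \<Rightarrow> (nat \<times> nat) set \<Rightarrow> bool" where
  "covers mu lam \<longleftrightarrow> mu \<subseteq> lam \<and> card lam = card mu + 1"

definition dimY :: "(nat \<times> nat) set \<Rightarrow> nat" where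
  "dimY D = card {T. bij_betw T D {1..card D} \<and> T \<in> extensional D \<and>
      (\<forall>i j. (i,j) \<in> D \<and> (i,Suc j) \<in> D \<longrightarrow> T (i,j) < T (i,Suc j)) \<and>
      (\<forall>i j. (i,j) \<in> D \<and> (Suc i,j) \<in> D \<longrightarrow> T (i,j) < T (Suc i,j))}"

definition poch_diag :: "complex \<Rightarrow> (nat \<times> nat) set \<Rightarrow> complex" where
  "poch_diag z th = (\<Prod>(i,j)\<in>th. z + of_nat j - of_nat i)"

text \<open>The z-measure on Y_n (z z' real in both series, hence the real part).\<close>
definition zmeasure :: "complex \<Rightarrow> complex \<Rightarrow> nat \<Rightarrow> (nat \<times> nat) set \<Rightarrow> real" where
  "zmeasure z z' n lam = Re (poch_diag z lam * poch_diag z' lam / pochhammer (z * z') n)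
      * (real (dimY lam))^2 / fact n"

definition p_down :: "(nat \<times> nat) set \<Rightarrow> (nat \<times> nat) set \<Rightarrow> real" where
  "p_down nu lam = (if covers lam nu then real (dimY lam) / real (dimY nu) else 0)"

definition p_up :: "complex \<Rightarrow> complex \<Rightarrow> nat \<Rightarrow> (nat \<times> nat) set \<Rightarrow> (nat \<times> nat) set \<Rightarrow> real" where
  "p_up z z' n lam nu = (if covers lam nu then
      Re (poch_diag z (nu - lam) * poch_diag z' (nu - lam) / (z * z' + of_nat n))
      * real (dimY nu) / (real (n + 1) * real (dimY lam)) else 0)"

definition Tn :: "complex \<Rightarrow> complex \<Rightarrow> nat \<Rightarrow> ((nat \<times> nat) set \<Rightarrow> real) \<Rightarrow> (nat \<times> nat) set \<Rightarrow> real" where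
  "Tn z z' n g lam = (\<Sum>nu\<in>YD (Suc n). p_up z z' n lam nu * (\<Sum>lt\<in>YD n. p_down nu lt * g lt))"

type_synonym thoma = "(nat \<Rightarrow> real) \<times> (nat \<Rightarrow> real)"

text \<open>Index k :: nat corresponds to alpha_(k+1), beta_(k+1). Topology: product
  topology (coordinatewise convergence), as in the paper.\<close>
definition Thoma :: "thoma set" where
  "Thoma = {(a,b). (\<forall>i. 0 \<le> a i \<and> 0 \<le> b i) \<and> antimono a \<and> antimono b \<and>
      (\<forall>m. (\<Sum>i<m. a i + b i) \<le> 1)}"

text \<open>Modified Frobenius coordinates (k :: nat is the index i-1).\<close>
definition row_len :: "(nat \<times> nat) set \<Rightarrow> nat \<Rightarrow> nat" where
  "row_len D i = card {j. (i,j) \<in> D}"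

definition col_len :: "(nat \<times> nat) set \<Rightarrow> nat \<Rightarrow> nat" where
  "col_len D j = card {i. (i,j) \<in> D}"

definition diag_len :: "(nat \<times> nat) set \<Rightarrow> nat" where
  "diag_len D = card {i. (i,i) \<in> D}"

definition iota :: "nat \<Rightarrow> (nat \<times> nat) set \<Rightarrow> thoma" where
  "iota n D = ((\<lambda>k. if k < diag_len D then (real (row_len D (Suc k)) - real (Suc k) + 1/2) / real n else 0),
               (\<lambda>k. if k < diag_len D then (real (col_len D (Suc k)) - real (Suc k) + 1/2) / real n else 0))"

definition admissible_zz :: "complex \<Rightarrow> complex \<Rightarrow> bool" where
  "admissible_zz z z' \<longleftrightarrow> (Im z \<noteq> 0 \<and> z' = cnj z) \<or>
     (\<exists>N::int. Im z = 0 \<and> Im z' = 0 \<and> of_int N < Re z \<and> Re z < of_int N + 1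
               \<and> of_int N < Re z' \<and> Re z' < of_int N + 1)"

definition prob_on_Thoma :: "thoma measure \<Rightarrow> bool" where
  "prob_on_Thoma P \<longleftrightarrow> prob_space P \<and> sets P = sets (restrict_space borel Thoma)"

definition is_boundary_zmeasure :: "complex \<Rightarrow> complex \<Rightarrow> thoma measure \<Rightarrow> bool" where
  "is_boundary_zmeasure z z' P \<longleftrightarrow> prob_on_Thoma P \<and>
     (\<forall>f. continuous_on Thoma f \<longrightarrow>
        (\<lambda>n. \<Sum>lam\<in>YD n. zmeasure z z' n lam * f (iota n lam)) \<longlonglongrightarrow> integral\<^sup>L P f)"

text \<open>T is the semigroup of the context, characterized by the approximation
  ||T_n^[n^2 t] pi_n f - pi_n (T(t) f)||_n \<rightarrow> 0 for all f in C(Omega), t \<ge> 0,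
  with T(t) f \<in> C(Omega).\<close>
definition is_zz_semigroup :: "complex \<Rightarrow> complex \<Rightarrow> (real \<Rightarrow> (thoma \<Rightarrow> real) \<Rightarrow> thoma \<Rightarrow> real) \<Rightarrow> bool" where
  "is_zz_semigroup z z' T \<longleftrightarrow>
     (\<forall>f t. continuous_on Thoma f \<and> 0 \<le> t \<longrightarrow>
        continuous_on Thoma (T t f) \<and>
        (\<lambda>n. Max ((\<lambda>lam. \<bar>(Tn z z' n ^^ nat \<lfloor>real n ^ 2 * t\<rfloor>) (\<lambda>mu. f (iota n mu)) lam
                           - T t f (iota n lam)\<bar>) ` YD n)) \<longlonglongrightarrow> 0)"

end

theory Submission
  imports Defs "HOL-Real_Asymp.Real_Asymp"
begin

text \<open>
  The generating functions of the transition and co-transition measures of a diagram are determined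
  by induction on its size (Kerov); the moments of the co-transition measure are then, up to lower
  order, proportional to the power sums of the contents. Hence the normalised power sums are almost
  martingales along the random down chain, and by Stone--Weierstrass every continuous function on the
  Thoma simplex is, along that chain, almost constant. So \<open>\<pi>\<^sub>n f\<close> is uniformly approximated by functions
  pulled back from a fixed level \<open>m\<close> along the down chain, and on those \<open>T\<^sub>n\<close> acts as \<open>1 + \<epsilon>\<^sub>n A\<^sub>m\<close> with
  \<open>\<epsilon>\<^sub>n \<approx> n\<^sup>-\<^sup>2\<close>. The up operator intertwines \<open>A\<^sub>m\<close> with \<open>A\<^sub>m\<^sub>-\<^sub>1\<close>, which gives, by induction on \<open>m\<close>,
  exponential convergence to a constant at a rate independent of \<open>n\<close>. Together with the density of
  the embedded diagrams this is ergodicity, and uniqueness follows. Symmetry passes to the limit from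
  the reversibility of \<open>T\<^sub>n\<close> with respect to the z-measures.
\<close>

section \<open>Young diagrams and their corners\<close>

text \<open>The semigroup is given only as a limit of powers of \<open>Tn\<close>, so its generator
  and spectrum are not directly at hand: each estimate must be uniform over the diagrams of level
  \<open>n\<close> and survive about \<open>n^2 * s\<close> steps. An initial sup-norm error is not
  amplified, because \<open>Tn\<close> is a contraction; hence replacing the test function once by
  one that factors through a fixed level suffices.

  One commutation relation, \<open>up_down\<close>, serves two purposes. Its diagonal term is
  \<open>w 0\<close> plus the sum over the boxes of the second differences of the content weight
  \<open>w\<close>. For \<open>w c = 1 / (u - c)\<close> this is the logarithmic derivative of
  Kerov's function and drives the induction for the transition measure. For
  \<open>w c = (z + c) * (z' + c)\<close>, a monic quadratic in \<open>c\<close>, it depends on the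
  number of boxes only, and summing it along the down chain yields the rates
  \<open>m * (m - 1 + z * z')\<close>. The smallest positive rate is \<open>t = z * z'\<close>; the
  weaker \<open>t / 2\<close> is kept since it leaves room at every level.\<close>

definition box_content :: "nat \<times> nat \<Rightarrow> int" where
  "box_content b = int (snd b) - int (fst b)"

definition addable :: "(nat \<times> nat) set \<Rightarrow> (nat \<times> nat) set" where
  "addable D = {b. b \<notin> D \<and> young (insert b D)}"

definition removable :: "(nat \<times> nat) set \<Rightarrow> (nat \<times> nat) set" where
  "removable D = {b \<in> D. young (D - {b})}"

lemma youngD:
  assumes "young D" "(i, j) \<in> D"
  shows "1 \<le> i" "1 \<le> j"
    and "\<And>i' j'. 1 \<le> i' \<Longrightarrow> i' \<le> i \<Longrightarrow> 1 \<le> j' \<Longrightarrow> j' \<le> j \<Longrightarrow> (i', j') \<in> D"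
  using assms unfolding young_def by fast+

lemma young_finite: "young D \<Longrightarrow> finite D"
  by (simp add: young_def)

lemma youngI:
  assumes "finite D" "\<And>i j. (i, j) \<in> D \<Longrightarrow> 1 \<le> i \<and> 1 \<le> j"
    and "\<And>i j i' j'. (i, j) \<in> D \<Longrightarrow> 1 \<le> i' \<Longrightarrow> i' \<le> i \<Longrightarrow> 1 \<le> j' \<Longrightarrow> j' \<le> j \<Longrightarrow> (i', j') \<in> D"
  shows "young D"
  using assms unfolding young_def by blast

lemma young_empty [simp]: "young {}"
  by (simp add: young_def)

lemma young_Int:
  assumes "young A" "young B"
  shows "young (A \<inter> B)"
proof (rule youngI)
  show "finite (A \<inter> B)" using assms by (simp add: young_finite)
next
  fix i j assume "(i, j) \<in> A \<inter> B"
  then show "1 \<le> i \<and> 1 \<le> j" using youngD(1,2)[OF assms(1), of i j] by blast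
next
  fix i j i' j' assume h: "(i, j) \<in> A \<inter> B" "1 \<le> i'" "i' \<le> i" "1 \<le> j'" "j' \<le> j"
  then show "(i', j') \<in> A \<inter> B"
    using youngD(3)[OF assms(1), of i j i' j'] youngD(3)[OF assms(2), of i j i' j'] by simp
qed

lemma young_Un:
  assumes "young A" "young B"
  shows "young (A \<union> B)"
proof (rule youngI)
  show "finite (A \<union> B)" using assms by (simp add: young_finite)
next
  fix i j assume "(i, j) \<in> A \<union> B"
  then show "1 \<le> i \<and> 1 \<le> j"
    using youngD(1,2)[OF assms(1), of i j] youngD(1,2)[OF assms(2), of i j] by blast
next
  fix i j i' j' assume h: "(i, j) \<in> A \<union> B" "1 \<le> i'" "i' \<le> i" "1 \<le> j'" "j' \<le> j"
  then show "(i', j') \<in> A \<union> B"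
    using youngD(3)[OF assms(1), of i j i' j'] youngD(3)[OF assms(2), of i j i' j'] by auto
qed

lemma addable_iff:
  assumes "young D"
  shows "(i, j) \<in> addable D \<longleftrightarrow> (i, j) \<notin> D \<and> 1 \<le> i \<and> 1 \<le> j \<and>
    (i = 1 \<or> (i - 1, j) \<in> D) \<and> (j = 1 \<or> (i, j - 1) \<in> D)" (is "?l \<longleftrightarrow> ?r")
proof
  assume l: ?l
  then have y: "young (insert (i, j) D)" and n: "(i, j) \<notin> D" by (auto simp: addable_def)
  have 1: "1 \<le> i" "1 \<le> j" using youngD[OF y, of i j] by auto
  have "(i - 1, j) \<in> insert (i, j) D" if "i \<noteq> 1"
    by (rule youngD(3)[OF y, of i j]) (use 1 that in auto)
  moreover have "(i, j - 1) \<in> insert (i, j) D" if "j \<noteq> 1"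
    by (rule youngD(3)[OF y, of i j]) (use 1 that in auto)
  ultimately show ?r using n 1 by (cases "i = 1"; cases "j = 1") auto
next
  assume r: ?r
  have "young (insert (i, j) D)"
  proof (rule youngI)
    show "finite (insert (i, j) D)" using assms by (simp add: young_finite)
  next
    fix i' j' assume "(i', j') \<in> insert (i, j) D"
    then show "1 \<le> i' \<and> 1 \<le> j'" using r youngD(1,2)[OF assms, of i' j'] by auto
  next
    fix a b a' b' assume h: "(a, b) \<in> insert (i, j) D" "1 \<le> a'" "a' \<le> a" "1 \<le> b'" "b' \<le> b"
    show "(a', b') \<in> insert (i, j) D"
    proof (cases "(a, b) \<in> D")
      case True then show ?thesis using youngD(3)[OF assms True] h by auto
    next
      case False
      then have ab: "a = i" "b = j" using h by auto
      consider "a' = i \<and> b' = j" | "a' < i" | "b' < j" using h ab by linarith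
      then show ?thesis
      proof cases
        case 1 then show ?thesis by simp
      next
        case 2
        then have "(i - 1, j) \<in> D" using r h by auto
        then have "(a', b') \<in> D" by (rule youngD(3)[OF assms]) (use 2 h ab in auto)
        then show ?thesis by simp
      next
        case 3
        then have "(i, j - 1) \<in> D" using r h by auto
        then have "(a', b') \<in> D" by (rule youngD(3)[OF assms]) (use 3 h ab in auto)
        then show ?thesis by simp
      qed
    qed
  qed
  then show ?l using r by (simp add: addable_def)
qed

lemma removable_iff:
  assumes "young D"
  shows "(i, j) \<in> removable D \<longleftrightarrow> (i, j) \<in> D \<and> (Suc i, j) \<notin> D \<and> (i, Suc j) \<notin> D" (is "?l \<longleftrightarrow> ?r")
proof
  assume l: ?l
  then have y: "young (D - {(i, j)})" and n: "(i, j) \<in> D" by (auto simp: removable_def)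
  have 1: "1 \<le> i" "1 \<le> j" using youngD[OF assms n] by auto
  have "(Suc i, j) \<in> D \<Longrightarrow> (i, j) \<in> D - {(i, j)}"
    by (rule youngD(3)[OF y, of "Suc i" j]) (use 1 in auto)
  moreover have "(i, Suc j) \<in> D \<Longrightarrow> (i, j) \<in> D - {(i, j)}"
    by (rule youngD(3)[OF y, of i "Suc j"]) (use 1 in auto)
  ultimately show ?r using n by auto
next
  assume r: ?r
  have 1: "1 \<le> i" "1 \<le> j" using youngD[OF assms, of i j] r by auto
  have "young (D - {(i, j)})"
  proof (rule youngI)
    show "finite (D - {(i, j)})" using assms by (simp add: young_finite)
  next
    fix i' j' assume "(i', j') \<in> D - {(i, j)}"
    then show "1 \<le> i' \<and> 1 \<le> j'" using youngD(1,2)[OF assms, of i' j'] by auto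
  next
    fix a b a' b' assume h: "(a, b) \<in> D - {(i, j)}" "1 \<le> a'" "a' \<le> a" "1 \<le> b'" "b' \<le> b"
    have D: "(a', b') \<in> D" using youngD(3)[OF assms, of a b] h by auto
    have "(a', b') \<noteq> (i, j)"
    proof
      assume e: "(a', b') = (i, j)"
      then consider "Suc i \<le> a" | "Suc j \<le> b" using h by fastforce
      then show False
      proof cases
        case 1
        have "(Suc i, j) \<in> D" by (rule youngD(3)[OF assms, of a b]) (use h e 1 in auto)
        then show False using r by simp
      next
        case 2
        have "(i, Suc j) \<in> D" by (rule youngD(3)[OF assms, of a b]) (use h e 2 in auto)
        then show False using r by simp
      qed
    qed
    then show "(a', b') \<in> D - {(i, j)}" using D by simp
  qed
  then show ?l using r by (simp add: removable_def)
qed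

lemma finite_removable: "young D \<Longrightarrow> finite (removable D)"
  using young_finite[of D] by (auto simp: removable_def)

lemma finite_addable:
  assumes "young D"
  shows "finite (addable D)"
proof (rule finite_subset)
  show "addable D \<subseteq> insert (1, 1) ((\<lambda>(i, j). (Suc i, j)) ` D \<union> (\<lambda>(i, j). (i, Suc j)) ` D)"
  proof
    fix b assume b: "b \<in> addable D"
    obtain i j where ij: "b = (i, j)" by fastforce
    have h: "1 \<le> i" "1 \<le> j" "i = 1 \<or> (i - 1, j) \<in> D" "j = 1 \<or> (i, j - 1) \<in> D"
      using b addable_iff[OF assms, of i j] unfolding ij by blast+
    consider "i = 1 \<and> j = 1" | "(i - 1, j) \<in> D" | "(i, j - 1) \<in> D" using h by blast
    then show "b \<in> insert (1, 1) ((\<lambda>(i, j). (Suc i, j)) ` D \<union> (\<lambda>(i, j). (i, Suc j)) ` D)"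
    proof cases
      case 1 then show ?thesis using ij by simp
    next
      case 2
      then have "b \<in> (\<lambda>(i, j). (Suc i, j)) ` D" using h ij by (intro image_eqI[where x="(i - 1, j)"]) auto
      then show ?thesis by blast
    next
      case 3
      then have "b \<in> (\<lambda>(i, j). (i, Suc j)) ` D" using h ij by (intro image_eqI[where x="(i, j - 1)"]) auto
      then show ?thesis by blast
    qed
  qed
qed (use assms in \<open>simp add: young_finite\<close>)

lemma addable_empty: "addable {} = {(1, 1)}"
proof -
  have "(i, j) \<in> addable {} \<longleftrightarrow> (i, j) = (1, 1)" for i j
    by (subst addable_iff) auto
  then show ?thesis by auto
qed

lemma removable_empty [simp]: "removable {} = {}"
  by (simp add: removable_def)

lemma removable_insert: "young D \<Longrightarrow> b \<in> addable D \<Longrightarrow> b \<in> removable (insert b D)"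
  by (simp add: removable_def addable_def)

lemma addable_Diff: "young D \<Longrightarrow> b \<in> removable D \<Longrightarrow> b \<in> addable (D - {b})"
  by (simp add: removable_def addable_def insert_absorb)

text \<open>A box with the largest coordinate sum has no neighbour below or to the right, so it is a
  corner.\<close>

lemma ex_removable:
  assumes "young D" "D \<noteq> {}"
  shows "removable D \<noteq> {}"
proof -
  have fin: "finite D" using assms by (simp add: young_finite)
  have "Max ((\<lambda>b. fst b + snd b) ` D) \<in> (\<lambda>b. fst b + snd b) ` D"
    using fin assms(2) by (intro Max_in) auto
  then obtain b where "b \<in> D" "fst b + snd b = Max ((\<lambda>b. fst b + snd b) ` D)" by auto
  then have b: "b \<in> D" "\<And>c. c \<in> D \<Longrightarrow> fst c + snd c \<le> fst b + snd b"
    using fin by auto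
  obtain i j where ij: "b = (i, j)" by fastforce
  have "(i, j) \<in> removable D"
    unfolding removable_iff[OF assms(1)] using b(1) b(2)[of "(Suc i, j)"] b(2)[of "(i, Suc j)"] ij by auto
  then show ?thesis by blast
qed

lemma young_induct [consumes 1, case_names empty insert]:
  assumes "young D" "P {}"
    and "\<And>D b. young D \<Longrightarrow> b \<in> addable D \<Longrightarrow> P D \<Longrightarrow> P (insert b D)"
  shows "P D"
  using assms(1)
proof (induction "card D" arbitrary: D)
  case 0
  then show ?case using assms(2) young_finite by force
next
  case (Suc n)
  then obtain b where b: "b \<in> removable D" using ex_removable[of D] by fastforce
  then have bD: "b \<in> D" "young (D - {b})" by (auto simp: removable_def)
  have "P (D - {b})" using Suc bD young_finite[of D] by (intro Suc.hyps(1)) auto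
  then have "P (insert b (D - {b}))" using assms(3)[OF bD(2) addable_Diff[OF Suc.prems b]] by simp
  then show ?case using bD by (simp add: insert_absorb)
qed

text \<open>Two boxes of one diagonal cannot both be addable: the lower one needs the box above it
  in \<open>D\<close>, and that box forces the upper one into \<open>D\<close>. Contents therefore
  identify corners, and the rational functions built from them have simple zeros and poles.\<close>

lemma inj_on_content_addable:
  assumes "young D"
  shows "inj_on box_content (addable D)"
proof -
  have aux: False if h: "(i, j) \<in> addable D" "(i + k, j + k) \<in> addable D" "k > 0" for i j k
  proof -
    have "(i + k - 1, j + k) \<in> D" using h(2,3) addable_iff[OF assms, of "i+k" "j+k"]
        addable_iff[OF assms, of i j] h(1) by auto
    then have "(i, j) \<in> D" by (rule youngD(3)[OF assms]) (use h addable_iff[OF assms, of i j] in auto)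
    then show False using h(1) by (simp add: addable_def)
  qed
  show ?thesis
  proof (rule inj_onI)
    fix b c assume h: "b \<in> addable D" "c \<in> addable D" "box_content b = box_content c"
    obtain i j i' j' where e: "b = (i, j)" "c = (i', j')" by fastforce
    have "int j - int i = int j' - int i'" using h(3) e by (simp add: box_content_def)
    then consider "i = i' \<and> j = j'" | "i < i' \<and> j' = j + (i' - i)" | "i' < i \<and> j = j' + (i - i')" by linarith
    then show "b = c"
    proof cases
      case 1 then show ?thesis using e by simp
    next
      case 2 then show ?thesis using aux[of i j "i' - i"] h e by auto
    next
      case 3 then show ?thesis using aux[of i' j' "i - i'"] h e by auto
    qed
  qed
qed

lemma inj_on_content_removable:
  assumes "young D"
  shows "inj_on box_content (removable D)"
proof -
  have aux: False if h: "(i, j) \<in> removable D" "(i + k, j + k) \<in> D" "k > 0" for i j k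
  proof -
    have "(Suc i, j) \<in> D" by (rule youngD(3)[OF assms h(2)])
      (use h youngD[OF assms, of i j] in \<open>auto simp: removable_def\<close>)
    then show False using h(1) removable_iff[OF assms] by simp
  qed
  show ?thesis
  proof (rule inj_onI)
    fix b c assume h: "b \<in> removable D" "c \<in> removable D" "box_content b = box_content c"
    obtain i j i' j' where e: "b = (i, j)" "c = (i', j')" by fastforce
    have m: "b \<in> D" "c \<in> D" using h by (auto simp: removable_def)
    have "int j - int i = int j' - int i'" using h(3) e by (simp add: box_content_def)
    then consider "i = i' \<and> j = j'" | "i < i' \<and> j' = j + (i' - i)" | "i' < i \<and> j = j' + (i - i')" by linarith
    then show "b = c"
    proof cases
      case 1 then show ?thesis using e by simp
    next
      case 2 then show ?thesis using aux[of i j "i' - i"] h e m by auto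
    next
      case 3 then show ?thesis using aux[of i' j' "i - i'"] h e m by auto
    qed
  qed
qed

lemma content_less_card:
  assumes "young D" "b \<in> D"
  shows "\<bar>box_content b\<bar> < int (card D)"
proof -
  obtain i j where e: "b = (i, j)" by fastforce
  have 1: "1 \<le> i" "1 \<le> j" using youngD(1,2)[OF assms(1), of i j] assms(2) e by auto
  have "(\<lambda>i'. (i', j)) ` {1..i} \<subseteq> D" using youngD(3)[OF assms(1), of i j] assms(2) e 1 by auto
  then have "card ((\<lambda>i'. (i', j)) ` {1..i}) \<le> card D" by (rule card_mono[OF young_finite[OF assms(1)]])
  then have i: "i \<le> card D" by (simp add: card_image inj_on_def)
  have "(\<lambda>j'. (i, j')) ` {1..j} \<subseteq> D" using youngD(3)[OF assms(1), of i j] assms(2) e 1 by auto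
  then have "card ((\<lambda>j'. (i, j')) ` {1..j}) \<le> card D" by (rule card_mono[OF young_finite[OF assms(1)]])
  then have j: "j \<le> card D" by (simp add: card_image inj_on_def)
  show ?thesis using i j 1 unfolding e box_content_def by auto
qed

lemma content_addable_le_card:
  assumes "young D" "b \<in> addable D"
  shows "\<bar>box_content b\<bar> \<le> int (card D)"
  using content_less_card[of "insert b D" b] assms young_finite[of D] by (auto simp: addable_def)

text \<open>Only the two neighbouring diagonals are affected. On each of them either a new addable
  box appears next to \<open>b\<close> or an old removable box next to \<open>b\<close> is lost.
  Stating this with multisets of contents, with \<open>removable D\<close> on the left, makes both
  alternatives the same equation; the product and sum versions are its images.\<close>

lemma addable_removable_update:
  assumes D: "young D" and b: "b \<in> addable D"
  shows "image_mset box_content (mset_set (addable (insert b D))) + image_mset box_content (mset_set (removable D))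
    = image_mset box_content (mset_set (addable D - {b})) + image_mset box_content (mset_set (removable (insert b D) - {b}))
      + {# box_content b + 1, box_content b - 1 #}"
proof -
  obtain i j where ij: "b = (i, j)" by fastforce
  define D' where "D' = insert b D"
  have D': "young D'" using b by (simp add: D'_def addable_def)
  have B: "(i, j) \<notin> D" "1 \<le> i" "1 \<le> j" "i = 1 \<or> (i - 1, j) \<in> D" "j = 1 \<or> (i, j - 1) \<in> D"
    using b addable_iff[OF D, of i j] unfolding ij by blast+
  \<comment> \<open>\<open>a1\<close> decides whether the box below \<open>b\<close> becomes
    addable; if not, \<open>(i, j - 1)\<close> was a corner of \<open>D\<close> and is no longer
    one. Both boxes have content \<open>box_content b - 1\<close>. \<open>a2\<close> does the same
    on the diagonal of content \<open>box_content b + 1\<close>.\<close>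
  define a1 where "a1 \<longleftrightarrow> j = 1 \<or> (Suc i, j - 1) \<in> D"
  define a2 where "a2 \<longleftrightarrow> i = 1 \<or> (i - 1, Suc j) \<in> D"
  have nD: "(Suc i, j) \<notin> D" "(i, Suc j) \<notin> D"
    using youngD(3)[OF D, of "Suc i" j i j] youngD(3)[OF D, of i "Suc j" i j] B by auto
  define E1 where "E1 = (if a1 then {(Suc i, j)} else {})"
  define E2 where "E2 = (if a2 then {(i, Suc j)} else {})"
  define F1 where "F1 = (if a1 then {} else {(i, j - 1)})"
  define F2 where "F2 = (if a2 then {} else {(i - 1, j)})"
  have add: "addable D' = (addable D - {b}) \<union> (E1 \<union> E2)"
  proof -
    have "(k, l) \<in> addable D' \<longleftrightarrow> (k, l) \<in> (addable D - {b}) \<union> (E1 \<union> E2)" for k l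
    proof -
      consider "(k, l) = (Suc i, j)" | "(k, l) = (i, Suc j)" | "(k, l) = (i, j)"
        | "(k, l) \<noteq> (Suc i, j)" "(k, l) \<noteq> (i, Suc j)" "(k, l) \<noteq> (i, j)" by blast
      then show ?thesis
      proof cases
        case 1
        then have "(k, l) \<notin> addable D" using addable_iff[OF D, of k l] B by auto
        then show ?thesis using 1 addable_iff[OF D', of k l] B nD
          unfolding E1_def E2_def a1_def D'_def ij by auto
      next
        case 2
        then have "(k, l) \<notin> addable D" using addable_iff[OF D, of k l] B by auto
        then show ?thesis using 2 addable_iff[OF D', of k l] B nD
          unfolding E1_def E2_def a2_def D'_def ij by auto
      next
        case 3
        then show ?thesis unfolding D'_def E1_def E2_def ij by (auto simp: addable_def)
      next
        case 4
        have "1 \<le> k \<Longrightarrow> k \<noteq> 1 \<Longrightarrow> (k - 1, l) \<in> D' \<longleftrightarrow> (k - 1, l) \<in> D"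
          "1 \<le> l \<Longrightarrow> l \<noteq> 1 \<Longrightarrow> (k, l - 1) \<in> D' \<longleftrightarrow> (k, l - 1) \<in> D" "(k, l) \<in> D' \<longleftrightarrow> (k, l) \<in> D"
          using 4 unfolding D'_def ij by auto
        then have "(k, l) \<in> addable D' \<longleftrightarrow> (k, l) \<in> addable D"
          unfolding addable_iff[OF D] addable_iff[OF D'] by blast
        then show ?thesis using 4 unfolding E1_def E2_def ij by auto
      qed
    qed
    then show ?thesis by auto
  qed
  have rem: "removable D = (removable D' - {b}) \<union> (F1 \<union> F2)"
  proof -
    have F: "F1 \<union> F2 \<subseteq> D" unfolding F1_def F2_def a1_def a2_def using B by auto
    have "(k, l) \<in> removable D \<longleftrightarrow> (k, l) \<in> (removable D' - {b}) \<union> (F1 \<union> F2)" for k l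
    proof -
      consider "i = Suc k" "l = j" | "k = i" "j = Suc l" | "(k, l) = (i, j)"
        | "(Suc k, l) \<noteq> (i, j)" "(k, Suc l) \<noteq> (i, j)" "(k, l) \<noteq> (i, j)" by blast
      then show ?thesis
      proof cases
        case 1
        then show ?thesis using removable_iff[OF D', of k l] removable_iff[OF D, of k l] B youngD(1,2)[OF D, of k l]
          unfolding F1_def F2_def a2_def D'_def ij by auto
      next
        case 2
        then show ?thesis using removable_iff[OF D', of k l] removable_iff[OF D, of k l] B youngD(1,2)[OF D, of k l]
          unfolding F1_def F2_def a1_def D'_def ij by auto
      next
        case 3
        then show ?thesis using B F unfolding ij by (auto simp: removable_def)
      next
        case 4
        have "(k, l) \<notin> F1 \<union> F2" using 4 B unfolding F1_def F2_def a1_def a2_def by auto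
        then show ?thesis using 4 removable_iff[OF D', of k l] removable_iff[OF D, of k l]
          unfolding D'_def ij by auto
      qed
    qed
    then show ?thesis by auto
  qed
  have fin: "finite (addable D)" "finite (removable D')"
    using D D' by (simp_all add: finite_addable finite_removable)
  have fE: "finite E1" "finite E2" "finite F1" "finite F2" "E1 \<inter> E2 = {}" "F1 \<inter> F2 = {}"
    unfolding E1_def E2_def F1_def F2_def using B by auto
  have d1: "(addable D - {b}) \<inter> (E1 \<union> E2) = {}"
    using addable_iff[OF D, of "Suc i" j] addable_iff[OF D, of i "Suc j"] B
    unfolding E1_def E2_def by auto
  have d2: "(removable D' - {b}) \<inter> (F1 \<union> F2) = {}"
    using removable_iff[OF D', of "i - 1" j] removable_iff[OF D', of i "j - 1"] B
    unfolding F1_def F2_def a1_def a2_def D'_def ij by auto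
  have e: "image_mset box_content (mset_set E1) + image_mset box_content (mset_set F1) = {# box_content b - 1 #}"
    "image_mset box_content (mset_set E2) + image_mset box_content (mset_set F2) = {# box_content b + 1 #}"
    unfolding E1_def E2_def F1_def F2_def ij box_content_def using B by (auto simp: a1_def a2_def)
  have s1: "image_mset box_content (mset_set (addable D')) = image_mset box_content (mset_set (addable D - {b}))
     + (image_mset box_content (mset_set E1) + image_mset box_content (mset_set E2))"
    unfolding add using fin fE d1 by (simp add: mset_set_Union)
  have s2: "image_mset box_content (mset_set (removable D)) = image_mset box_content (mset_set (removable D' - {b}))
     + (image_mset box_content (mset_set F1) + image_mset box_content (mset_set F2))"
    unfolding rem using fin fE d2 by (simp add: mset_set_Union)
  have "image_mset box_content (mset_set (addable D')) + image_mset box_content (mset_set (removable D))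
    = image_mset box_content (mset_set (addable D - {b})) + image_mset box_content (mset_set (removable D' - {b}))
     + ((image_mset box_content (mset_set E2) + image_mset box_content (mset_set F2))
     + (image_mset box_content (mset_set E1) + image_mset box_content (mset_set F1)))"
    unfolding s1 s2 by (simp only: ac_simps)
  then show ?thesis unfolding e D'_def by simp
qed

lemma prod_addable_removable_update:
  fixes F :: "int \<Rightarrow> 'a::comm_monoid_mult"
  assumes "young D" "b \<in> addable D"
  shows "(\<Prod>x\<in>addable (insert b D). F (box_content x)) * (\<Prod>y\<in>removable D. F (box_content y))
    = (\<Prod>x\<in>addable D - {b}. F (box_content x)) * (\<Prod>y\<in>removable (insert b D) - {b}. F (box_content y))
      * (F (box_content b + 1) * F (box_content b - 1))"
proof -
  have "prod_mset (image_mset F (image_mset box_content (mset_set (addable (insert b D)))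
      + image_mset box_content (mset_set (removable D))))
    = prod_mset (image_mset F (image_mset box_content (mset_set (addable D - {b}))
      + image_mset box_content (mset_set (removable (insert b D) - {b})) + {# box_content b + 1, box_content b - 1 #}))"
    by (simp only: addable_removable_update[OF assms])
  then show ?thesis by (simp add: prod_unfold_prod_mset image_mset.compositionality comp_def ac_simps)
qed

lemma sum_addable_removable_update:
  fixes F :: "int \<Rightarrow> 'a::comm_monoid_add"
  assumes "young D" "b \<in> addable D"
  shows "(\<Sum>x\<in>addable (insert b D). F (box_content x)) + (\<Sum>y\<in>removable D. F (box_content y))
    = (\<Sum>x\<in>addable D - {b}. F (box_content x)) + (\<Sum>y\<in>removable (insert b D) - {b}. F (box_content y))
      + (F (box_content b + 1) + F (box_content b - 1))"
proof -
  have "sum_mset (image_mset F (image_mset box_content (mset_set (addable (insert b D)))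
      + image_mset box_content (mset_set (removable D))))
    = sum_mset (image_mset F (image_mset box_content (mset_set (addable D - {b}))
      + image_mset box_content (mset_set (removable (insert b D) - {b})) + {# box_content b + 1, box_content b - 1 #}))"
    by (simp only: addable_removable_update[OF assms])
  then show ?thesis by (simp add: sum_unfold_sum_mset image_mset.compositionality comp_def ac_simps)
qed

text \<open>Inserting \<open>b\<close> turns the content \<open>c\<close> of \<open>b\<close> from
  addable to removable and contributes \<open>c + 1\<close> and \<open>c - 1\<close>, so the
  difference grows by the second difference of \<open>W\<close> at \<open>c\<close>. The term
  \<open>W 0\<close> is the single addable box of the empty diagram.\<close>

lemma sum_addable_minus_removable:
  fixes W :: "int \<Rightarrow> real"
  assumes "young D"
  shows "(\<Sum>x\<in>addable D. W (box_content x)) - (\<Sum>y\<in>removable D. W (box_content y))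
    = W 0 + (\<Sum>b\<in>D. W (box_content b + 1) + W (box_content b - 1) - 2 * W (box_content b))"
  using assms
proof (induction rule: young_induct)
  case empty
  then show ?case by (simp add: addable_empty box_content_def)
next
  case (insert D b)
  have y: "young (insert b D)" "b \<notin> D" using insert.hyps by (auto simp: addable_def)
  note u = sum_addable_removable_update[OF insert.hyps, of W]
  have 1: "(\<Sum>x\<in>addable D. W (box_content x)) = W (box_content b) + (\<Sum>x\<in>addable D - {b}. W (box_content x))"
    using insert.hyps by (simp add: sum.remove[OF finite_addable])
  have 2: "(\<Sum>y\<in>removable (insert b D). W (box_content y))
      = W (box_content b) + (\<Sum>y\<in>removable (insert b D) - {b}. W (box_content y))"
    using removable_insert[OF insert.hyps] y by (simp add: sum.remove[OF finite_removable])
  have 3: "(\<Sum>b\<in>insert b D. W (box_content b + 1) + W (box_content b - 1) - 2 * W (box_content b))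
     = (W (box_content b + 1) + W (box_content b - 1) - 2 * W (box_content b))
      + (\<Sum>b\<in>D. W (box_content b + 1) + W (box_content b - 1) - 2 * W (box_content b))"
    by (rule sum.insert) (use y insert.hyps young_finite in auto)
  show ?case using u 1 2 3 insert.IH by linarith
qed


section \<open>Dimensions and the weighted up and down operators\<close>

definition SYT :: "(nat \<times> nat) set \<Rightarrow> (nat \<times> nat \<Rightarrow> nat) set" where
  "SYT D = {T. bij_betw T D {1..card D} \<and> T \<in> extensional D \<and>
      (\<forall>i j. (i,j) \<in> D \<and> (i,Suc j) \<in> D \<longrightarrow> T (i,j) < T (i,Suc j)) \<and>
      (\<forall>i j. (i,j) \<in> D \<and> (Suc i,j) \<in> D \<longrightarrow> T (i,j) < T (Suc i,j))}"

lemma dimY_eq: "dimY D = card (SYT D)"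
  by (simp add: dimY_def SYT_def)

lemma finite_SYT:
  assumes "finite D"
  shows "finite (SYT D)"
proof (rule finite_subset)
  show "SYT D \<subseteq> D \<rightarrow>\<^sub>E {1..card D}"
    by (auto simp: SYT_def PiE_def bij_betw_def)
  show "finite (D \<rightarrow>\<^sub>E {1..card D})" using assms by (intro finite_PiE) auto
qed

lemma dimY_empty [simp]: "dimY {} = 1"
proof -
  have "SYT {} = {\<lambda>_. undefined}" by (auto simp: SYT_def extensional_def bij_betw_def)
  then show ?thesis by (simp add: dimY_eq)
qed

lemma SYT_insert:
  assumes D: "young D" and b: "b \<in> removable D" and T: "T \<in> SYT (D - {b})"
  shows "T(b := card D) \<in> SYT D"
proof -
  have fin: "finite D" and bD: "b \<in> D" using D b by (auto simp: young_finite removable_def)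
  have c: "card (D - {b}) = card D - 1" "card D > 0" using fin bD by (auto simp: card_gt_0_iff)
  have bij: "bij_betw T (D - {b}) {1..card D - 1}" using T c by (simp add: SYT_def)
  have lt: "T x < card D" if "x \<in> D - {b}" for x
  proof -
    have "T x \<in> {1..card D - 1}" using bij_betwE[OF bij] that by blast
    then show ?thesis using c by auto
  qed
  have bij': "bij_betw (T(b := card D)) (D - {b}) {1..card D - 1}"
    by (rule bij_betw_cong[THEN iffD1, OF _ bij]) auto
  have "bij_betw (T(b := card D)) ((D - {b}) \<union> {b}) ({1..card D - 1} \<union> {card D})"
    by (rule bij_betw_combine[OF bij']) (use c in auto)
  moreover have "(D - {b}) \<union> {b} = D" "{1..card D - 1} \<union> {card D} = {1..card D}" using bD c by auto
  ultimately have "bij_betw (T(b := card D)) D {1..card D}" by simp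
  moreover have "T(b := card D) \<in> extensional D"
    using T bD by (auto simp: SYT_def extensional_def)
  moreover have "(T(b := card D)) (i, j) < (T(b := card D)) (i, Suc j)"
    if "(i, j) \<in> D" "(i, Suc j) \<in> D" for i j
  proof -
    have "b \<noteq> (i, j)" using b that removable_iff[OF D] by auto
    then show ?thesis using that lt[of "(i, j)"] T by (auto simp: SYT_def)
  qed
  moreover have "(T(b := card D)) (i, j) < (T(b := card D)) (Suc i, j)"
    if "(i, j) \<in> D" "(Suc i, j) \<in> D" for i j
  proof -
    have "b \<noteq> (i, j)" using b that removable_iff[OF D] by auto
    then show ?thesis using that lt[of "(i, j)"] T by (auto simp: SYT_def)
  qed
  ultimately show ?thesis by (simp add: SYT_def)
qed

lemma SYT_remove:
  assumes D: "young D" "D \<noteq> {}" and T: "T \<in> SYT D"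
  obtains b where "b \<in> removable D" "T b = card D" "T(b := undefined) \<in> SYT (D - {b})"
proof -
  have fin: "finite D" using D by (auto simp: young_finite)
  have c: "card D > 0" using fin D by (simp add: card_gt_0_iff)
  have bij: "bij_betw T D {1..card D}" using T by (simp add: SYT_def)
  have "card D \<in> T ` D" using bij c by (simp add: bij_betw_def)
  then obtain b where b: "b \<in> D" "T b = card D" by auto
  have le: "T x \<le> card D" if "x \<in> D" for x using bij_betwE[OF bij] that by auto
  obtain i j where ij: "b = (i, j)" by fastforce
  have "(i, Suc j) \<notin> D" using le[of "(i, Suc j)"] b T unfolding ij SYT_def by force
  moreover have "(Suc i, j) \<notin> D" using le[of "(Suc i, j)"] b T unfolding ij SYT_def by force
  ultimately have rem: "b \<in> removable D" using b ij removable_iff[OF D(1)] by simp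
  have "bij_betw T (D - {b}) ({1..card D} - {card D})"
    using bij_betw_DiffI[OF bij, of "{b}" "{card D}"] b c by (auto simp: bij_betw_def)
  moreover have "{1..card D} - {card D} = {1..card (D - {b})}" using fin b c by auto
  ultimately have "bij_betw T (D - {b}) {1..card (D - {b})}" by simp
  then have 1: "bij_betw (T(b := undefined)) (D - {b}) {1..card (D - {b})}"
    by (subst bij_betw_cong[where g=T]) auto
  have 2: "T(b := undefined) \<in> extensional (D - {b})"
    using T by (auto simp: SYT_def extensional_def)
  have 3: "T (i, j) < T (i, Suc j)" if "(i, j) \<in> D" "(i, Suc j) \<in> D" for i j
    using T that by (simp add: SYT_def)
  have 4: "T (i, j) < T (Suc i, j)" if "(i, j) \<in> D" "(Suc i, j) \<in> D" for i j
    using T that by (simp add: SYT_def)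
  have "T(b := undefined) \<in> SYT (D - {b})"
    unfolding SYT_def mem_Collect_eq
    by (intro conjI 1 2 allI impI) (simp_all add: 3 4)
  then show thesis using that rem b by blast
qed

text \<open>The branching rule: the largest entry of a standard tableau sits in a corner, and
  erasing it leaves a standard tableau of the smaller shape.\<close>

lemma dimY_rec:
  assumes D: "young D" "D \<noteq> {}"
  shows "dimY D = (\<Sum>b\<in>removable D. dimY (D - {b}))"
proof -
  have fin: "finite D" using D by (auto simp: young_finite)
  have c: "card D > 0" using fin D by (simp add: card_gt_0_iff)
  \<comment> \<open>An extensional tableau of shape \<open>D - {b}\<close> is
    \<open>undefined\<close> at \<open>b\<close>; \<open>f\<close> puts the largest entry there, and
    resetting the cell to \<open>undefined\<close> is the inverse.\<close>
  define f where "f = (\<lambda>(b, T). T(b := card D) :: nat \<times> nat \<Rightarrow> nat)"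
  have "bij_betw f (SIGMA b:removable D. SYT (D - {b})) (SYT D)"
  proof (rule bij_betwI')
    fix p q assume p: "p \<in> (SIGMA b:removable D. SYT (D - {b}))" and q: "q \<in> (SIGMA b:removable D. SYT (D - {b}))"
    obtain b T where e1: "p = (b, T)" by (cases p)
    obtain b' T' where e2: "q = (b', T')" by (cases q)
    note e = e1 e2
    have bb: "b \<in> D" "b' \<in> D" using p q e by (auto simp: removable_def)
    have T: "T \<in> SYT (D - {b})" "T' \<in> SYT (D - {b'})" using p q e by auto
    have "T \<in> extensional (D - {b})" "T' \<in> extensional (D - {b'})" using T by (simp_all add: SYT_def)
    then have 3: "T b = undefined" "T' b' = undefined" by (auto intro: extensional_arb)
    show "(f p = f q) = (p = q)"
    proof
      assume "f p = f q"
      then have eq: "T(b := card D) = T'(b' := card D)" by (simp add: f_def e)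
      have "b = b'"
      proof (rule ccontr)
        assume ne: "b \<noteq> b'"
        then have "T b' = card D" using fun_cong[OF eq, of b'] by simp
        moreover have "b' \<in> D - {b}" using bb ne by simp
        moreover have "bij_betw T (D - {b}) {1..card (D - {b})}" using T(1) by (simp add: SYT_def)
        ultimately have "card D \<in> {1..card (D - {b})}" using bij_betwE by metis
        then show False using fin bb c by auto
      qed
      moreover have "T = T'"
      proof
        fix x show "T x = T' x" using fun_cong[OF eq, of x] 3 \<open>b = b'\<close> by (cases "x = b") auto
      qed
      ultimately show "p = q" by (simp add: e)
    qed simp
  next
    fix p assume "p \<in> (SIGMA b:removable D. SYT (D - {b}))"
    then show "f p \<in> SYT D" using SYT_insert[OF D(1)] by (auto simp: f_def)
  next
    fix T assume T: "T \<in> SYT D"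
    obtain b where b: "b \<in> removable D" "T b = card D" "T(b := undefined) \<in> SYT (D - {b})"
      using SYT_remove[OF D T] .
    then show "\<exists>x\<in>SIGMA b:removable D. SYT (D - {b}). T = f x"
      by (intro bexI[of _ "(b, T(b := undefined))"]) (auto simp: f_def)
  qed
  then have "card (SYT D) = card (SIGMA b:removable D. SYT (D - {b}))" by (simp add: bij_betw_same_card)
  also have "\<dots> = (\<Sum>b\<in>removable D. card (SYT (D - {b})))"
    using finite_removable[OF D(1)] finite_SYT fin by (intro card_SigmaI) auto
  finally show ?thesis by (simp add: dimY_eq)
qed

lemma dimY_pos: "young D \<Longrightarrow> dimY D > 0"
proof (induction "card D" arbitrary: D)
  case 0
  then show ?case using young_finite[of D] by simp
next
  case (Suc n)
  then have ne: "D \<noteq> {}" by auto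
  obtain b where b: "b \<in> removable D" using ex_removable[OF Suc.prems ne] by blast
  have "dimY (D - {b}) > 0" using b Suc young_finite[of D] by (intro Suc.hyps(1)) (auto simp: removable_def)
  then show ?case
    unfolding dimY_rec[OF Suc.prems ne] using b finite_removable[OF Suc.prems] by (meson sum_pos2 zero_le)
qed

lemma finite_YD: "finite (YD n)"
proof (rule finite_subset)
  show "YD n \<subseteq> Pow ({1..n} \<times> {1..n})"
  proof clarify
    fix D i j assume D: "D \<in> YD n" "(i, j) \<in> D"
    then have y: "young D" "card D = n" by (auto simp: YD_def)
    have 1: "1 \<le> i" "1 \<le> j" using youngD(1,2)[OF y(1) D(2)] by auto
    have "(\<lambda>i'. (i', j)) ` {1..i} \<subseteq> D" using youngD(3)[OF y(1) D(2)] 1 by auto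
    then have "card ((\<lambda>i'. (i', j)) ` {1..i}) \<le> card D" by (rule card_mono[OF young_finite[OF y(1)]])
    moreover have "(\<lambda>j'. (i, j')) ` {1..j} \<subseteq> D" using youngD(3)[OF y(1) D(2)] 1 by auto
    then have "card ((\<lambda>j'. (i, j')) ` {1..j}) \<le> card D" by (rule card_mono[OF young_finite[OF y(1)]])
    ultimately show "i \<in> {1..n} \<and> j \<in> {1..n}" using 1 y by (simp add: card_image inj_on_def)
  qed
qed simp

section \<open>Weighted up and down operators and their commutation\<close>

definition down :: "((nat \<times> nat) set \<Rightarrow> real) \<Rightarrow> (nat \<times> nat) set \<Rightarrow> real" where
  "down g D = (\<Sum>b\<in>removable D. real (dimY (D - {b})) / real (dimY D) * g (D - {b}))"

text \<open>The weight is left free since two choices are needed: \<open>1 / (u - c)\<close> makes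
  \<open>up\<close> of the constant \<open>1\<close> a multiple of the Stieltjes transform of the
  transition measure, while \<open>(z + c) * (z' + c)\<close> gives the up transitions of the chain,
  up to a factor depending on the size only.\<close>

definition up :: "(int \<Rightarrow> real) \<Rightarrow> ((nat \<times> nat) set \<Rightarrow> real) \<Rightarrow> (nat \<times> nat) set \<Rightarrow> real" where
  "up w g D = (\<Sum>b\<in>addable D. w (box_content b) * (real (dimY (insert b D)) / real (dimY D)) * g (insert b D))"

lemma removable_young: "b \<in> removable D \<Longrightarrow> young (D - {b})"
  by (simp add: removable_def)

lemma addable_young: "b \<in> addable D \<Longrightarrow> young (insert b D)"
  by (simp add: addable_def)

text \<open>Adding \<open>x\<close> and then removing \<open>y \<noteq> x\<close> leads to the same
  diagram with the same coefficient as removing \<open>y\<close> first, so these paths cancel in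
  pairs. What remains are the returns to \<open>D\<close>, weighted by \<open>w\<close> over addable
  boxes on one side and over removable boxes on the other; their difference is
  \<open>sum_addable_minus_removable\<close>.\<close>

lemma up_down:
  assumes D: "young D"
  shows "up w (down g) D = (w 0 + (\<Sum>b\<in>D. w (box_content b + 1) + w (box_content b - 1) - 2 * w (box_content b))) * g D
     + down (up w g) D"
proof -
  define d where "d D = real (dimY D)" for D
  have dpos: "d D > 0" if "young D" for D using dimY_pos[OF that] by (simp add: d_def)
  define S where "S = {(x, y). x \<noteq> y \<and> x \<in> addable D \<and> y \<in> removable (insert x D)}"
  have S1: "S = (SIGMA x:addable D. removable (insert x D) - {x})" by (auto simp: S_def)
  have S2: "(\<lambda>(y, x). (x, y)) ` (SIGMA y:removable D. addable (D - {y}) - {y}) = S"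
  proof -
    have "(y \<in> removable D \<and> x \<in> addable (D - {y})) \<longleftrightarrow> (x \<in> addable D \<and> y \<in> removable (insert x D))"
      if ne: "x \<noteq> y" for x y
    proof
      assume h: "y \<in> removable D \<and> x \<in> addable (D - {y})"
      have x: "x \<notin> D" "y \<in> D" using h ne by (auto simp: removable_def addable_def)
      \<comment> \<open>Diagrams are closed under union and intersection, which completes the square
        formed by \<open>D - {y}\<close>, \<open>D\<close>, \<open>insert x D - {y}\<close> and
        \<open>insert x D\<close> from either side.\<close>
      have "young (D \<union> insert x (D - {y}))" using h D by (intro young_Un) (auto simp: addable_def)
      moreover have "D \<union> insert x (D - {y}) = insert x D" by auto
      moreover have "insert x (D - {y}) = insert x D - {y}" using ne by auto
      ultimately show "x \<in> addable D \<and> y \<in> removable (insert x D)"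
        using h x by (auto simp: removable_def addable_def)
    next
      assume h: "x \<in> addable D \<and> y \<in> removable (insert x D)"
      have x: "x \<notin> D" "y \<in> D" using h ne by (auto simp: removable_def addable_def)
      have "young (D \<inter> (insert x D - {y}))" using h D by (intro young_Int) (auto simp: removable_def)
      moreover have "D \<inter> (insert x D - {y}) = D - {y}" using x by auto
      moreover have "insert x (D - {y}) = insert x D - {y}" using ne by auto
      ultimately show "y \<in> removable D \<and> x \<in> addable (D - {y})"
        using h x by (auto simp: removable_def addable_def)
    qed
    then have key: "(x \<noteq> y \<and> y \<in> removable D \<and> x \<in> addable (D - {y})) \<longleftrightarrow> (x \<noteq> y \<and> x \<in> addable D \<and> y \<in> removable (insert x D))"
      for x y by blast
    have "(\<lambda>(y, x). (x, y)) ` (SIGMA y:removable D. addable (D - {y}) - {y})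
      = {(x, y). x \<noteq> y \<and> y \<in> removable D \<and> x \<in> addable (D - {y})}"
      by (auto simp: image_iff)
    then show ?thesis unfolding S_def key .
  qed
  \<comment> \<open>The dimension of the intermediate diagram cancels, and the weight sees only the
    added box; hence \<open>F x y\<close> is the term for both orders.\<close>
  define F where "F = (\<lambda>x y. w (box_content x) * (d (insert x D - {y}) / d D) * g (insert x D - {y}))"
  have "up w (down g) D = (\<Sum>x\<in>addable D. w (box_content x) * g D + (\<Sum>y\<in>removable (insert x D) - {x}. F x y))"
    unfolding up_def
  proof (rule sum.cong)
    fix x assume x: "x \<in> addable D"
    have y: "young (insert x D)" and xn: "x \<notin> D" using x by (auto simp: addable_def)
    have p: "d (insert x D) > 0" "d D > 0" using dpos y D by auto
    have "w (box_content x) * (real (dimY (insert x D)) / real (dimY D)) * down g (insert x D)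
      = (\<Sum>y\<in>removable (insert x D). F x y)"
      unfolding down_def sum_distrib_left F_def using p by (intro sum.cong) (auto simp: d_def)
    also have "\<dots> = F x x + (\<Sum>y\<in>removable (insert x D) - {x}. F x y)"
      using removable_insert[OF D x] finite_removable[OF y] by (simp add: sum.remove)
    also have "F x x = w (box_content x) * g D" using xn p by (simp add: F_def)
    finally show "w (box_content x) * (real (dimY (insert x D)) / real (dimY D)) * down g (insert x D)
      = w (box_content x) * g D + (\<Sum>y\<in>removable (insert x D) - {x}. F x y)" .
  qed simp
  also have "\<dots> = (\<Sum>x\<in>addable D. w (box_content x)) * g D + (\<Sum>(x, y)\<in>S. F x y)"
    unfolding S1 using finite_addable[OF D] finite_removable addable_young
    by (simp add: sum.distrib sum_distrib_right sum.Sigma)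
  finally have 1: "up w (down g) D = (\<Sum>x\<in>addable D. w (box_content x)) * g D + (\<Sum>(x, y)\<in>S. F x y)" .
  have "down (up w g) D = (\<Sum>y\<in>removable D. w (box_content y) * g D + (\<Sum>x\<in>addable (D - {y}) - {y}. F x y))"
    unfolding down_def
  proof (rule sum.cong)
    fix y assume y: "y \<in> removable D"
    have yy: "young (D - {y})" and yD: "y \<in> D" using y by (auto simp: removable_def)
    have p: "d (D - {y}) > 0" "d D > 0" using dpos yy D by auto
    define G where "G x = w (box_content x) * (d (insert x (D - {y})) / d D) * g (insert x (D - {y}))" for x
    have "real (dimY (D - {y})) / real (dimY D) * up w g (D - {y}) = (\<Sum>x\<in>addable (D - {y}). G x)"
      unfolding up_def sum_distrib_left G_def using p by (intro sum.cong) (auto simp: d_def)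
    also have "\<dots> = G y + (\<Sum>x\<in>addable (D - {y}) - {y}. G x)"
      using addable_Diff[OF D y] finite_addable[OF yy] by (simp add: sum.remove)
    also have "G y = w (box_content y) * g D" using yD p by (simp add: G_def insert_absorb)
    also have "(\<Sum>x\<in>addable (D - {y}) - {y}. G x) = (\<Sum>x\<in>addable (D - {y}) - {y}. F x y)"
      by (rule sum.cong) (auto simp: F_def G_def insert_Diff_if)
    finally show "real (dimY (D - {y})) / real (dimY D) * up w g (D - {y})
      = w (box_content y) * g D + (\<Sum>x\<in>addable (D - {y}) - {y}. F x y)" .
  qed simp
  also have "\<dots> = (\<Sum>y\<in>removable D. w (box_content y)) * g D + (\<Sum>(y, x)\<in>(SIGMA y:removable D. addable (D - {y}) - {y}). F x y)"
    using finite_removable[OF D] finite_addable removable_young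
    by (simp add: sum.distrib sum_distrib_right sum.Sigma)
  also have "(\<Sum>(y, x)\<in>(SIGMA y:removable D. addable (D - {y}) - {y}). F x y) = (\<Sum>(x, y)\<in>S. F x y)"
    unfolding S2[symmetric] by (subst sum.reindex) (auto simp: inj_on_def intro!: sum.cong)
  finally have 2: "down (up w g) D = (\<Sum>y\<in>removable D. w (box_content y)) * g D + (\<Sum>(x, y)\<in>S. F x y)" .
  show ?thesis using 1 2 sum_addable_minus_removable[OF D, of w] by (simp add: algebra_simps)
qed

lemma down_weights:
  assumes "young D" "D \<noteq> {}"
  shows "(\<Sum>b\<in>removable D. real (dimY (D - {b})) / real (dimY D)) = 1"
proof -
  have "(\<Sum>b\<in>removable D. real (dimY (D - {b})) / real (dimY D)) = real (dimY D) / real (dimY D)"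
    by (subst (2) dimY_rec[OF assms]) (simp add: sum_divide_distrib)
  then show ?thesis using dimY_pos[OF assms(1)] by simp
qed

lemma down_const: "young D \<Longrightarrow> D \<noteq> {} \<Longrightarrow> down (\<lambda>_. c) D = c"
  unfolding down_def sum_distrib_right[symmetric] by (simp add: down_weights)

text \<open>No step leads down from the empty diagram and the sum is empty. Constants are thus
  preserved only as long as boxes remain, whence the size hypotheses of \<open>down_const\<close>
  and \<open>down_pow_const\<close>.\<close>

lemma down_empty [simp]: "down g {} = 0"
  by (simp add: down_def)

lemma down_mono:
  assumes "\<And>b. b \<in> removable D \<Longrightarrow> f (D - {b}) \<le> g (D - {b})"
  shows "down f D \<le> down g D"
  unfolding down_def using assms by (intro sum_mono mult_left_mono) auto

lemma down_add: "down (\<lambda>x. f x + g x) D = down f D + down g D"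
  by (simp add: down_def algebra_simps sum.distrib)

lemma down_cmult: "down (\<lambda>x. c * f x) D = c * down f D"
  by (simp add: down_def algebra_simps sum_distrib_left)

lemma up_add: "up w (\<lambda>x. f x + g x) D = up w f D + up w g D"
  by (simp add: up_def distrib_left sum.distrib)

lemma up_cmult: "up w (\<lambda>x. c * f x) D = c * up w f D"
  by (simp add: up_def algebra_simps sum_distrib_left)

lemma down_cong:
  assumes "\<And>b. b \<in> removable D \<Longrightarrow> f (D - {b}) = g (D - {b})"
  shows "down f D = down g D"
  unfolding down_def using assms by (intro sum.cong) auto

lemma up_cong:
  assumes "\<And>b. b \<in> addable D \<Longrightarrow> f (insert b D) = g (insert b D)"
  shows "up w f D = up w g D"
  unfolding up_def using assms by (intro sum.cong) auto

lemma card_removable: "young D \<Longrightarrow> b \<in> removable D \<Longrightarrow> card (D - {b}) = card D - 1"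
  using young_finite[of D] by (auto simp: removable_def)

lemma card_addable: "young D \<Longrightarrow> b \<in> addable D \<Longrightarrow> card (insert b D) = Suc (card D)"
  using young_finite[of D] by (auto simp: addable_def)


section \<open>The transition and co-transition measures\<close>

text \<open>Kerov's rational function, the quotient of the products of \<open>u - c\<close> over
  addable and over removable contents (\<open>Kfun_removable\<close>). In this form as a product
  over boxes a new box changes it by one factor.\<close>

definition Kfun :: "(nat \<times> nat) set \<Rightarrow> real \<Rightarrow> real" where
  "Kfun D u = u * (\<Prod>b\<in>D. 1 - 1 / (u - box_content b)\<^sup>2)"

text \<open>The diagonal term of \<open>up_down\<close> for the weight \<open>1 / (u - c)\<close>.
  That it is also the logarithmic derivative of \<open>Kfun\<close> (\<open>Kfun_deriv\<close>) is
  what makes the induction close.\<close>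

definition Lfun :: "(nat \<times> nat) set \<Rightarrow> real \<Rightarrow> real" where
  "Lfun D u = 1 / u + (\<Sum>b\<in>D. 1 / (u - (box_content b + 1)) + 1 / (u - (box_content b - 1)) - 2 / (u - box_content b))"

lemma Kfun_insert:
  "finite D \<Longrightarrow> b \<notin> D \<Longrightarrow> Kfun (insert b D) u = Kfun D u * (1 - 1 / (u - box_content b)\<^sup>2)"
  by (simp add: Kfun_def)

lemma real_content_less_card:
  assumes "young D" "b \<in> D"
  shows "\<bar>real_of_int (box_content b)\<bar> + 1 \<le> real (card D)"
  using content_less_card[OF assms] by linarith

lemma real_content_addable:
  assumes "young D" "b \<in> addable D"
  shows "\<bar>real_of_int (box_content b)\<bar> \<le> real (card D)"
  using content_addable_le_card[OF assms] by linarith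

lemma Kfun_nonzero:
  assumes "young D" "\<bar>u\<bar> > real (card D)"
  shows "Kfun D u \<noteq> 0"
proof -
  have "1 - 1 / (u - box_content b)\<^sup>2 \<noteq> 0" if "b \<in> D" for b
  proof
    assume "1 - 1 / (u - box_content b)\<^sup>2 = 0"
    then have "(u - box_content b)\<^sup>2 = 1" by (auto simp: divide_simps split: if_splits)
    then have "u - box_content b = 1 \<or> u - box_content b = - 1" by (simp add: power2_eq_1_iff)
    then show False using real_content_less_card[OF assms(1) that] assms(2) by linarith
  qed
  then show ?thesis using assms by (auto simp: Kfun_def young_finite)
qed

text \<open>With \<open>v = u - c\<close>, a new box of content \<open>c\<close> multiplies
  \<open>Kfun\<close> by \<open>(v - 1) * (v + 1) / v^2\<close>, which is the change of the quotient
  of corner products according to \<open>prod_addable_removable_update\<close>.\<close>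

lemma Kfun_removable:
  assumes D: "young D" and u: "\<bar>u\<bar> > real (card D)"
  shows "Kfun D u * (\<Prod>y\<in>removable D. u - box_content y) = (\<Prod>x\<in>addable D. u - box_content x)"
  using D u
proof (induction rule: young_induct)
  case empty
  then show ?case by (simp add: Kfun_def addable_empty box_content_def)
next
  case (insert D b)
  have y: "young (insert b D)" "b \<notin> D" and c: "card (insert b D) = Suc (card D)"
    using insert.hyps card_addable by (auto simp: addable_def)
  define v where "v = u - box_content b"
  have "v \<noteq> 0" using real_content_less_card[OF y(1), of b] insert.prems by (auto simp: v_def)
  have R0: "(\<Prod>y\<in>removable D. u - box_content y) \<noteq> 0"
  proof -
    have "u - box_content y \<noteq> 0" if "y \<in> removable D" for y
      using real_content_less_card[OF insert.hyps(1), of y] that insert.prems c by (auto simp: removable_def)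
    then show ?thesis using finite_removable[OF insert.hyps(1)] by simp
  qed
  note up = prod_addable_removable_update[OF insert.hyps, of "\<lambda>c. u - real_of_int c"]
  have 1: "(\<Prod>x\<in>addable D. u - box_content x) = v * (\<Prod>x\<in>addable D - {b}. u - box_content x)"
    unfolding v_def using insert.hyps by (simp add: prod.remove[OF finite_addable])
  have 2: "(\<Prod>y\<in>removable (insert b D). u - box_content y)
      = v * (\<Prod>y\<in>removable (insert b D) - {b}. u - box_content y)"
    unfolding v_def using removable_insert[OF insert.hyps] y by (simp add: prod.remove[OF finite_removable])
  have IH: "Kfun D u * (\<Prod>y\<in>removable D. u - box_content y) = v * (\<Prod>x\<in>addable D - {b}. u - box_content x)"
    using insert.IH insert.prems c 1 by simp
  have 3: "(u - real_of_int (box_content b + 1)) * (u - real_of_int (box_content b - 1)) = v\<^sup>2 - 1"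
    by (simp add: v_def power2_eq_square algebra_simps)
  have "(Kfun (insert b D) u * (\<Prod>y\<in>removable (insert b D). u - box_content y)) * (\<Prod>y\<in>removable D. u - box_content y)
     = (Kfun D u * (\<Prod>y\<in>removable D. u - box_content y)) * (1 - 1 / v\<^sup>2) * v * (\<Prod>y\<in>removable (insert b D) - {b}. u - box_content y)"
    unfolding 2 using y insert.hyps by (simp add: Kfun_insert young_finite v_def)
  also have "\<dots> = (v\<^sup>2 - 1) * (\<Prod>x\<in>addable D - {b}. u - box_content x) * (\<Prod>y\<in>removable (insert b D) - {b}. u - box_content y)"
    unfolding IH using \<open>v \<noteq> 0\<close> by (simp add: field_simps power2_eq_square)
  also have "\<dots> = (\<Prod>x\<in>addable (insert b D). u - box_content x) * (\<Prod>y\<in>removable D. u - box_content y)"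
    using up 3 by simp
  finally show ?case using R0 by simp
qed

text \<open>Each factor \<open>1 - 1 / v^2 = (v - 1) * (v + 1) / v^2\<close> has logarithmic
  derivative \<open>1 / (v - 1) + 1 / (v + 1) - 2 / v\<close>, and the prefactor \<open>u\<close>
  contributes \<open>1 / u\<close>.\<close>

lemma Kfun_deriv:
  fixes u :: real
  assumes "finite D" "u \<noteq> 0" "\<And>b. b \<in> D \<Longrightarrow> \<bar>u - box_content b\<bar> > 1"
  shows "(Kfun D has_real_derivative Kfun D u * Lfun D u) (at u)"
  using assms
proof (induction D rule: finite_induct)
  case empty
  then show ?case by (auto simp: Kfun_def[abs_def] Lfun_def)
next
  case (insert b D)
  define c where "c = real_of_int (box_content b)"
  define v where "v = u - c"
  have v: "\<bar>v\<bar> > 1" using insert.prems by (auto simp: v_def c_def)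
  then have nz: "v \<noteq> 0" "v + 1 \<noteq> 0" "v - 1 \<noteq> 0" "v\<^sup>2 - 1 \<noteq> 0"
    by (auto simp: power2_eq_1_iff)
  have *: "Kfun (insert b D) = (\<lambda>u. Kfun D u * (1 - 1 / (u - c)\<^sup>2))"
    using insert.hyps by (intro ext) (simp add: Kfun_insert c_def)
  have d: "((\<lambda>u. 1 - 1 / (u - c)\<^sup>2) has_real_derivative 2 / v ^ 3) (at u)"
  proof -
    have "((\<lambda>u. 1 - 1 / (u - c)\<^sup>2) has_real_derivative 0 - (0 * (u - c)\<^sup>2 - 1 * (2 * (u - c))) / ((u - c)\<^sup>2 * (u - c)\<^sup>2)) (at u)"
      using nz by (auto intro!: derivative_eq_intros simp: v_def)
    moreover have "0 - (0 * (u - c)\<^sup>2 - 1 * (2 * (u - c))) / ((u - c)\<^sup>2 * (u - c)\<^sup>2) = 2 / v ^ 3"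
      using nz by (simp add: v_def power2_eq_square power3_eq_cube divide_simps)
    ultimately show ?thesis by simp
  qed
  have e: "2 / v ^ 3 = (1 - 1 / v\<^sup>2) * (1 / (v - 1) + 1 / (v + 1) - 2 / v)"
  proof -
    have 1: "1 / (v - 1) + 1 / (v + 1) - 2 / v = 2 / (v * (v\<^sup>2 - 1))"
      using nz by (simp add: divide_simps) (simp add: power2_eq_square algebra_simps)
    show ?thesis unfolding 1 using nz by (simp add: divide_simps power2_eq_square power3_eq_cube)
  qed
  have IH: "(Kfun D has_real_derivative Kfun D u * Lfun D u) (at u)" using insert by auto
  have L: "Lfun (insert b D) u = (1 / (v - 1) + 1 / (v + 1) - 2 / v) + Lfun D u"
    using insert.hyps by (simp add: Lfun_def v_def c_def algebra_simps)
  have "((\<lambda>u. Kfun D u * (1 - 1 / (u - c)\<^sup>2)) has_real_derivative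
      (Kfun D u * Lfun D u) * (1 - 1 / (u - c)\<^sup>2) + 2 / v ^ 3 * Kfun D u) (at u)"
    by (rule DERIV_mult[OF IH d])
  also have "(Kfun D u * Lfun D u) * (1 - 1 / (u - c)\<^sup>2) + 2 / v ^ 3 * Kfun D u
     = Kfun (insert b D) u * Lfun (insert b D) u"
  proof -
    have g: "K * L0 * q + q * m * K = K * q * (m + L0)" for K L0 q m :: real by (simp add: algebra_simps)
    show ?thesis unfolding e L * using g[of _ _ "1 - 1 / v\<^sup>2"] by (simp add: v_def)
  qed
  finally show ?case unfolding * .
qed

text \<open>The transition measure gives an addable \<open>b\<close> the mass
  \<open>dimY (insert b D) / ((card D + 1) * dimY D)\<close>; the identity says that its Stieltjes
  transform is \<open>1 / Kfun D u\<close>. The bound keeps \<open>u\<close> beyond all contents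
  involved.\<close>

definition transition_id :: "(nat \<times> nat) set \<Rightarrow> bool" where
  "transition_id D \<longleftrightarrow> (\<forall>u. \<bar>u\<bar> > real (card D) + 1 \<longrightarrow>
     up (\<lambda>c. 1 / (u - real_of_int c)) (\<lambda>_. 1) D * Kfun D u = real (card D) + 1)"

text \<open>The partial fraction expansion of \<open>Kfun\<close>: the residue at the content of a
  removable box is minus \<open>card D\<close> times the probability of removing that box.\<close>

definition cotransition_id :: "(nat \<times> nat) set \<Rightarrow> bool" where
  "cotransition_id D \<longleftrightarrow> (\<forall>u. \<bar>u\<bar> > real (card D) \<longrightarrow>
     (\<Sum>y\<in>removable D. real (card D) * (real (dimY (D - {y})) / real (dimY D)) / (u - box_content y)) = u - Kfun D u)"

text \<open>Apply \<open>up_down\<close> to the constant function \<open>1\<close>. The inductive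
  hypothesis turns the down term, times \<open>Kfun D u\<close>, into \<open>n\<close> minus the sum
  of \<open>n * p y / (u - c)^2\<close>, which by differentiating \<open>cotransition_id D\<close>
  equals \<open>n - (K * L - 1)\<close>. The diagonal term contributes \<open>K * L\<close>, so
  \<open>n + 1\<close> is left.\<close>

lemma transition_id_step:
  assumes D: "young D" and co: "cotransition_id D"
    and tr: "\<And>y. y \<in> removable D \<Longrightarrow> transition_id (D - {y})"
  shows "transition_id D"
  unfolding transition_id_def
proof (intro allI impI)
  fix u :: real assume u: "\<bar>u\<bar> > real (card D) + 1"
  define n where "n = real (card D)"
  define p where "p y = real (dimY (D - {y})) / real (dimY D)" for y
  define w where "w c = 1 / (u - real_of_int c)" for c
  have fin: "finite D" using D by (simp add: young_finite)
  have K0: "Kfun D u \<noteq> 0" using Kfun_nonzero[OF D] u by simp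
  have c1: "\<bar>v - box_content b\<bar> > 1" if "b \<in> D" "\<bar>v\<bar> > n" for b v
    using real_content_less_card[OF D that(1)] that(2) by (auto simp: n_def)
  have dK: "(Kfun D has_real_derivative Kfun D u * Lfun D u) (at u)"
    using u by (intro Kfun_deriv fin) (auto simp: n_def intro!: c1)
  have rem: "removable D \<subseteq> D" by (auto simp: removable_def)
  have "((\<lambda>v. \<Sum>y\<in>removable D. n * p y / (v - box_content y)) has_real_derivative
     (\<Sum>y\<in>removable D. - (n * p y / (u - box_content y)\<^sup>2))) (at u)"
  proof (rule DERIV_sum)
    fix y assume "y \<in> removable D"
    then have "u - box_content y \<noteq> 0" using c1[of y u] u rem by (auto simp: n_def)
    then show "((\<lambda>v. n * p y / (v - box_content y)) has_real_derivative - (n * p y / (u - box_content y)\<^sup>2)) (at u)"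
      by (auto intro!: derivative_eq_intros simp: power2_eq_square divide_simps)
  qed
  moreover have "((\<lambda>v. v - Kfun D v) has_real_derivative 1 - Kfun D u * Lfun D u) (at u)"
    using dK by (auto intro!: derivative_eq_intros)
  \<comment> \<open>The co-transition identity holds on an open set around \<open>u\<close>, so its
    two sides have the same derivative there.\<close>
  moreover have "((\<lambda>v. \<Sum>y\<in>removable D. n * p y / (v - box_content y)) has_real_derivative 1 - Kfun D u * Lfun D u) (at u)"
  proof (rule has_field_derivative_transform_within_open)
    show "((\<lambda>v. v - Kfun D v) has_real_derivative 1 - Kfun D u * Lfun D u) (at u)" by fact
    show "open {v. \<bar>v\<bar> > n}" by (intro open_Collect_less continuous_intros)
    show "u \<in> {v. \<bar>v\<bar> > n}" using u by (simp add: n_def)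
    show "v - Kfun D v = (\<Sum>y\<in>removable D. n * p y / (v - box_content y))" if "v \<in> {v. \<bar>v\<bar> > n}" for v
      using co that unfolding cotransition_id_def n_def p_def by auto
  qed
  ultimately have key: "(\<Sum>y\<in>removable D. n * p y / (u - box_content y)\<^sup>2) = Kfun D u * Lfun D u - 1"
    using DERIV_unique by (fastforce simp: sum_negf)
  have dn1: "down (\<lambda>_. 1) D' = 1" if "young D'" "D' \<noteq> {}" for D' using down_const[OF that] .
  \<comment> \<open>The constant \<open>1\<close> equals its own \<open>down\<close> on the
    non-empty diagrams \<open>insert b D\<close>; this brings the left side into the form of
    \<open>up_down\<close>.\<close>
  have U: "up w (\<lambda>_. 1) D = up w (down (\<lambda>_. 1)) D"
    using addable_young by (intro up_cong) (simp add: dn1)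
  have L: "w 0 + (\<Sum>b\<in>D. w (box_content b + 1) + w (box_content b - 1) - 2 * w (box_content b)) = Lfun D u"
    by (simp add: w_def Lfun_def)
  have "down (up w (\<lambda>_. 1)) D * Kfun D u = (\<Sum>y\<in>removable D. n * p y - n * p y / (u - box_content y)\<^sup>2)"
    unfolding down_def sum_distrib_right
  proof (rule sum.cong)
    fix y assume y: "y \<in> removable D"
    have yD: "y \<in> D" "young (D - {y})" using y by (auto simp: removable_def)
    have cd: "card (D - {y}) = card D - 1" "card D \<ge> 1" using yD fin card_gt_0_iff[of D] by auto
    have "up w (\<lambda>_. 1) (D - {y}) * Kfun (D - {y}) u = n"
      using tr[OF y] u cd unfolding transition_id_def w_def n_def by auto
    moreover have "Kfun D u = Kfun (D - {y}) u * (1 - 1 / (u - box_content y)\<^sup>2)"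
      using Kfun_insert[of "D - {y}" y u] fin yD by (simp add: insert_absorb)
    ultimately have "up w (\<lambda>_. 1) (D - {y}) * Kfun D u = n * (1 - 1 / (u - box_content y)\<^sup>2)" by simp
    then have "p y * (up w (\<lambda>_. 1) (D - {y}) * Kfun D u) = p y * (n * (1 - 1 / (u - box_content y)\<^sup>2))" by simp
    then have "p y * (up w (\<lambda>_. 1) (D - {y}) * Kfun D u) = n * p y - n * p y / (u - box_content y)\<^sup>2"
      by (simp add: algebra_simps)
    then show "real (dimY (D - {y})) / real (dimY D) * up w (\<lambda>_. 1) (D - {y}) * Kfun D u
       = n * p y - n * p y / (u - box_content y)\<^sup>2" by (simp add: p_def)
  qed simp
  also have "\<dots> = n * (\<Sum>y\<in>removable D. p y) - (Kfun D u * Lfun D u - 1)"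
    unfolding sum_subtractf key by (simp add: sum_distrib_left)
  also have "n * (\<Sum>y\<in>removable D. p y) = n"
  proof (cases "D = {}")
    case True then show ?thesis by (simp add: n_def)
  next
    case False then show ?thesis using down_weights[OF D False] by (simp add: p_def)
  qed
  finally have dn: "down (up w (\<lambda>_. 1)) D * Kfun D u = n - (Kfun D u * Lfun D u - 1)" .
  have "up w (\<lambda>_. 1) D * Kfun D u = n + 1"
    unfolding U up_down[OF D] L using dn by (simp add: algebra_simps)
  then show "up (\<lambda>c. 1 / (u - real_of_int c)) (\<lambda>_. 1) D * Kfun D u = real (card D) + 1"
    by (simp add: w_def[abs_def] n_def)
qed

text \<open>A non-zero \<open>p\<close> with at least \<open>degree q\<close> distinct roots has
  degree at least that of \<open>q\<close>, so \<open>p / q\<close> could not vanish at infinity.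
  This replaces a comparison of poles by counting roots.\<close>

lemma poly_eq_0_if_ratio_tendsto_0:
  fixes p q :: "real poly"
  assumes "finite R" "\<And>r. r \<in> R \<Longrightarrow> poly p r = 0" "q \<noteq> 0" "degree q \<le> card R"
    and lim: "((\<lambda>u. poly p u / poly q u) \<longlongrightarrow> 0) at_top"
  shows "p = 0"
proof (rule ccontr)
  assume p: "p \<noteq> 0"
  have "card R \<le> card {x. poly p x = 0}" using assms poly_roots_finite[OF p] by (intro card_mono) auto
  also have "\<dots> \<le> degree p" by (rule card_poly_roots_bound[OF p])
  finally have dp: "degree q \<le> degree p" using assms by simp
  have a: "((\<lambda>u. poly p u / u ^ degree p) \<longlongrightarrow> lead_coeff p) at_top"
    using poly_divide_tendsto_aux[of p] at_top_le_at_infinity tendsto_mono by blast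
  have b: "((\<lambda>u. poly q u / u ^ degree q) \<longlongrightarrow> lead_coeff q) at_top"
    using poly_divide_tendsto_aux[of q] at_top_le_at_infinity tendsto_mono by blast
  have "((\<lambda>u. (poly p u / poly q u) * (poly q u / u ^ degree q)) \<longlongrightarrow> 0 * lead_coeff q) at_top"
    by (intro tendsto_mult lim b)
  then have c: "((\<lambda>u. (poly p u / poly q u) * (poly q u / u ^ degree q)) \<longlongrightarrow> 0) at_top" by simp
  have "((\<lambda>u. poly p u / u ^ degree p) \<longlongrightarrow> 0) at_top"
  proof (rule Lim_null_comparison[OF _ tendsto_norm_zero[OF c]])
    have "eventually (\<lambda>u. poly q u \<noteq> 0) at_top"
      using tendsto_imp_eventually_ne[OF b, of 0] \<open>q \<noteq> 0\<close> by (auto elim: eventually_mono)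
    then show "eventually (\<lambda>u. norm (poly p u / u ^ degree p) \<le> norm (poly p u / poly q u * (poly q u / u ^ degree q))) at_top"
      using eventually_ge_at_top[of 1]
    proof eventually_elim
      case (elim u)
      have "u ^ degree q \<le> u ^ degree p" using elim dp by (intro power_increasing) auto
      then show ?case using elim by (auto simp: abs_mult intro!: divide_left_mono mult_pos_pos)
    qed
  qed
  then have "lead_coeff p = 0" using tendsto_unique[OF _ a] by auto
  then show False using p by simp
qed


lemma Kfun_minus_id_tendsto:
  assumes "finite D"
  shows "((\<lambda>u. u - Kfun D u) \<longlongrightarrow> 0) at_top"
  using assms
proof (induction D rule: finite_induct)
  case empty
  then show ?case by (simp add: Kfun_def)
next
  case (insert b D)
  define c where "c = real_of_int (box_content b)"
  have 1: "((\<lambda>u. 1 - 1 / (u - c)\<^sup>2) \<longlongrightarrow> 1) at_top" by real_asymp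
  have 2: "((\<lambda>u. u / (u - c)\<^sup>2) \<longlongrightarrow> 0) at_top" by real_asymp
  have "((\<lambda>u. (u - Kfun D u) * (1 - 1 / (u - c)\<^sup>2) + u / (u - c)\<^sup>2) \<longlongrightarrow> 0 * 1 + 0) at_top"
    by (intro tendsto_intros 1 2 insert.IH)
  moreover have "(u - Kfun D u) * (1 - 1 / (u - c)\<^sup>2) + u / (u - c)\<^sup>2 = u - Kfun (insert b D) u" for u
    using insert.hyps by (simp add: Kfun_insert c_def algebra_simps add_divide_distrib[symmetric])
  ultimately show ?case by simp
qed

lemma poly_eq_of_large:
  fixes p q :: "real poly"
  assumes "\<And>u. u > r \<Longrightarrow> poly p u = poly q u"
  shows "p = q"
proof (rule ccontr)
  assume "p \<noteq> q"
  then have "finite {u. poly (p - q) u = 0}" by (intro poly_roots_finite) simp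
  then have "finite {r<..}" by (rule rev_finite_subset) (use assms in auto)
  then show False by (simp add: infinite_Ioi)
qed

text \<open>The residue of the transition identity at the content of \<open>b\<close>, found
  algebraically: clearing denominators gives two polynomials that agree for large \<open>u\<close>,
  hence everywhere, and at the content of \<open>b\<close> all summands but one vanish.\<close>

lemma transition_id_at_addable:
  assumes D: "young D" and tr: "transition_id D" and b: "b \<in> addable D"
  shows "real (dimY (insert b D)) / real (dimY D) * (\<Prod>x\<in>addable D - {b}. real_of_int (box_content b) - box_content x)
     = (real (card D) + 1) * (\<Prod>y\<in>removable D. real_of_int (box_content b) - box_content y)"
proof -
  define d where "d x = real (dimY (insert x D)) / real (dimY D)" for x
  define l where "l x = [:- real_of_int (box_content x), 1:]" for x
  define p where "p = (\<Sum>x\<in>addable D. smult (d x) (\<Prod>x'\<in>addable D - {x}. l x'))"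
  define q where "q = smult (real (card D) + 1) (\<Prod>y\<in>removable D. l y)"
  have fin: "finite (addable D)" using D by (rule finite_addable)
  have l: "poly (l x) u = u - box_content x" for x u by (simp add: l_def)
  have "poly p u = poly q u" if u: "u > real (card D) + 1" for u
  proof -
    have nz: "u - box_content x \<noteq> 0" if "x \<in> addable D" for x
      using real_content_addable[OF D that] u by auto
    have "poly p u = (\<Sum>x\<in>addable D. d x / (u - box_content x) * (\<Prod>x'\<in>addable D. u - box_content x'))"
      unfolding p_def poly_sum
    proof (rule sum.cong)
      fix x assume x: "x \<in> addable D"
      have "(\<Prod>x'\<in>addable D. u - box_content x') = (u - box_content x) * (\<Prod>x'\<in>addable D - {x}. u - box_content x')"
        using prod.remove[OF fin x] .
      then show "poly (smult (d x) (\<Prod>x'\<in>addable D - {x}. l x')) u = d x / (u - box_content x) * (\<Prod>x'\<in>addable D. u - box_content x')"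
        using nz[OF x] by (simp add: poly_prod l)
    qed simp
    also have "\<dots> = up (\<lambda>c. 1 / (u - real_of_int c)) (\<lambda>_. 1) D * (\<Prod>x'\<in>addable D. u - box_content x')"
      unfolding up_def d_def sum_distrib_right by (intro sum.cong) (simp_all add: mult.commute)
    also have "\<dots> = (up (\<lambda>c. 1 / (u - real_of_int c)) (\<lambda>_. 1) D * Kfun D u) * (\<Prod>y\<in>removable D. u - box_content y)"
      using Kfun_removable[OF D, of u] u by simp
    also have "\<dots> = poly q u" using tr u unfolding transition_id_def q_def by (simp add: poly_prod l)
    finally show ?thesis .
  qed
  then have "p = q" by (rule poly_eq_of_large)
  then have "poly p (box_content b) = poly q (box_content b)" by simp
  moreover have "poly p (box_content b) = d b * (\<Prod>x\<in>addable D - {b}. real_of_int (box_content b) - box_content x)"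
  proof -
    have "poly p (box_content b) = (\<Sum>x\<in>addable D. d x * (\<Prod>x'\<in>addable D - {x}. real_of_int (box_content b) - box_content x'))"
      by (simp add: p_def poly_sum poly_prod l)
    also have "\<dots> = d b * (\<Prod>x\<in>addable D - {b}. real_of_int (box_content b) - box_content x)
       + (\<Sum>x\<in>addable D - {b}. d x * (\<Prod>x'\<in>addable D - {x}. real_of_int (box_content b) - box_content x'))"
      using sum.remove[OF fin b] .
    also have "(\<Sum>x\<in>addable D - {b}. d x * (\<Prod>x'\<in>addable D - {x}. real_of_int (box_content b) - box_content x')) = 0"
      using b fin by (intro sum.neutral) (auto intro!: bexI[of _ b])
    finally show ?thesis by simp
  qed
  ultimately show ?thesis by (simp add: d_def q_def poly_prod l)
qed

text \<open>The difference of the two sides is \<open>p / q\<close> with \<open>q\<close> the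
  product over removable contents, and it vanishes at infinity. It remains to see that
  \<open>p\<close> vanishes at each removable content. The residue of \<open>Kfun D\<close> at
  \<open>y\<close> is expressed by the corners of \<open>D - {y}\<close>, where \<open>y\<close> is
  addable, and is then known from the transition identity of \<open>D - {y}\<close>.\<close>

lemma cotransition_id_step:
  assumes D: "young D" and tr: "\<And>y. y \<in> removable D \<Longrightarrow> transition_id (D - {y})"
  shows "cotransition_id D"
proof -
  define n where "n = real (card D)"
  define pr where "pr y = real (dimY (D - {y})) / real (dimY D)" for y
  define R where "R = removable D"
  define c where "c = (\<lambda>b. real_of_int (box_content b))"
  define l where "l x = [:- c x, 1:]" for x
  define q where "q = (\<Prod>y\<in>R. l y)"
  define p where "p = [:0, 1:] * q - (\<Prod>x\<in>addable D. l x) - (\<Sum>y\<in>R. smult (n * pr y) (\<Prod>y'\<in>R - {y}. l y'))"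
  have finD: "finite D" using D by (simp add: young_finite)
  have fin: "finite R" "finite (addable D)" using D by (simp_all add: finite_addable finite_removable R_def)
  have l: "poly (l x) u = u - c x" for x u by (simp add: l_def)
  have nz: "u - c y \<noteq> 0" if "y \<in> R" "\<bar>u\<bar> > n" for u y
    using real_content_less_card[OF D, of y] that by (auto simp: R_def removable_def n_def c_def)
  have ratio: "poly p u / poly q u = (u - Kfun D u) - (\<Sum>y\<in>R. n * pr y / (u - c y))" if u: "\<bar>u\<bar> > n" for u
  proof -
    have q0: "(\<Prod>y\<in>R. u - c y) \<noteq> 0" using nz u fin by simp
    have "(\<Sum>y\<in>R. n * pr y * (\<Prod>y'\<in>R - {y}. u - c y')) = (\<Sum>y\<in>R. n * pr y / (u - c y) * (\<Prod>y\<in>R. u - c y))"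
      using nz u by (intro sum.cong) (auto simp: prod.remove[OF fin(1)])
    then have "poly p u = u * (\<Prod>y\<in>R. u - c y) - Kfun D u * (\<Prod>y\<in>R. u - c y) - (\<Sum>y\<in>R. n * pr y / (u - c y)) * (\<Prod>y\<in>R. u - c y)"
      using Kfun_removable[OF D, of u] u
      by (simp add: p_def q_def poly_sum poly_prod l R_def c_def n_def sum_distrib_right)
    also have "\<dots> = ((u - Kfun D u) - (\<Sum>y\<in>R. n * pr y / (u - c y))) * (\<Prod>y\<in>R. u - c y)"
      by (simp add: algebra_simps)
    finally show ?thesis using q0 by (simp add: q_def poly_prod l)
  qed
  have "p = 0"
  proof (rule poly_eq_0_if_ratio_tendsto_0)
    show "finite (c ` R)" using fin by simp
    show "q \<noteq> 0" using fin by (auto simp: q_def l_def)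
    have "degree q \<le> (\<Sum>y\<in>R. degree (l y))" unfolding q_def by (rule degree_prod_sum_le[OF fin(1), unfolded comp_def])
    also have "\<dots> = card R" by (simp add: l_def)
    also have "card R = card (c ` R)"
    proof (rule card_image[symmetric])
      show "inj_on c R" using inj_on_content_removable[OF D] unfolding c_def R_def inj_on_def by simp
    qed
    finally show "degree q \<le> card (c ` R)" .
    show "((\<lambda>u. poly p u / poly q u) \<longlongrightarrow> 0) at_top"
    proof (rule Lim_transform_eventually)
      have "((\<lambda>u. n * pr y / (u - c y)) \<longlongrightarrow> 0) at_top" for y by real_asymp
      then have "((\<lambda>u. (u - Kfun D u) - (\<Sum>y\<in>R. n * pr y / (u - c y))) \<longlongrightarrow> 0 - (\<Sum>y\<in>R. 0)) at_top"
        by (intro tendsto_diff tendsto_sum Kfun_minus_id_tendsto[OF finD])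
      then show "((\<lambda>u. (u - Kfun D u) - (\<Sum>y\<in>R. n * pr y / (u - c y))) \<longlongrightarrow> 0) at_top" by simp
      show "\<forall>\<^sub>F u in at_top. (u - Kfun D u) - (\<Sum>y\<in>R. n * pr y / (u - c y)) = poly p u / poly q u"
        using eventually_gt_at_top[of n] by eventually_elim (simp add: ratio)
    qed
    fix r assume "r \<in> c ` R"
    then obtain y where y: "y \<in> R" "r = c y" by auto
    have yD: "y \<in> D" "young (D - {y})" "insert y (D - {y}) = D" using y by (auto simp: R_def removable_def)
    have ya: "y \<in> addable (D - {y})" using addable_Diff[OF D] y by (simp add: R_def)
    have cd: "real (card (D - {y})) + 1 = n" using yD finD card_gt_0_iff[of D] by (auto simp: n_def of_nat_diff)
    have dp: "real (dimY D) > 0" "real (dimY (D - {y})) > 0" using dimY_pos D yD by auto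
    define A0 where "A0 = (\<Prod>x\<in>addable (D - {y}) - {y}. c y - c x)"
    define R0 where "R0 = (\<Prod>x\<in>removable (D - {y}). c y - c x)"
    define A1 where "A1 = (\<Prod>x\<in>addable D. c y - c x)"
    define R1 where "R1 = (\<Prod>x\<in>R - {y}. c y - c x)"
    have e1: "real (dimY D) / real (dimY (D - {y})) * A0 = n * R0"
      using transition_id_at_addable[OF yD(2) tr[of y] ya] y(1) yD(3) cd
      by (simp add: R_def A0_def R0_def c_def)
    \<comment> \<open>The factor \<open>- 1\<close> is the product over the two new contents
      \<open>c y + 1\<close> and \<open>c y - 1\<close>, that is, \<open>(- 1) * 1\<close>.\<close>
    have e2: "A1 * R0 = A0 * R1 * (- 1)"
      using prod_addable_removable_update[OF yD(2) ya, of "\<lambda>i. c y - real_of_int i"] yD(3)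
      by (simp add: A0_def A1_def R0_def R1_def R_def c_def)
    have "A0 \<noteq> 0"
      using inj_on_content_addable[OF yD(2)] ya finite_addable[OF yD(2)]
      unfolding A0_def c_def inj_on_def by auto
    then have "R0 \<noteq> 0" using e1 dp by auto
    have "A0 = n * pr y * R0" using e1 dp by (simp add: pr_def field_simps)
    then have "A1 * R0 = (- n * pr y * R1) * R0" using e2 by (simp add: algebra_simps)
    then have e3: "A1 = - n * pr y * R1" using \<open>R0 \<noteq> 0\<close> mult_right_cancel by blast
    have "poly p r = r * (\<Prod>y'\<in>R. c y - c y') - A1 - (\<Sum>y'\<in>R. n * pr y' * (\<Prod>x\<in>R - {y'}. c y - c x))"
      by (simp add: p_def q_def poly_sum poly_prod l y A1_def)
    also have "(\<Prod>y'\<in>R. c y - c y') = 0" using y fin by (auto intro!: bexI[of _ y])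
    also have "(\<Sum>y'\<in>R. n * pr y' * (\<Prod>x\<in>R - {y'}. c y - c x))
        = n * pr y * R1 + (\<Sum>y'\<in>R - {y}. n * pr y' * (\<Prod>x\<in>R - {y'}. c y - c x))"
      unfolding R1_def by (rule sum.remove[OF fin(1) y(1)])
    also have "(\<Sum>y'\<in>R - {y}. n * pr y' * (\<Prod>x\<in>R - {y'}. c y - c x)) = 0"
      using y fin by (intro sum.neutral) (auto intro!: bexI[of _ y])
    finally show "poly p r = 0" using e3 by simp
  qed
  then have "(\<Sum>y\<in>R. n * pr y / (u - c y)) = u - Kfun D u" if "\<bar>u\<bar> > n" for u
    using ratio[OF that] by simp
  then show ?thesis unfolding cotransition_id_def by (simp add: n_def R_def pr_def c_def)
qed

text \<open>There is no circle: the co-transition identity of \<open>D\<close> uses the transition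
  identity of smaller diagrams only, and the transition identity of \<open>D\<close> uses in
  addition the co-transition identity just obtained.\<close>

theorem transition_cotransition: "young D \<Longrightarrow> transition_id D \<and> cotransition_id D"
proof (induction "card D" arbitrary: D rule: less_induct)
  case less
  have tr: "transition_id (D - {y})" if "y \<in> removable D" for y
  proof -
    have "y \<in> D" using that by (simp add: removable_def)
    then have "card (D - {y}) < card D" using less.prems by (intro card_Diff1_less) (auto simp: young_finite)
    then show ?thesis using less.hyps removable_young[OF that] by blast
  qed
  then show ?case using cotransition_id_step transition_id_step less.prems by blast
qed


section \<open>Moments of the co-transition measure\<close>

definition content_sum :: "nat \<Rightarrow> (nat \<times> nat) set \<Rightarrow> real" where
  "content_sum k D = (\<Sum>b\<in>D. real_of_int (box_content b) ^ k)"

definition cotrans_moment :: "nat \<Rightarrow> (nat \<times> nat) set \<Rightarrow> real" where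
  "cotrans_moment k D = (\<Sum>b\<in>removable D. real (dimY (D - {b})) / real (dimY D) * real_of_int (box_content b) ^ k)"

text \<open>The coefficient of \<open>1 / u^(k + 1)\<close> in \<open>Lfun D u - 1 / u\<close>
  expanded at infinity.\<close>

definition diff_sum :: "nat \<Rightarrow> (nat \<times> nat) set \<Rightarrow> real" where
  "diff_sum k D = (\<Sum>b\<in>D. (real_of_int (box_content b) + 1) ^ k + (real_of_int (box_content b) - 1) ^ k
     - 2 * real_of_int (box_content b) ^ k)"

section \<open>Expansion at infinity as a formal power series in 1/u\<close>

definition fps_geo :: "real \<Rightarrow> real fps" where
  "fps_geo c = Abs_fps (\<lambda>k. c ^ k)"

lemma fps_geo_mult: "(1 - fps_const c * fps_X) * fps_geo c = 1"
proof (rule fps_ext)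
  fix k show "fps_nth ((1 - fps_const c * fps_X) * fps_geo c) k = fps_nth 1 k"
    by (cases k) (simp_all add: fps_geo_def algebra_simps)
qed

lemma fps_geo_eq_inverse: "fps_geo c = inverse (1 - fps_const c * fps_X)"
  using fps_geo_mult[of c] by (intro fps_inverse_unique[symmetric]) (simp add: mult.commute)

lemma fps_geo_expansion: "(\<lambda>x. 1 / (1 - c * x)) has_fps_expansion fps_geo c"
  unfolding fps_geo_eq_inverse divide_inverse mult_1_left by (intro fps_expansion_intros) auto

lemma fps_geo_deriv: "fps_deriv (fps_geo c) = fps_const c * fps_geo c ^ 2"
proof -
  have "fps_deriv ((1 - fps_const c * fps_X) * fps_geo c) = 0" by (simp add: fps_geo_mult)
  then have "(1 - fps_const c * fps_X) * fps_deriv (fps_geo c) = fps_const c * fps_geo c"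
    by (simp add: algebra_simps)
  then have "fps_geo c * ((1 - fps_const c * fps_X) * fps_deriv (fps_geo c)) = fps_geo c * (fps_const c * fps_geo c)"
    by simp
  then have "((1 - fps_const c * fps_X) * fps_geo c) * fps_deriv (fps_geo c) = fps_const c * fps_geo c ^ 2"
    by (simp add: power2_eq_square mult_ac)
  then show ?thesis by (simp add: fps_geo_mult)
qed

text \<open>The formal version of the logarithmic derivative of one factor of \<open>Kfun\<close>:
  with \<open>X\<close> for \<open>1 / u\<close>, \<open>X * fps_geo c\<close> stands for
  \<open>1 / (u - c)\<close>, and the factor is
  \<open>(1 - (c + 1) * X) * (1 - (c - 1) * X) / (1 - c * X)^2\<close>.\<close>

lemma fps_factor_deriv:
  "fps_deriv (1 - (fps_X * fps_geo c) ^ 2) = - ((1 - (fps_X * fps_geo c) ^ 2) *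
     (fps_const (c + 1) * fps_geo (c + 1) + fps_const (c - 1) * fps_geo (c - 1) - 2 * (fps_const c * fps_geo c)))"
proof -
  define X :: "real fps" where "X = fps_X"
  define C where "C = fps_const c"
  define G where "G = fps_geo c"
  define Gp where "Gp = fps_geo (c + 1)"
  define Gm where "Gm = fps_geo (c - 1)"
  have 1: "(1 - C * X) * G = 1" using fps_geo_mult by (simp add: C_def X_def G_def)
  have p: "(1 - (C + 1) * X) * Gp = 1" using fps_geo_mult[of "c + 1"] by (simp add: C_def X_def Gp_def flip: fps_const_add fps_const_1_eq_1)
  have m: "(1 - (C - 1) * X) * Gm = 1" using fps_geo_mult[of "c - 1"] by (simp add: C_def X_def Gm_def flip: fps_const_sub fps_const_1_eq_1)
  have f: "1 - (X * G) ^ 2 = (1 - (C + 1) * X) * (1 - (C - 1) * X) * G ^ 2"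
  proof -
    have "1 - (X * G) ^ 2 = ((1 - C * X) * G) ^ 2 - (X * G) ^ 2" by (simp add: 1)
    also have "\<dots> = (1 - (C + 1) * X) * (1 - (C - 1) * X) * G ^ 2" by algebra
    finally show ?thesis .
  qed
  have "fps_deriv ((X * G) ^ 2) = 2 * (X * G) * (G + X * (C * G ^ 2))"
    by (simp add: power2_eq_square X_def G_def C_def fps_geo_deriv algebra_simps)
  also have "G + X * (C * G ^ 2) = G * ((1 - C * X) * G) + X * (C * G ^ 2)" by (simp add: 1)
  also have "\<dots> = G ^ 2" by algebra
  finally have d: "fps_deriv ((X * G) ^ 2) = 2 * X * G ^ 3" by (simp add: power2_eq_square power3_eq_cube mult_ac)
  have "(1 - (X * G) ^ 2) * ((C + 1) * Gp + (C - 1) * Gm - 2 * (C * G))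
    = ((1 - (C + 1) * X) * Gp) * (1 - (C - 1) * X) * G ^ 2 * (C + 1)
      + (1 - (C + 1) * X) * ((1 - (C - 1) * X) * Gm) * G ^ 2 * (C - 1)
      - 2 * C * G ^ 3 * ((1 - (C + 1) * X) * (1 - (C - 1) * X))"
    unfolding f by algebra
  also have "\<dots> = G ^ 2 * ((1 - (C - 1) * X) * (C + 1) + (1 - (C + 1) * X) * (C - 1))
      - 2 * C * G ^ 3 * ((1 - (C + 1) * X) * (1 - (C - 1) * X))"
    unfolding p m by algebra
  \<comment> \<open>Inserting the unit \<open>(1 - C * X) * G\<close> brings both terms to the
    common factor \<open>G ^ 3\<close>, after which the identity is one of polynomials.\<close>
  also have "\<dots> = G ^ 2 * ((1 - C * X) * G) * ((1 - (C - 1) * X) * (C + 1) + (1 - (C + 1) * X) * (C - 1))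
      - 2 * C * G ^ 3 * ((1 - (C + 1) * X) * (1 - (C - 1) * X))"
    by (simp only: 1 mult_1_right)
  also have "\<dots> = 2 * X * G ^ 3" by algebra
  finally have "fps_deriv ((X * G) ^ 2) = (1 - (X * G) ^ 2) * ((C + 1) * Gp + (C - 1) * Gm - 2 * (C * G))"
    using d by simp
  then show ?thesis
    by (simp add: X_def C_def G_def Gp_def Gm_def flip: fps_const_add fps_const_sub)
qed

text \<open>The expansion of \<open>Kfun D u / u\<close> in the variable
  \<open>1 / u\<close>.\<close>

definition fps_prodK :: "(nat \<times> nat) set \<Rightarrow> real fps" where
  "fps_prodK D = (\<Prod>b\<in>D. 1 - (fps_X * fps_geo (box_content b)) ^ 2)"

lemma fps_prodK_deriv:
  assumes "finite D"
  shows "fps_deriv (fps_prodK D) = - (fps_prodK D * Abs_fps (\<lambda>k. diff_sum (Suc k) D))"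
  using assms
proof (induction D rule: finite_induct)
  case empty
  then show ?case by (simp add: fps_prodK_def diff_sum_def fps_zero_def[symmetric])
next
  case (insert b D)
  define c where "c = real_of_int (box_content b)"
  define f where "f = 1 - (fps_X * fps_geo c) ^ 2"
  define g where "g = fps_const (c + 1) * fps_geo (c + 1) + fps_const (c - 1) * fps_geo (c - 1) - 2 * (fps_const c * fps_geo c)"
  have P: "fps_prodK (insert b D) = f * fps_prodK D" using insert.hyps by (simp add: fps_prodK_def f_def c_def)
  have 2: "Abs_fps (\<lambda>k. diff_sum (Suc k) (insert b D)) = g + Abs_fps (\<lambda>k. diff_sum (Suc k) D)"
    using insert.hyps by (intro fps_ext) (simp add: diff_sum_def g_def fps_geo_def c_def numeral_fps_const)
  have "fps_deriv f = - (f * g)" unfolding f_def g_def by (rule fps_factor_deriv)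
  then show ?case unfolding P 2 fps_deriv_mult insert.IH by (simp add: algebra_simps)
qed

text \<open>If the two expansions differed first in degree \<open>d\<close>, the zero function
  divided by \<open>x ^ d\<close> would tend at \<open>0\<close> to a non-zero coefficient.\<close>

lemma fps_expansion_unique_real:
  fixes F G :: "real fps"
  assumes "f has_fps_expansion F" "f has_fps_expansion G"
  shows "F = G"
proof (rule ccontr)
  assume "F \<noteq> G"
  define H where "H = F - G"
  define d where "d = subdegree H"
  have "H \<noteq> 0" using \<open>F \<noteq> G\<close> by (simp add: H_def)
  then have H: "fps_nth H d \<noteq> 0" unfolding d_def by (rule nth_subdegree_nonzero)
  have "(\<lambda>x. f x - f x) has_fps_expansion H" unfolding H_def by (intro fps_expansion_intros assms)
  then have "(\<lambda>x. if x = 0 then fps_nth H d else (f x - f x) / x ^ d) has_fps_expansion fps_shift d H"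
    by (intro has_fps_expansion_shift) (auto simp: d_def)
  then have "isCont (\<lambda>x. if x = 0 then fps_nth H d else (f x - f x) / x ^ d) 0"
    by (rule has_fps_expansion_imp_continuous[where A = UNIV, simplified])
  then have "((\<lambda>x. if x = 0 then fps_nth H d else (f x - f x) / x ^ d) \<longlongrightarrow> fps_nth H d) (at 0)"
    by (simp add: isCont_def)
  then have "((\<lambda>x::real. 0::real) \<longlongrightarrow> fps_nth H d) (at 0)"
    by (rule Lim_transform_eventually) (auto simp: eventually_at_filter)
  then show False using H tendsto_unique[OF _ tendsto_const] by force
qed

text \<open>The co-transition identity divided by \<open>u\<close>, rewritten in
  \<open>x = 1 / u\<close> and expanded at \<open>x = 0\<close>.\<close>

lemma cotransition_fps:
  assumes D: "young D"
  shows "(\<Sum>y\<in>removable D. fps_const (real (card D) * (real (dimY (D - {y})) / real (dimY D))) * fps_X ^ 2 * fps_geo (box_content y))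
     = 1 - fps_prodK D" (is "?l = ?r")
proof -
  define n where "n = real (card D)"
  define pr where "pr y = real (dimY (D - {y})) / real (dimY D)" for y
  define h where "h x = (\<Sum>y\<in>removable D. n * pr y * x ^ 2 * (1 / (1 - box_content y * x)))" for x :: real
  define h2 where "h2 x = 1 - (\<Prod>b\<in>D. 1 - (x * (1 / (1 - box_content b * x))) ^ 2)" for x :: real
  have e1: "h has_fps_expansion ?l"
    unfolding h_def n_def pr_def by (intro fps_expansion_intros fps_geo_expansion)
  have e2: "h2 has_fps_expansion ?r"
    unfolding h2_def fps_prodK_def power2_eq_square by (intro fps_expansion_intros fps_geo_expansion)
  \<comment> \<open>The radius \<open>1 / (n + 1)\<close> guarantees
    \<open>\<bar>u\<bar> > n\<close>, where the identity is available; at \<open>x = 0\<close> both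
    sides vanish.\<close>
  have eq: "h x = h2 x" if x: "\<bar>x\<bar> < 1 / (n + 1)" for x
  proof (cases "x = 0")
    case True
    then show ?thesis by (simp add: h_def h2_def)
  next
    case False
    define u where "u = 1 / x"
    have n0: "n \<ge> 0" by (simp add: n_def)
    have "\<bar>x\<bar> * (n + 1) < 1" using x n0 by (simp add: field_simps)
    then have u: "\<bar>u\<bar> > n" using False unfolding u_def abs_divide by (simp add: field_simps abs_if split: if_splits)
    have xu: "x = 1 / u" "u \<noteq> 0" using False by (auto simp: u_def)
    have q: "x * (1 / (1 - c * x)) = 1 / (u - c)" for c :: real
      unfolding xu using xu(2) by (simp add: divide_simps) 
    have co: "(\<Sum>y\<in>removable D. n * pr y / (u - box_content y)) = u - Kfun D u"
      using transition_cotransition[OF D] u unfolding cotransition_id_def n_def pr_def by blast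
    have "h x = (\<Sum>y\<in>removable D. x * (n * pr y * (x * (1 / (1 - box_content y * x)))))"
      unfolding h_def by (intro sum.cong) (auto simp: power2_eq_square mult_ac)
    also have "\<dots> = x * (u - Kfun D u)" unfolding q co[symmetric] sum_distrib_left by simp
    also have "\<dots> = 1 - (\<Prod>b\<in>D. 1 - (1 / (u - box_content b)) ^ 2)"
      using xu(2) by (simp add: Kfun_def xu(1) algebra_simps power_divide)
    also have "\<dots> = h2 x" unfolding h2_def q ..
    finally show ?thesis .
  qed
  have "\<forall>\<^sub>F x in nhds 0. h x = h2 x"
  proof (rule eventually_nhds_in_open[of "{x. \<bar>x\<bar> < 1 / (n + 1)}" 0, THEN eventually_mono])
    show "open {x. \<bar>x\<bar> < 1 / (n + 1)}" by (intro open_Collect_less continuous_intros)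
    show "0 \<in> {x. \<bar>x\<bar> < 1 / (n + 1)}" by (simp add: n_def add_nonneg_pos)
  qed (use eq in auto)
  then have "h2 has_fps_expansion ?l" using e1
    by (auto simp: has_fps_expansion_def elim: eventually_elim2)
  then show ?thesis using e2 fps_expansion_unique_real by blast
qed


text \<open>With \<open>P = fps_prodK D\<close> and \<open>H = 1 - P\<close>, the equation
  \<open>P' = - P * M\<close> becomes \<open>H' = M - H * M\<close>; this is its coefficient of
  degree \<open>k + 1\<close>. The shift by two and the two vanishing values of \<open>h\<close>
  come from the factor \<open>X^2\<close> in \<open>H\<close>.\<close>

lemma cotrans_moment_rec:
  fixes k :: nat
  assumes D: "young D"
  defines "h \<equiv> (\<lambda>i::nat. if i < 2 then 0 else real (card D) * cotrans_moment (i - 2) D)"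
  shows "(real k + 2) * (real (card D) * cotrans_moment k D)
    = diff_sum (k + 2) D - (\<Sum>i\<le>k + 1. h i * diff_sum (k + 2 - i) D)"
proof -
  define H where "H = (\<Sum>y\<in>removable D. fps_const (real (card D) * (real (dimY (D - {y})) / real (dimY D))) * fps_X ^ 2 * fps_geo (box_content y))"
  define M where "M = Abs_fps (\<lambda>k. diff_sum (Suc k) D)"
  have HP: "H = 1 - fps_prodK D" unfolding H_def by (rule cotransition_fps[OF D])
  have nH: "fps_nth H i = h i" for i
    unfolding H_def h_def cotrans_moment_def fps_sum_nth
    by (simp add: mult.assoc fps_X_power_mult_nth fps_geo_def sum_distrib_left)
  have "fps_deriv H = M - H * M"
    using fps_prodK_deriv[OF young_finite[OF D]] by (simp add: HP M_def algebra_simps)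
  then have "fps_nth (fps_deriv H) (k + 1) = fps_nth (M - H * M) (k + 1)" by simp
  moreover have "fps_nth (fps_deriv H) (k + 1) = (real k + 2) * (real (card D) * cotrans_moment k D)"
    by (simp add: nH h_def)
  moreover have "fps_nth (M - H * M) (k + 1) = diff_sum (k + 2) D - (\<Sum>i\<le>k + 1. h i * diff_sum (k + 2 - i) D)"
    by (simp add: M_def fps_mult_nth nH atLeast0AtMost Suc_diff_le)
  ultimately show ?thesis by simp
qed

text \<open>The binomial terms of order three and higher, each bounded by its binomial coefficient
  times \<open>N ^ (j - 3)\<close>. It is used with \<open>e = 1, - 1\<close> for second differences
  and with \<open>e = 1/2, - 1/2\<close> to pass from contents to Frobenius coordinates.\<close>

lemma binomial_remainder:
  fixes c e N :: real
  assumes N: "1 \<le> N" "\<bar>c\<bar> \<le> N" "\<bar>e\<bar> \<le> 1"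
  shows "\<bar>(c + e) ^ j - c ^ j - real j * c ^ (j - 1) * e - real (j choose 2) * c ^ (j - 2) * e\<^sup>2\<bar> \<le> 2 ^ j * N ^ (j - 3)"
proof (cases "j < 3")
  case True
  then consider "j = 0" | "j = 1" | "j = 2" by linarith
  then show ?thesis by cases (auto simp: power2_eq_square algebra_simps choose_two)
next
  case False
  then obtain m where m: "j = m + 3" by (metis add.commute le_Suc_ex not_less)
  define f where "f i = real (j choose i) * e ^ i * c ^ (j - i)" for i
  have "(c + e) ^ j = (\<Sum>i\<le>j. f i)" unfolding f_def by (subst add.commute) (rule binomial_ring)
  also have "\<dots> = f 0 + f 1 + f 2 + (\<Sum>i\<le>m. f (i + 3))"
    unfolding m by (simp add: eval_nat_numeral sum.atMost_Suc_shift del: sum.atMost_Suc)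
  finally have *: "(c + e) ^ j - c ^ j - real j * c ^ (j - 1) * e - real (j choose 2) * c ^ (j - 2) * e\<^sup>2 = (\<Sum>i\<le>m. f (i + 3))"
    by (simp add: f_def mult_ac)
  have "\<bar>\<Sum>i\<le>m. f (i + 3)\<bar> \<le> (\<Sum>i\<le>m. real (j choose (i + 3)) * N ^ m)"
  proof (rule order.trans[OF sum_abs sum_mono])
    fix i assume i: "i \<in> {..m}"
    have "\<bar>f (i + 3)\<bar> = real (j choose (i + 3)) * (\<bar>e\<bar> ^ (i + 3) * \<bar>c\<bar> ^ (m - i))"
      by (simp add: f_def abs_mult power_abs m)
    also have "\<dots> \<le> real (j choose (i + 3)) * (1 * N ^ m)"
    proof (intro mult_left_mono mult_mono)
      show "\<bar>e\<bar> ^ (i + 3) \<le> 1" using N by (intro power_le_one) auto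
      have "\<bar>c\<bar> ^ (m - i) \<le> N ^ (m - i)" using N by (intro power_mono) auto
      also have "\<dots> \<le> N ^ m" using N by (intro power_increasing) auto
      finally show "\<bar>c\<bar> ^ (m - i) \<le> N ^ m" .
    qed auto
    finally show "\<bar>f (i + 3)\<bar> \<le> real (j choose (i + 3)) * N ^ m" by simp
  qed
  also have "\<dots> = real (\<Sum>i\<le>m. j choose (i + 3)) * N ^ m" by (simp add: sum_distrib_right)
  also have "(\<Sum>i\<le>m. j choose (i + 3)) = (\<Sum>i\<in>(\<lambda>i. i + 3) ` {..m}. j choose i)"
    by (subst sum.reindex) auto
  also have "(\<Sum>i\<in>(\<lambda>i. i + 3) ` {..m}. j choose i) \<le> (\<Sum>i\<le>j. j choose i)"
    by (rule sum_mono2) (auto simp: m)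
  also have "(\<Sum>i\<le>j. j choose i) = 2 ^ j" by (rule choose_row_sum)
  finally show ?thesis unfolding * using N m by (simp add: mult_right_mono)
qed

text \<open>The linear terms for the shifts \<open>1\<close> and \<open>- 1\<close> cancel and the
  quadratic ones add up.\<close>

lemma second_difference_bound:
  fixes c N :: real
  assumes N: "1 \<le> N" "\<bar>c\<bar> \<le> N"
  shows "\<bar>(c + 1) ^ j + (c - 1) ^ j - 2 * c ^ j - real j * (real j - 1) * c ^ (j - 2)\<bar> \<le> 2 * 2 ^ j * N ^ (j - 3)"
proof -
  have ch: "2 * real (j choose 2) = real j * (real j - 1)"
    by (cases j) (simp_all add: choose_two algebra_simps real_of_nat_div flip: of_nat_mult)
  have "\<bar>(c + 1) ^ j - c ^ j - real j * c ^ (j - 1) - real (j choose 2) * c ^ (j - 2)\<bar> \<le> 2 ^ j * N ^ (j - 3)"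
    using binomial_remainder[OF N, of 1 j] by simp
  moreover have "\<bar>(c - 1) ^ j - c ^ j + real j * c ^ (j - 1) - real (j choose 2) * c ^ (j - 2)\<bar> \<le> 2 ^ j * N ^ (j - 3)"
    using binomial_remainder[OF N, of "- 1" j] by simp
  moreover have "(c + 1) ^ j + (c - 1) ^ j - 2 * c ^ j - real j * (real j - 1) * c ^ (j - 2)
    = ((c + 1) ^ j - c ^ j - real j * c ^ (j - 1) - real (j choose 2) * c ^ (j - 2))
     + ((c - 1) ^ j - c ^ j + real j * c ^ (j - 1) - real (j choose 2) * c ^ (j - 2))"
    unfolding ch[symmetric] by (simp add: algebra_simps)
  ultimately show ?thesis by linarith
qed

lemma diff_sum_approx:
  assumes D: "young D" "D \<noteq> {}"
  shows "\<bar>diff_sum j D - real j * (real j - 1) * content_sum (j - 2) D\<bar> \<le> real (card D) * (2 * 2 ^ j * real (card D) ^ (j - 3))"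
proof -
  have "diff_sum j D - real j * (real j - 1) * content_sum (j - 2) D
    = (\<Sum>b\<in>D. (real_of_int (box_content b) + 1) ^ j + (real_of_int (box_content b) - 1) ^ j - 2 * real_of_int (box_content b) ^ j
       - real j * (real j - 1) * real_of_int (box_content b) ^ (j - 2))"
    by (simp add: diff_sum_def content_sum_def sum_subtractf sum_distrib_left)
  also have "\<bar>\<dots>\<bar> \<le> (\<Sum>b\<in>D. 2 * 2 ^ j * real (card D) ^ (j - 3))"
  proof (rule order.trans[OF sum_abs sum_mono])
    fix b assume "b \<in> D"
    then have "\<bar>real_of_int (box_content b)\<bar> + 1 \<le> real (card D)" by (rule real_content_less_card[OF D(1)])
    then show "\<bar>(real_of_int (box_content b) + 1) ^ j + (real_of_int (box_content b) - 1) ^ j - 2 * real_of_int (box_content b) ^ j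
       - real j * (real j - 1) * real_of_int (box_content b) ^ (j - 2)\<bar> \<le> 2 * 2 ^ j * real (card D) ^ (j - 3)"
      by (intro second_difference_bound) auto
  qed
  finally show ?thesis by simp
qed

lemma content_sum_bound:
  assumes D: "young D"
  shows "\<bar>content_sum k D\<bar> \<le> real (card D) ^ (k + 1)"
proof -
  have "\<bar>content_sum k D\<bar> \<le> (\<Sum>b\<in>D. real (card D) ^ k)" unfolding content_sum_def
  proof (rule order.trans[OF sum_abs sum_mono])
    fix b assume "b \<in> D"
    then have "\<bar>real_of_int (box_content b)\<bar> + 1 \<le> real (card D)" by (rule real_content_less_card[OF D(1)])
    then show "\<bar>real_of_int (box_content b) ^ k\<bar> \<le> real (card D) ^ k"
      unfolding power_abs by (intro power_mono) auto
  qed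
  then show ?thesis by simp
qed

lemma cotrans_moment_bound:
  assumes D: "young D"
  shows "\<bar>cotrans_moment k D\<bar> \<le> real (card D) ^ k"
proof (cases "D = {}")
  case True
  then show ?thesis by (simp add: cotrans_moment_def)
next
  case False
  have "\<bar>cotrans_moment k D\<bar> \<le> (\<Sum>b\<in>removable D. real (dimY (D - {b})) / real (dimY D) * real (card D) ^ k)"
    unfolding cotrans_moment_def
  proof (rule order.trans[OF sum_abs sum_mono])
    fix b assume "b \<in> removable D"
    then have "b \<in> D" by (simp add: removable_def)
    then have "\<bar>real_of_int (box_content b)\<bar> + 1 \<le> real (card D)" by (rule real_content_less_card[OF D(1)])
    then have "\<bar>real_of_int (box_content b) ^ k\<bar> \<le> real (card D) ^ k"
      unfolding power_abs by (intro power_mono) auto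
    then show "\<bar>real (dimY (D - {b})) / real (dimY D) * real_of_int (box_content b) ^ k\<bar>
      \<le> real (dimY (D - {b})) / real (dimY D) * real (card D) ^ k"
      by (simp add: abs_mult divide_right_mono mult_left_mono)
  qed
  also have "\<dots> = real (card D) ^ k"
    unfolding sum_distrib_right[symmetric] down_weights[OF D False] by simp
  finally show ?thesis .
qed

lemma diff_sum_bound:
  assumes D: "young D" "D \<noteq> {}"
  shows "\<bar>diff_sum (j + 1) D\<bar> \<le> (2 * 2 ^ (j + 1) + (real j + 1) * real j) * real (card D) ^ j"
proof (cases j)
  case 0
  then show ?thesis by (simp add: diff_sum_def)
next
  case (Suc m)
  define n where "n = real (card D)"
  have n: "n \<ge> 1" using D young_finite[of D] by (simp add: n_def Suc_leI card_gt_0_iff)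
  have "\<bar>diff_sum (j + 1) D - (real j + 1) * real j * content_sum m D\<bar> \<le> n * (2 * 2 ^ (j + 1) * n ^ (m - 1))"
    using diff_sum_approx[OF D, of "j + 1"] Suc by (simp add: n_def algebra_simps)
  also have "\<dots> \<le> n * (2 * 2 ^ (j + 1) * n ^ m)"
    using n by (intro mult_left_mono power_increasing) auto
  also have "\<dots> = 2 * 2 ^ (j + 1) * n ^ j" using Suc by (simp add: algebra_simps)
  finally have 1: "\<bar>diff_sum (j + 1) D - (real j + 1) * real j * content_sum m D\<bar> \<le> 2 * 2 ^ (j + 1) * n ^ j" .
  have "\<bar>(real j + 1) * real j * content_sum m D\<bar> = (real j + 1) * real j * \<bar>content_sum m D\<bar>"
    by (simp add: abs_mult)
  also have "\<dots> \<le> (real j + 1) * real j * n ^ j"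
    using content_sum_bound[OF D(1), of m] Suc by (intro mult_left_mono) (auto simp: n_def)
  finally have "\<bar>(real j + 1) * real j * content_sum m D\<bar> \<le> (real j + 1) * real j * n ^ j" .
  then show ?thesis using 1 unfolding n_def[symmetric] distrib_right by linarith
qed

text \<open>In \<open>cotrans_moment_rec\<close> the term \<open>diff_sum (k + 2) D\<close> is
  \<open>(k + 2) * (k + 1) * content_sum k D\<close> up to order \<open>n^k\<close>. In the
  remaining products \<open>h i\<close> has order \<open>n^(i - 1)\<close> and
  \<open>diff_sum (k + 2 - i) D\<close> order \<open>n^(k + 1 - i)\<close>, so they too are
  \<open>O(n^k)\<close>, one power below the a priori bound for the main term.\<close>

lemma cotrans_moment_approx:
  assumes k: "k \<ge> 1"
  obtains C where "C \<ge> 0" "\<And>D. young D \<Longrightarrow> D \<noteq> {} \<Longrightarrow>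
    \<bar>real (card D) * cotrans_moment k D - (real k + 1) * content_sum k D\<bar> \<le> C * real (card D) ^ k"
proof -
  define a where "a = (\<lambda>j::nat. 2 * 2 ^ (j + 1) + (real j + 1) * real j)"
  \<comment> \<open>The first summand is the error of \<open>diff_sum_approx\<close>, the second
    collects the products by means of \<open>diff_sum_bound\<close>; the division by
    \<open>k + 2 \<ge> 1\<close> only helps.\<close>
  define C where "C = 2 * 2 ^ (k + 2) + (\<Sum>i\<le>k + 1. a (k + 1 - i))"
  have a0: "a j \<ge> 0" for j by (simp add: a_def)
  have C0: "C \<ge> 0" unfolding C_def by (intro add_nonneg_nonneg sum_nonneg a0) auto
  moreover have "\<bar>real (card D) * cotrans_moment k D - (real k + 1) * content_sum k D\<bar> \<le> C * real (card D) ^ k"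
    if D: "young D" "D \<noteq> {}" for D
  proof -
    define n where "n = real (card D)"
    have n: "n \<ge> 1" using D young_finite[of D] by (simp add: n_def Suc_leI card_gt_0_iff)
    define h where "h = (\<lambda>i::nat. if i < 2 then 0 else n * cotrans_moment (i - 2) D)"
    have rec: "(real k + 2) * (n * cotrans_moment k D) = diff_sum (k + 2) D - (\<Sum>i\<le>k + 1. h i * diff_sum (k + 2 - i) D)"
      using cotrans_moment_rec[OF D(1), of k] unfolding h_def n_def .
    have 1: "\<bar>diff_sum (k + 2) D - (real k + 2) * (real k + 1) * content_sum k D\<bar> \<le> 2 * 2 ^ (k + 2) * n ^ k"
      using diff_sum_approx[OF D, of "k + 2"] k by (cases k) (auto simp: n_def algebra_simps)
    have 2: "\<bar>\<Sum>i\<le>k + 1. h i * diff_sum (k + 2 - i) D\<bar> \<le> (\<Sum>i\<le>k + 1. a (k + 1 - i)) * n ^ k"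
      unfolding sum_distrib_right
    proof (rule order.trans[OF sum_abs sum_mono])
      fix i assume i: "i \<in> {..k + 1}"
      show "\<bar>h i * diff_sum (k + 2 - i) D\<bar> \<le> a (k + 1 - i) * n ^ k"
      proof (cases "i < 2")
        case True then show ?thesis using a0 n by (simp add: h_def)
      next
        case False
        then obtain m where m: "i = m + 2" by (metis add.commute le_Suc_ex not_less)
        define j where "j = k + 1 - i"
        have kj: "k + 2 - i = j + 1" "k = Suc m + j" using i m by (auto simp: j_def)
        have "\<bar>h i\<bar> \<le> n * n ^ m"
          using cotrans_moment_bound[OF D(1), of m] n by (simp add: h_def m abs_mult n_def mult_left_mono)
        moreover have "\<bar>diff_sum (j + 1) D\<bar> \<le> a j * n ^ j"
          using diff_sum_bound[OF D, of j] by (simp add: a_def n_def)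
        ultimately have "\<bar>h i\<bar> * \<bar>diff_sum (j + 1) D\<bar> \<le> (n * n ^ m) * (a j * n ^ j)"
          using n by (intro mult_mono) auto
        also have "\<dots> = a j * n ^ k" by (simp add: kj power_add)
        finally show ?thesis unfolding kj(1) abs_mult j_def[symmetric] .
      qed
    qed
    have "(real k + 2) * \<bar>n * cotrans_moment k D - (real k + 1) * content_sum k D\<bar>
      = \<bar>(real k + 2) * (n * cotrans_moment k D) - (real k + 2) * (real k + 1) * content_sum k D\<bar>"
    proof -
      have "(real k + 2) * (n * cotrans_moment k D) - (real k + 2) * (real k + 1) * content_sum k D
        = (real k + 2) * (n * cotrans_moment k D - (real k + 1) * content_sum k D)" by (simp add: algebra_simps)
      then show ?thesis by (simp add: abs_mult)
    qed
    also have "\<dots> \<le> 2 * 2 ^ (k + 2) * n ^ k + (\<Sum>i\<le>k + 1. a (k + 1 - i)) * n ^ k"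
      unfolding rec using 1 2 by linarith
    also have "\<dots> = C * n ^ k" unfolding C_def by (rule distrib_right[symmetric])
    finally have "(real k + 2) * \<bar>n * cotrans_moment k D - (real k + 1) * content_sum k D\<bar> \<le> C * n ^ k" .
    moreover have "y \<le> (real k + 2) * y" if "y \<ge> 0" for y :: real
      using mult_right_mono[of 1 "real k + 2" y] that by simp
    ultimately show ?thesis unfolding n_def by (meson abs_ge_zero order.trans)
  qed
  ultimately show thesis using that by blast
qed


section \<open>The law of large numbers for the down chain\<close>

lemma down_pow_mono:
  assumes "young D" "j \<le> card D"
    and "\<And>E. young E \<Longrightarrow> card E = card D - j \<Longrightarrow> f E \<le> g E"
  shows "(down ^^ j) f D \<le> (down ^^ j) g D"
  using assms
proof (induction j arbitrary: D)
  case 0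
  then show ?case by simp
next
  case (Suc j)
  have "down ((down ^^ j) f) D \<le> down ((down ^^ j) g) D"
  proof (rule down_mono)
    fix b assume b: "b \<in> removable D"
    show "(down ^^ j) f (D - {b}) \<le> (down ^^ j) g (D - {b})"
      using Suc.prems card_removable[OF Suc.prems(1) b] removable_young[OF b]
      by (intro Suc.IH) auto
  qed
  then show ?case by simp
qed

lemma down_pow_const:
  assumes "young D" "j \<le> card D"
  shows "(down ^^ j) (\<lambda>_. c) D = c"
  using assms
proof (induction j arbitrary: D)
  case 0
  then show ?case by simp
next
  case (Suc j)
  have "down ((down ^^ j) (\<lambda>_. c)) D = down (\<lambda>_. c) D"
  proof (rule down_cong)
    fix b assume b: "b \<in> removable D"
    show "(down ^^ j) (\<lambda>_. c) (D - {b}) = c"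
      using Suc.prems card_removable[OF Suc.prems(1) b] removable_young[OF b]
      by (intro Suc.IH) auto
  qed
  also have "\<dots> = c" using Suc.prems by (intro down_const) auto
  finally show ?case by simp
qed

lemma down_pow_add: "(down ^^ j) (\<lambda>x. f x + g x) = (\<lambda>D. (down ^^ j) f D + (down ^^ j) g D)"
  by (induction j) (simp_all add: down_add[abs_def])

lemma down_pow_cmult: "(down ^^ j) (\<lambda>x. c * f x) = (\<lambda>D. c * (down ^^ j) f D)"
  by (induction j) (simp_all add: down_cmult[abs_def])

text \<open>Up to the factor \<open>k + 1\<close> and an error \<open>O(1 / n)\<close>, this is the
  power sum of degree \<open>k + 1\<close> at the image of \<open>D\<close> in the simplex
  (\<open>pw_monomial_approx\<close>).\<close>

definition scaled_sum :: "nat \<Rightarrow> (nat \<times> nat) set \<Rightarrow> real" where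
  "scaled_sum k D = content_sum k D / real (card D) ^ (k + 1)"

lemma scaled_sum_le_1: "young D \<Longrightarrow> \<bar>scaled_sum k D\<bar> \<le> 1"
  using content_sum_bound[of D k]
  by (cases "card D = 0") (auto simp: scaled_sum_def divide_simps)

lemma one_minus_power_approx:
  fixes x :: real
  assumes "0 \<le> x" "x \<le> 1"
  shows "\<bar>(1 - x) ^ j - 1 + real j * x\<bar> \<le> (real j)\<^sup>2 * x\<^sup>2"
proof (induction j)
  case 0
  then show ?case by simp
next
  case (Suc j)
  have "\<bar>(1 - x) ^ Suc j - 1 + real (Suc j) * x\<bar> = \<bar>(1 - x) * ((1 - x) ^ j - 1 + real j * x) + real j * x\<^sup>2\<bar>"
    by (simp add: algebra_simps power2_eq_square)
  also have "\<dots> \<le> (1 - x) * \<bar>(1 - x) ^ j - 1 + real j * x\<bar> + real j * x\<^sup>2"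
    using assms by (intro order.trans[OF abs_triangle_ineq]) (auto simp: abs_mult)
  also have "\<dots> \<le> 1 * ((real j)\<^sup>2 * x\<^sup>2) + real j * x\<^sup>2"
    using assms Suc by (intro add_mono mult_mono) auto
  also have "\<dots> \<le> (real (Suc j))\<^sup>2 * x\<^sup>2" using assms by (simp add: algebra_simps power2_eq_square)
  finally show ?case .
qed

text \<open>One step moves the value by \<open>O(1 / n)\<close>, but its mean only by
  \<open>O(1 / n^2)\<close>. The mean loss of the content sum is \<open>(k + 1) / n\<close> times
  the content sum up to order \<open>n^(k - 1)\<close>, by \<open>cotrans_moment_approx\<close>, and
  the change of the denominator from \<open>n^(k + 1)\<close> to \<open>(n - 1)^(k + 1)\<close>
  compensates it to first order.\<close>

lemma scaled_sum_drift:
  assumes k: "k \<ge> 1"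
  obtains C where "C \<ge> 0"
    "\<And>D. young D \<Longrightarrow> card D \<ge> 2 \<Longrightarrow> \<bar>down (scaled_sum k) D - scaled_sum k D\<bar> \<le> C / (real (card D))\<^sup>2"
    "\<And>D b. young D \<Longrightarrow> card D \<ge> 2 \<Longrightarrow> b \<in> removable D \<Longrightarrow> \<bar>scaled_sum k (D - {b}) - scaled_sum k D\<bar> \<le> C / real (card D)"
proof -
  obtain C0 where C0: "C0 \<ge> 0" "\<And>D. young D \<Longrightarrow> D \<noteq> {} \<Longrightarrow>
    \<bar>real (card D) * cotrans_moment k D - (real k + 1) * content_sum k D\<bar> \<le> C0 * real (card D) ^ k"
    using cotrans_moment_approx[OF k] by blast
  define K where "K = real k + 1"
  \<comment> \<open>The factor \<open>2 ^ (k + 1)\<close> pays for replacing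
    \<open>(n - 1) ^ (k + 1)\<close> by \<open>n ^ (k + 1)\<close> in denominators, as
    \<open>n \<ge> 2\<close>.\<close>
  define C where "C = 2 ^ (k + 1) * (C0 + K\<^sup>2 + K + 1)"
  have K: "K \<ge> 1" by (simp add: K_def)
  have "C \<ge> 0" using C0 K by (simp add: C_def)
  have *: "\<bar>down (scaled_sum k) D - scaled_sum k D\<bar> \<le> C / (real (card D))\<^sup>2 \<and>
    (\<forall>b\<in>removable D. \<bar>scaled_sum k (D - {b}) - scaled_sum k D\<bar> \<le> C / real (card D))"
    if D: "young D" "card D \<ge> 2" for D
  proof -
    define n where "n = real (card D)"
    define q where "q = content_sum k D"
    define S where "S = cotrans_moment k D"
    have n: "n \<ge> 2" using D by (simp add: n_def)
    have ne: "D \<noteq> {}" using D by auto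
    have fin: "finite D" using D by (simp add: young_finite)
    have q: "\<bar>q\<bar> \<le> n ^ (k + 1)" unfolding q_def n_def by (rule content_sum_bound[OF D(1)])
    define P where "P = (n - 1) ^ (k + 1)"
    have P: "P > 0" "P = n ^ (k + 1) * (1 - 1 / n) ^ (k + 1)"
      using n by (auto simp: P_def power_mult_distrib[symmetric] algebra_simps)
    have P2: "n ^ (k + 1) \<le> 2 ^ (k + 1) * P"
    proof -
      have "n ^ (k + 1) \<le> (2 * (n - 1)) ^ (k + 1)" using n by (intro power_mono) auto
      also have "\<dots> = 2 ^ (k + 1) * P" unfolding P_def power_mult_distrib ..
      finally show ?thesis .
    qed
    have sb: "scaled_sum k (D - {b}) = (q - real_of_int (box_content b) ^ k) / P" if "b \<in> removable D" for b
    proof -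
      have bD: "b \<in> D" using that by (simp add: removable_def)
      have "real (card (D - {b})) = n - 1" using bD fin D by (simp add: n_def of_nat_diff)
      moreover have "content_sum k (D - {b}) = q - real_of_int (box_content b) ^ k"
        using bD fin by (simp add: content_sum_def q_def sum.remove)
      ultimately show ?thesis unfolding scaled_sum_def P_def by simp
    qed
    have "down (scaled_sum k) D = (\<Sum>b\<in>removable D. real (dimY (D - {b})) / real (dimY D) * ((q - real_of_int (box_content b) ^ k) / P))"
      unfolding down_def using sb by (intro sum.cong) auto
    also have "\<dots> = (\<Sum>b\<in>removable D. real (dimY (D - {b})) / real (dimY D)) * q / P - S / P"
      unfolding S_def cotrans_moment_def sum_distrib_right sum_divide_distrib sum_subtractf[symmetric]
      by (intro sum.cong) (auto simp: algebra_simps diff_divide_distrib)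
    also have "\<dots> = (q - S) / P" unfolding down_weights[OF D(1) ne] by (simp add: diff_divide_distrib)
    finally have dn: "down (scaled_sum k) D = (q - S) / P" .
    have sD: "scaled_sum k D = q * (1 - 1 / n) ^ (k + 1) / P"
      using n P unfolding P(2) by (simp add: scaled_sum_def q_def n_def)
    define r where "r = (1 - 1 / n) ^ (k + 1) - 1 + K / n"
    have r: "\<bar>r\<bar> \<le> K\<^sup>2 / n\<^sup>2"
      using one_minus_power_approx[of "1 / n" "k + 1"] n by (simp add: r_def K_def power_divide add.commute)
    have pw: "(1 - 1 / n) ^ (k + 1) = 1 - K / n + r" by (simp add: r_def)
    have qr: "\<bar>q * r\<bar> \<le> K\<^sup>2 * n ^ (k + 1) / n\<^sup>2"
    proof -
      have "\<bar>q\<bar> * \<bar>r\<bar> \<le> n ^ (k + 1) * (K\<^sup>2 / n\<^sup>2)" using q r n by (intro mult_mono) auto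
      then show ?thesis by (simp add: abs_mult mult.commute)
    qed
    have main1: "\<bar>(q - S) - q * (1 - 1 / n) ^ (k + 1)\<bar> \<le> (C0 + K\<^sup>2) * (n ^ (k + 1) / n\<^sup>2)"
    proof -
      have "(q - S) - q * (1 - 1 / n) ^ (k + 1) = - ((n * S - K * q) / n) - q * r"
        unfolding pw using n by (simp add: field_simps)
      moreover have "\<bar>(n * S - K * q) / n\<bar> \<le> C0 * n ^ k / n"
        using C0(2)[OF D(1) ne] n by (simp add: K_def n_def S_def q_def divide_right_mono)
      moreover have "C0 * n ^ k / n = C0 * (n ^ (k + 1) / n\<^sup>2)" using n by (simp add: power2_eq_square)
      moreover have "\<bar>q * r\<bar> \<le> K\<^sup>2 * (n ^ (k + 1) / n\<^sup>2)" using qr by simp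
      ultimately show ?thesis unfolding distrib_right by linarith
    qed
    have fac: "x / P \<le> 2 ^ (k + 1) * (x / n ^ (k + 1))" if "x \<ge> 0" for x
    proof -
      have "x * n ^ (k + 1) \<le> x * (2 ^ (k + 1) * P)" using P2 that by (intro mult_left_mono) auto
      then show ?thesis using P(1) n by (simp add: field_simps)
    qed
    have "\<bar>down (scaled_sum k) D - scaled_sum k D\<bar> = \<bar>(q - S) - q * (1 - 1 / n) ^ (k + 1)\<bar> / P"
      unfolding dn sD diff_divide_distrib[symmetric] using P by simp
    also have "\<dots> \<le> 2 ^ (k + 1) * (\<bar>(q - S) - q * (1 - 1 / n) ^ (k + 1)\<bar> / n ^ (k + 1))" by (rule fac) simp
    also have "\<dots> \<le> 2 ^ (k + 1) * ((C0 + K\<^sup>2) * (n ^ (k + 1) / n\<^sup>2) / n ^ (k + 1))"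
      using main1 n by (intro mult_left_mono divide_right_mono) auto
    also have "\<dots> = 2 ^ (k + 1) * (C0 + K\<^sup>2) / n\<^sup>2" using n by simp
    also have "\<dots> \<le> C / n\<^sup>2" unfolding C_def using K C0 by (intro divide_right_mono mult_left_mono) auto
    finally have 1: "\<bar>down (scaled_sum k) D - scaled_sum k D\<bar> \<le> C / n\<^sup>2" .
    have 2: "\<bar>scaled_sum k (D - {b}) - scaled_sum k D\<bar> \<le> C / n" if b: "b \<in> removable D" for b
    proof -
      have "b \<in> D" using b by (simp add: removable_def)
      then have "\<bar>real_of_int (box_content b)\<bar> \<le> n" using real_content_less_card[OF D(1), of b] by (simp add: n_def)
      then have c: "\<bar>real_of_int (box_content b) ^ k\<bar> \<le> n ^ k" unfolding power_abs by (intro power_mono) auto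
      have nk: "n ^ k = n ^ (k + 1) / n" using n by simp
      have "(q - real_of_int (box_content b) ^ k) - q * (1 - 1 / n) ^ (k + 1) = - (real_of_int (box_content b) ^ k) + K * q / n - q * r"
        unfolding pw by (simp add: algebra_simps)
      moreover have "\<bar>K * q / n\<bar> \<le> K * (n ^ (k + 1) / n)"
      proof -
        have "\<bar>q\<bar> / n \<le> n ^ (k + 1) / n" using q n by (intro divide_right_mono) auto
        then have "K * (\<bar>q\<bar> / n) \<le> K * (n ^ (k + 1) / n)" using K by (intro mult_left_mono) auto
        then show ?thesis using n K by (simp add: abs_mult)
      qed
      moreover have "K\<^sup>2 * n ^ (k + 1) / n\<^sup>2 \<le> K\<^sup>2 * (n ^ (k + 1) / n)"
      proof -
        have "n ^ (k + 1) / n\<^sup>2 \<le> n ^ (k + 1) / n"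
          using n by (intro divide_left_mono) (auto simp: power2_eq_square)
        then have "K\<^sup>2 * (n ^ (k + 1) / n\<^sup>2) \<le> K\<^sup>2 * (n ^ (k + 1) / n)" by (intro mult_left_mono) auto
        then show ?thesis by simp
      qed
      ultimately have m: "\<bar>(q - real_of_int (box_content b) ^ k) - q * (1 - 1 / n) ^ (k + 1)\<bar> \<le> (K\<^sup>2 + K + 1) * (n ^ (k + 1) / n)"
        using qr c unfolding nk distrib_right by linarith
      have "\<bar>scaled_sum k (D - {b}) - scaled_sum k D\<bar> = \<bar>(q - real_of_int (box_content b) ^ k) - q * (1 - 1 / n) ^ (k + 1)\<bar> / P"
        unfolding sb[OF b] sD diff_divide_distrib[symmetric] using P by simp
      also have "\<dots> \<le> 2 ^ (k + 1) * (\<bar>(q - real_of_int (box_content b) ^ k) - q * (1 - 1 / n) ^ (k + 1)\<bar> / n ^ (k + 1))" by (rule fac) simp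
      also have "\<dots> \<le> 2 ^ (k + 1) * ((K\<^sup>2 + K + 1) * (n ^ (k + 1) / n) / n ^ (k + 1))"
        using m n by (intro mult_left_mono divide_right_mono) auto
      also have "\<dots> = 2 ^ (k + 1) * (K\<^sup>2 + K + 1) / n" using n by simp
      also have "\<dots> \<le> C / n" unfolding C_def using n C0 by (intro divide_right_mono mult_left_mono) auto
      finally show ?thesis .
    qed
    show ?thesis using 1 2 by (simp add: n_def)
  qed
  show thesis by (rule that[OF \<open>C \<ge> 0\<close>]) (use * in blast)+
qed

text \<open>In one step the mean square deviation from a fixed value grows by at most
  \<open>C / n^2\<close>: the squared jump and the drift are both of this order. Summed down to
  level \<open>m\<close> this is at most \<open>C / m\<close>, whatever the initial size.\<close>

lemma scaled_sum_variance:
  assumes k: "k \<ge> 1"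
  obtains C where "C \<ge> 0"
    "\<And>D m. young D \<Longrightarrow> 1 \<le> m \<Longrightarrow> m \<le> card D \<Longrightarrow>
      (down ^^ (card D - m)) (\<lambda>E. (scaled_sum k E - scaled_sum k D)\<^sup>2) D \<le> C / real m"
proof -
  obtain C0 where C0: "C0 \<ge> 0"
    "\<And>D. young D \<Longrightarrow> card D \<ge> 2 \<Longrightarrow> \<bar>down (scaled_sum k) D - scaled_sum k D\<bar> \<le> C0 / (real (card D))\<^sup>2"
    "\<And>D b. young D \<Longrightarrow> card D \<ge> 2 \<Longrightarrow> b \<in> removable D \<Longrightarrow> \<bar>scaled_sum k (D - {b}) - scaled_sum k D\<bar> \<le> C0 / real (card D)"
    using scaled_sum_drift[OF k] by blast
  \<comment> \<open>\<open>C0^2\<close> is the squared jump; \<open>4 * C0\<close> is the cross term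
    \<open>2 * (s - x)\<close> times the drift, with
    \<open>\<bar>s - x\<bar> \<le> 2\<close>.\<close>
  define C where "C = 4 * C0 + C0\<^sup>2"
  have C: "C \<ge> 0" using C0 by (simp add: C_def)
  have step: "down (\<lambda>E. (scaled_sum k E - x)\<^sup>2) D \<le> (scaled_sum k D - x)\<^sup>2 + C / (real (card D))\<^sup>2"
    if D: "young D" "card D \<ge> 2" and x: "\<bar>x\<bar> \<le> 1" for D x
  proof -
    define s where "s = scaled_sum k D"
    define n where "n = real (card D)"
    have ne: "D \<noteq> {}" using D by auto
    have "down (\<lambda>E. (scaled_sum k E - x)\<^sup>2) D
      \<le> down (\<lambda>E. ((s - x)\<^sup>2 - 2 * (s - x) * s + C0\<^sup>2 / n\<^sup>2) + 2 * (s - x) * scaled_sum k E) D"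
    proof (rule down_mono)
      fix b assume b: "b \<in> removable D"
      define y where "y = scaled_sum k (D - {b})"
      have "\<bar>y - s\<bar> \<le> C0 / n" using C0(3)[OF D b] by (simp add: y_def s_def n_def)
      then have "(y - s)\<^sup>2 \<le> (C0 / n)\<^sup>2" by (metis abs_ge_zero power2_abs power_mono)
      then show "(y - x)\<^sup>2 \<le> ((s - x)\<^sup>2 - 2 * (s - x) * s + C0\<^sup>2 / n\<^sup>2) + 2 * (s - x) * y"
        by (simp add: power_divide) (simp add: power2_eq_square algebra_simps)
    qed
    also have "\<dots> = ((s - x)\<^sup>2 - 2 * (s - x) * s + C0\<^sup>2 / n\<^sup>2) + 2 * (s - x) * down (scaled_sum k) D"
      unfolding down_add down_cmult down_const[OF D(1) ne] ..
    also have "\<dots> = (s - x)\<^sup>2 + C0\<^sup>2 / n\<^sup>2 + 2 * ((s - x) * (down (scaled_sum k) D - s))"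
      by (simp add: algebra_simps)
    also have "(s - x) * (down (scaled_sum k) D - s) \<le> 2 * (C0 / n\<^sup>2)"
    proof -
      have "\<bar>s - x\<bar> \<le> 2" using scaled_sum_le_1[OF D(1), of k] x by (simp add: s_def)
      then have "\<bar>s - x\<bar> * \<bar>down (scaled_sum k) D - s\<bar> \<le> 2 * (C0 / n\<^sup>2)"
        using C0(2)[OF D] by (intro mult_mono) (auto simp: s_def n_def)
      then show ?thesis by (simp add: abs_mult[symmetric])
    qed
    also have "(s - x)\<^sup>2 + C0\<^sup>2 / n\<^sup>2 + 2 * (2 * (C0 / n\<^sup>2)) = (s - x)\<^sup>2 + C / n\<^sup>2"
      by (simp add: C_def add_divide_distrib)
    finally show ?thesis by (simp add: s_def n_def)
  qed
  have iter: "(down ^^ j) (\<lambda>E. (scaled_sum k E - x)\<^sup>2) D \<le> (scaled_sum k D - x)\<^sup>2 + C * (1 / real (card D - j) - 1 / real (card D))"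
    if "young D" "j < card D" "\<bar>x\<bar> \<le> 1" for D x j
    using that
  proof (induction j arbitrary: D)
    case 0
    then show ?case by simp
  next
    case (Suc j)
    define n where "n = real (card D)"
    have n: "n \<ge> 2" and ne: "D \<noteq> {}" using Suc.prems by (auto simp: n_def)
    define A where "A = C * (1 / real (card D - Suc j) - 1 / (n - 1))"
    have "down ((down ^^ j) (\<lambda>E. (scaled_sum k E - x)\<^sup>2)) D \<le> down (\<lambda>E. (scaled_sum k E - x)\<^sup>2 + A) D"
    proof (rule down_mono)
      fix b assume b: "b \<in> removable D"
      have cb: "card (D - {b}) = card D - 1" using card_removable[OF Suc.prems(1) b] .
      have "(down ^^ j) (\<lambda>E. (scaled_sum k E - x)\<^sup>2) (D - {b})
        \<le> (scaled_sum k (D - {b}) - x)\<^sup>2 + C * (1 / real (card (D - {b}) - j) - 1 / real (card (D - {b})))"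
        using Suc.prems cb by (intro Suc.IH removable_young[OF b]) auto
      also have "C * (1 / real (card (D - {b}) - j) - 1 / real (card (D - {b}))) = A"
        using Suc.prems by (simp add: A_def cb n_def of_nat_diff)
      finally show "(down ^^ j) (\<lambda>E. (scaled_sum k E - x)\<^sup>2) (D - {b}) \<le> (scaled_sum k (D - {b}) - x)\<^sup>2 + A" .
    qed
    also have "\<dots> = down (\<lambda>E. (scaled_sum k E - x)\<^sup>2) D + A"
      unfolding down_add down_const[OF Suc.prems(1) ne] ..
    also have "\<dots> \<le> (scaled_sum k D - x)\<^sup>2 + C / n\<^sup>2 + A"
      using step[OF Suc.prems(1) _ Suc.prems(3)] Suc.prems by (simp add: n_def)
    also have "C / n\<^sup>2 \<le> C * (1 / (n - 1) - 1 / n)"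
    proof -
      \<comment> \<open>Bounding \<open>1 / n^2\<close> by this difference lets the increments
        telescope along the chain.\<close>
      have "1 / n\<^sup>2 \<le> 1 / (n - 1) - 1 / n" using n by (simp add: field_simps power2_eq_square)
      then show ?thesis using C mult_left_mono by fastforce
    qed
    also have "(scaled_sum k D - x)\<^sup>2 + C * (1 / (n - 1) - 1 / n) + A = (scaled_sum k D - x)\<^sup>2 + C * (1 / real (card D - Suc j) - 1 / n)"
      by (simp add: A_def algebra_simps)
    finally show ?case by (simp add: n_def)
  qed
  have "(down ^^ (card D - m)) (\<lambda>E. (scaled_sum k E - scaled_sum k D)\<^sup>2) D \<le> C / real m"
    if "young D" "1 \<le> m" "m \<le> card D" for D m
  proof -
    have "(down ^^ (card D - m)) (\<lambda>E. (scaled_sum k E - scaled_sum k D)\<^sup>2) D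
      \<le> (scaled_sum k D - scaled_sum k D)\<^sup>2 + C * (1 / real (card D - (card D - m)) - 1 / real (card D))"
      using that by (intro iter scaled_sum_le_1) auto
    also have "\<dots> \<le> C / real m" using that C by (simp add: algebra_simps)
    finally show ?thesis .
  qed
  then show thesis using that C by blast
qed

text \<open>A function on diagrams is stable if, started from a large diagram, its value along the random
  down chain stays close to the initial value in mean, as long as the diagram is large.\<close>

definition down_stable :: "((nat \<times> nat) set \<Rightarrow> real) \<Rightarrow> bool" where
  "down_stable F \<longleftrightarrow> (\<forall>e>0. \<exists>m0. \<forall>m\<ge>m0. \<forall>D. young D \<longrightarrow> m \<le> card D \<longrightarrow>
     (down ^^ (card D - m)) (\<lambda>E. \<bar>F E - F D\<bar>) D \<le> e)"

lemma down_stableI: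
  assumes "\<And>e. e > 0 \<Longrightarrow> \<exists>m0. \<forall>m\<ge>m0. \<forall>D. young D \<longrightarrow> m \<le> card D \<longrightarrow>
     (down ^^ (card D - m)) (\<lambda>E. \<bar>F E - F D\<bar>) D \<le> e"
  shows "down_stable F"
  using assms by (simp add: down_stable_def)

lemma down_stable_const: "down_stable (\<lambda>_. c)"
  by (rule down_stableI) (auto simp: down_pow_const)

lemma down_stable_scaled_sum:
  assumes k: "k \<ge> 1"
  shows "down_stable (scaled_sum k)"
proof (rule down_stableI)
  fix e :: real assume e: "e > 0"
  obtain C where C: "C \<ge> 0"
    "\<And>D m. young D \<Longrightarrow> 1 \<le> m \<Longrightarrow> m \<le> card D \<Longrightarrow>
      (down ^^ (card D - m)) (\<lambda>E. (scaled_sum k E - scaled_sum k D)\<^sup>2) D \<le> C / real m"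
    using scaled_sum_variance[OF k] by blast
  \<comment> \<open>From mean square to mean by \<open>y \<le> d + y^2 / d\<close>: the mean of the
    second term is at most \<open>C / (d * m)\<close>, which is at most \<open>d\<close> once
    \<open>m \<ge> C / d^2\<close>.\<close>
  define d where "d = e / 2"
  have d: "d > 0" using e by (simp add: d_def)
  obtain m0 where m0: "real m0 > C / d\<^sup>2" using reals_Archimedean2 by blast
  have "(down ^^ (card D - m)) (\<lambda>E. \<bar>scaled_sum k E - scaled_sum k D\<bar>) D \<le> e"
    if m: "m \<ge> m0 + 1" "young D" "m \<le> card D" for m D
  proof -
    have "(down ^^ (card D - m)) (\<lambda>E. \<bar>scaled_sum k E - scaled_sum k D\<bar>) D
      \<le> (down ^^ (card D - m)) (\<lambda>E. d + (1 / d) * (scaled_sum k E - scaled_sum k D)\<^sup>2) D"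
    proof (rule down_pow_mono)
      fix E
      define y where "y = \<bar>scaled_sum k E - scaled_sum k D\<bar>"
      have "y * d \<le> d * d + y * y"
      proof (cases "y \<le> d")
        case True
        then have "y * d \<le> d * d" using d by (intro mult_right_mono) auto
        then show ?thesis by (simp add: add_increasing2)
      next
        case False
        then have "y * d \<le> y * y" using d by (intro mult_left_mono) auto
        then show ?thesis by (simp add: add_increasing)
      qed
      then have "y \<le> d + (1 / d) * y\<^sup>2" using d by (simp add: field_simps power2_eq_square)
      then show "\<bar>scaled_sum k E - scaled_sum k D\<bar> \<le> d + (1 / d) * (scaled_sum k E - scaled_sum k D)\<^sup>2"
        by (simp add: y_def)
    qed (use m in auto)
    also have "\<dots> = d + (1 / d) * (down ^^ (card D - m)) (\<lambda>E. (scaled_sum k E - scaled_sum k D)\<^sup>2) D"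
      unfolding down_pow_add down_pow_cmult using m by (simp add: down_pow_const)
    also have "\<dots> \<le> d + (1 / d) * (C / real m)" using C(2)[of D m] m d by (intro add_left_mono mult_left_mono) auto
    also have "(1 / d) * (C / real m) \<le> d"
    proof -
      have "C / d\<^sup>2 \<le> real m" using m0 m by linarith
      then show ?thesis using d m by (simp add: field_simps power2_eq_square)
    qed
    finally show ?thesis by (simp add: d_def)
  qed
  then show "\<exists>m0. \<forall>m\<ge>m0. \<forall>D. young D \<longrightarrow> m \<le> card D \<longrightarrow>
     (down ^^ (card D - m)) (\<lambda>E. \<bar>scaled_sum k E - scaled_sum k D\<bar>) D \<le> e" by blast
qed

lemma down_stable_add:
  assumes "down_stable F" "down_stable G"
  shows "down_stable (\<lambda>D. F D + G D)"
proof (rule down_stableI)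
  fix e :: real assume e: "e > 0"
  obtain m1 where m1: "\<And>m D. m \<ge> m1 \<Longrightarrow> young D \<Longrightarrow> m \<le> card D \<Longrightarrow> (down ^^ (card D - m)) (\<lambda>E. \<bar>F E - F D\<bar>) D \<le> e / 2"
    using assms(1) e unfolding down_stable_def by (meson half_gt_zero)
  obtain m2 where m2: "\<And>m D. m \<ge> m2 \<Longrightarrow> young D \<Longrightarrow> m \<le> card D \<Longrightarrow> (down ^^ (card D - m)) (\<lambda>E. \<bar>G E - G D\<bar>) D \<le> e / 2"
    using assms(2) e unfolding down_stable_def by (meson half_gt_zero)
  have "(down ^^ (card D - m)) (\<lambda>E. \<bar>(F E + G E) - (F D + G D)\<bar>) D \<le> e"
    if m: "m \<ge> max m1 m2" "young D" "m \<le> card D" for m D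
  proof -
    have "(down ^^ (card D - m)) (\<lambda>E. \<bar>(F E + G E) - (F D + G D)\<bar>) D
      \<le> (down ^^ (card D - m)) (\<lambda>E. \<bar>F E - F D\<bar> + \<bar>G E - G D\<bar>) D"
      using m by (intro down_pow_mono) auto
    also have "\<dots> \<le> e" unfolding down_pow_add using m1[of m D] m2[of m D] m by simp
    finally show ?thesis .
  qed
  then show "\<exists>m0. \<forall>m\<ge>m0. \<forall>D. young D \<longrightarrow> m \<le> card D \<longrightarrow>
     (down ^^ (card D - m)) (\<lambda>E. \<bar>(F E + G E) - (F D + G D)\<bar>) D \<le> e" by blast
qed

lemma down_stable_mult:
  assumes "down_stable F" "down_stable G"
    and B: "\<And>D. young D \<Longrightarrow> \<bar>F D\<bar> \<le> B" "\<And>D. young D \<Longrightarrow> \<bar>G D\<bar> \<le> B"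
  shows "down_stable (\<lambda>D. F D * G D)"
proof (rule down_stableI)
  fix e :: real assume e: "e > 0"
  define B' where "B' = B + 1"
  have "0 \<le> B" using B(1)[of "{}"] by simp
  then have B': "B' > 0" by (simp add: B'_def)
  define d where "d = e / (2 * B')"
  have d: "d > 0" using e B' by (simp add: d_def)
  obtain m1 where m1: "\<And>m D. m \<ge> m1 \<Longrightarrow> young D \<Longrightarrow> m \<le> card D \<Longrightarrow> (down ^^ (card D - m)) (\<lambda>E. \<bar>F E - F D\<bar>) D \<le> d"
    using assms(1) d unfolding down_stable_def by meson
  obtain m2 where m2: "\<And>m D. m \<ge> m2 \<Longrightarrow> young D \<Longrightarrow> m \<le> card D \<Longrightarrow> (down ^^ (card D - m)) (\<lambda>E. \<bar>G E - G D\<bar>) D \<le> d"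
    using assms(2) d unfolding down_stable_def by meson
  have "(down ^^ (card D - m)) (\<lambda>E. \<bar>F E * G E - F D * G D\<bar>) D \<le> e"
    if m: "m \<ge> max m1 m2" "young D" "m \<le> card D" for m D
  proof -
    have "(down ^^ (card D - m)) (\<lambda>E. \<bar>F E * G E - F D * G D\<bar>) D
      \<le> (down ^^ (card D - m)) (\<lambda>E. B' * \<bar>F E - F D\<bar> + B' * \<bar>G E - G D\<bar>) D"
    proof (rule down_pow_mono)
      fix E assume E: "young E"
      have "\<bar>F E * G E - F D * G D\<bar> = \<bar>(F E - F D) * G E + F D * (G E - G D)\<bar>" by (simp add: algebra_simps)
      also have "\<dots> \<le> \<bar>F E - F D\<bar> * \<bar>G E\<bar> + \<bar>F D\<bar> * \<bar>G E - G D\<bar>"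
        by (intro order.trans[OF abs_triangle_ineq]) (simp add: abs_mult)
      also have "\<dots> \<le> \<bar>F E - F D\<bar> * B' + B' * \<bar>G E - G D\<bar>"
        using B(1)[OF m(2)] B(2)[OF E] by (intro add_mono mult_mono) (auto simp: B'_def)
      finally show "\<bar>F E * G E - F D * G D\<bar> \<le> B' * \<bar>F E - F D\<bar> + B' * \<bar>G E - G D\<bar>" by (simp add: mult.commute)
    qed (use m in auto)
    also have "\<dots> \<le> B' * d + B' * d" unfolding down_pow_add down_pow_cmult
      using m1[of m D] m2[of m D] m B' by (intro add_mono mult_left_mono) auto
    also have "\<dots> = e" using B' by (simp add: d_def field_simps)
    finally show ?thesis .
  qed
  then show "\<exists>m0. \<forall>m\<ge>m0. \<forall>D. young D \<longrightarrow> m \<le> card D \<longrightarrow>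
     (down ^^ (card D - m)) (\<lambda>E. \<bar>F E * G E - F D * G D\<bar>) D \<le> e" by blast
qed

text \<open>Closeness is asked for on large diagrams only, so the lemma covers both uniform limits
  on the simplex and replacements that are correct up to \<open>O(1 / n)\<close>.\<close>

lemma down_stable_approx:
  assumes "\<And>e. e > 0 \<Longrightarrow> \<exists>G n0. down_stable G \<and> (\<forall>D. young D \<longrightarrow> n0 \<le> card D \<longrightarrow> \<bar>F D - G D\<bar> \<le> e)"
  shows "down_stable F"
proof (rule down_stableI)
  fix e :: real assume e: "e > 0"
  then have e3: "e / 3 > 0" by simp
  obtain G n0 where G: "down_stable G" "\<And>D. young D \<Longrightarrow> n0 \<le> card D \<Longrightarrow> \<bar>F D - G D\<bar> \<le> e / 3"
    using assms[OF e3] by blast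
  obtain m1 where m1: "\<And>m D. m \<ge> m1 \<Longrightarrow> young D \<Longrightarrow> m \<le> card D \<Longrightarrow> (down ^^ (card D - m)) (\<lambda>E. \<bar>G E - G D\<bar>) D \<le> e / 3"
    using G(1) e3 unfolding down_stable_def by meson
  have "(down ^^ (card D - m)) (\<lambda>E. \<bar>F E - F D\<bar>) D \<le> e"
    if m: "m \<ge> max m1 n0" "young D" "m \<le> card D" for m D
  proof -
    have "(down ^^ (card D - m)) (\<lambda>E. \<bar>F E - F D\<bar>) D
      \<le> (down ^^ (card D - m)) (\<lambda>E. 2 * (e / 3) + \<bar>G E - G D\<bar>) D"
    proof (rule down_pow_mono)
      fix E assume E: "young E" "card E = card D - (card D - m)"
      then have "\<bar>F E - G E\<bar> \<le> e / 3" "\<bar>F D - G D\<bar> \<le> e / 3" using m G(2)[of E] G(2)[of D] by auto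
      then show "\<bar>F E - F D\<bar> \<le> 2 * (e / 3) + \<bar>G E - G D\<bar>" by linarith
    qed (use m in auto)
    also have "\<dots> \<le> e" unfolding down_pow_add using m1[of m D] m by (simp add: down_pow_const)
    finally show ?thesis .
  qed
  then show "\<exists>m0. \<forall>m\<ge>m0. \<forall>D. young D \<longrightarrow> m \<le> card D \<longrightarrow>
     (down ^^ (card D - m)) (\<lambda>E. \<bar>F E - F D\<bar>) D \<le> e" by blast
qed


section \<open>Frobenius coordinates\<close>

lemma downset_eq_atLeastAtMost:
  assumes "finite S" "\<And>i. i \<in> S \<Longrightarrow> 1 \<le> i" "\<And>i i'. i \<in> S \<Longrightarrow> 1 \<le> i' \<Longrightarrow> i' \<le> i \<Longrightarrow> i' \<in> S"
  shows "S = {1..card S}"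
proof (cases "S = {}")
  case True
  then show ?thesis by simp
next
  case False
  then have "Max S \<in> S" using assms(1) by (rule Max_in[rotated])
  have "S = {1..Max S}"
  proof (intro equalityI subsetI)
    fix i assume "i \<in> S"
    then show "i \<in> {1..Max S}" using assms(2)[of i] Max_ge[OF assms(1)] by simp
  next
    fix i assume "i \<in> {1..Max S}"
    then show "i \<in> S" using assms(3)[OF \<open>Max S \<in> S\<close>, of i] by simp
  qed
  then have "card S = Max S" by (metis card_atLeastAtMost diff_Suc_1)
  then show ?thesis using \<open>S = {1..Max S}\<close> by simp
qed

lemma diag_len_empty [simp]: "diag_len {} = 0"
  by (simp add: diag_len_def)

lemma diag_iff:
  assumes "young D"
  shows "(i, i) \<in> D \<longleftrightarrow> 1 \<le> i \<and> i \<le> diag_len D"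
proof -
  have "{i. (i, i) \<in> D} = {1..card {i. (i, i) \<in> D}}"
  proof (rule downset_eq_atLeastAtMost)
    have "{i. (i, i) \<in> D} \<subseteq> fst ` D" by force
    then show "finite {i. (i, i) \<in> D}" using young_finite[OF assms] finite_subset by blast
  next
    fix i assume "i \<in> {i. (i, i) \<in> D}"
    then show "1 \<le> i" using youngD(1)[OF assms, of i i] by simp
  next
    fix i i' assume "i \<in> {i. (i, i) \<in> D}" "1 \<le> i'" "i' \<le> i"
    then show "i' \<in> {i. (i, i) \<in> D}" using youngD(3)[OF assms, of i i i' i'] by simp
  qed
  then show ?thesis unfolding diag_len_def by (metis (mono_tags, lifting) atLeastAtMost_iff mem_Collect_eq)
qed

lemma row_iff:
  assumes "young D" "1 \<le> i"
  shows "(i, j) \<in> D \<longleftrightarrow> 1 \<le> j \<and> j \<le> row_len D i"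
proof -
  have "{j. (i, j) \<in> D} = {1..card {j. (i, j) \<in> D}}"
  proof (rule downset_eq_atLeastAtMost)
    have "{j. (i, j) \<in> D} \<subseteq> snd ` D" by force
    then show "finite {j. (i, j) \<in> D}" using young_finite[OF assms(1)] finite_subset by blast
  next
    fix j assume "j \<in> {j. (i, j) \<in> D}"
    then show "1 \<le> j" using youngD(2)[OF assms(1), of i j] by simp
  next
    fix j j' assume "j \<in> {j. (i, j) \<in> D}" "1 \<le> j'" "j' \<le> j"
    then show "j' \<in> {j. (i, j) \<in> D}" using youngD(3)[OF assms(1), of i j i j'] assms(2) by simp
  qed
  then show ?thesis unfolding row_len_def by (metis (mono_tags, lifting) atLeastAtMost_iff mem_Collect_eq)
qed

lemma col_iff:
  assumes "young D" "1 \<le> j"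
  shows "(i, j) \<in> D \<longleftrightarrow> 1 \<le> i \<and> i \<le> col_len D j"
proof -
  have "{i. (i, j) \<in> D} = {1..card {i. (i, j) \<in> D}}"
  proof (rule downset_eq_atLeastAtMost)
    have "{i. (i, j) \<in> D} \<subseteq> fst ` D" by force
    then show "finite {i. (i, j) \<in> D}" using young_finite[OF assms(1)] finite_subset by blast
  next
    fix i assume "i \<in> {i. (i, j) \<in> D}"
    then show "1 \<le> i" using youngD(1)[OF assms(1), of i j] by simp
  next
    fix i i' assume "i \<in> {i. (i, j) \<in> D}" "1 \<le> i'" "i' \<le> i"
    then show "i' \<in> {i. (i, j) \<in> D}" using youngD(3)[OF assms(1), of i j i' j] assms(2) by simp
  qed
  then show ?thesis unfolding col_len_def by (metis (mono_tags, lifting) atLeastAtMost_iff mem_Collect_eq)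
qed

text \<open>An integer, since rows past the diagonal are shorter than their index.
  \<open>arm D k + 1/2\<close> is the modified Frobenius coordinate of index
  \<open>k + 1\<close>.\<close>

definition arm :: "(nat \<times> nat) set \<Rightarrow> nat \<Rightarrow> int" where
  "arm D k = int (row_len D (Suc k)) - int (Suc k)"

definition leg :: "(nat \<times> nat) set \<Rightarrow> nat \<Rightarrow> int" where
  "leg D k = int (col_len D (Suc k)) - int (Suc k)"

lemma arm_leg_nonneg:
  assumes "young D" "k < diag_len D"
  shows "0 \<le> arm D k" "0 \<le> leg D k"
proof -
  have "(Suc k, Suc k) \<in> D" using diag_iff[OF assms(1)] assms(2) by simp
  then show "0 \<le> arm D k" "0 \<le> leg D k"
    using row_iff[OF assms(1), of "Suc k" "Suc k"] col_iff[OF assms(1), of "Suc k" "Suc k"] by (auto simp: arm_def leg_def)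
qed

text \<open>The diagram is cut into its diagonal hooks; along hook \<open>k\<close> the contents run
  once through the interval from \<open>- leg D k\<close> to \<open>arm D k\<close>.\<close>

lemma sum_content_hooks:
  assumes D: "young D"
  shows "(\<Sum>b\<in>D. f (box_content b)) = (\<Sum>k<diag_len D. \<Sum>c\<in>{- leg D k..arm D k}. f c)"
proof -
  \<comment> \<open>The index of the diagonal hook that contains the box.\<close>
  define g :: "nat \<times> nat \<Rightarrow> nat" where "g b = min (fst b) (snd b) - 1" for b
  have g: "g ` D \<subseteq> {..<diag_len D}"
  proof (rule image_subsetI)
    fix b assume b: "b \<in> D"
    obtain i j where e: "b = (i, j)" by fastforce
    have ij: "(i, j) \<in> D" using b e by simp
    have 1: "1 \<le> i" "1 \<le> j" using youngD(1,2)[OF D ij] by auto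
    have "(min i j, min i j) \<in> D" using youngD(3)[OF D ij, of "min i j" "min i j"] 1 by auto
    then show "g b \<in> {..<diag_len D}" using diag_iff[OF D, of "min i j"] 1 by (auto simp: g_def e)
  qed
  have "(\<Sum>b\<in>D. f (box_content b)) = (\<Sum>k<diag_len D. sum (\<lambda>b. f (box_content b)) {b \<in> D. g b = k})"
    by (rule sum.group[symmetric]) (use young_finite[OF D] g in auto)
  also have "\<dots> = (\<Sum>k<diag_len D. \<Sum>c\<in>{- leg D k..arm D k}. f c)"
  proof (rule sum.cong)
    fix k assume "k \<in> {..<diag_len D}"
    then have k: "k < diag_len D" by simp
    have al: "0 \<le> arm D k" "0 \<le> leg D k" using arm_leg_nonneg[OF D k] by auto
    have mem: "(i, j) \<in> {b \<in> D. g b = k} \<longleftrightarrow> (i = Suc k \<and> Suc k \<le> j \<and> j \<le> row_len D (Suc k))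
        \<or> (j = Suc k \<and> Suc k \<le> i \<and> i \<le> col_len D (Suc k))" for i j
    proof -
      have "(i, j) \<in> {b \<in> D. g b = k} \<longleftrightarrow> (i, j) \<in> D \<and> min i j = Suc k"
        using youngD(1,2)[OF D, of i j] by (auto simp: g_def min_def)
      also have "\<dots> \<longleftrightarrow> (i = Suc k \<and> Suc k \<le> j \<and> (Suc k, j) \<in> D) \<or> (j = Suc k \<and> Suc k \<le> i \<and> (i, Suc k) \<in> D)"
        by (auto simp: min_def)
      finally show ?thesis using row_iff[OF D, of "Suc k" j] col_iff[OF D, of "Suc k" i] by auto
    qed
    have bij: "bij_betw box_content {b \<in> D. g b = k} {- leg D k..arm D k}"
    proof (rule bij_betw_imageI)
      show "inj_on box_content {b \<in> D. g b = k}"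
      proof (rule inj_onI)
        fix b b' assume h: "b \<in> {b \<in> D. g b = k}" "b' \<in> {b \<in> D. g b = k}" "box_content b = box_content b'"
        obtain i j i' j' where e: "b = (i, j)" "b' = (i', j')" by fastforce
        have "int j - int i = int j' - int i'" using h(3) by (simp add: e box_content_def)
        then show "b = b'" using h(1,2) unfolding e mem by auto
      qed
      show "box_content ` {b \<in> D. g b = k} = {- leg D k..arm D k}"
      proof (intro equalityI subsetI)
        fix c assume "c \<in> box_content ` {b \<in> D. g b = k}"
        then obtain i j where h: "(i, j) \<in> {b \<in> D. g b = k}" "c = int j - int i"
          by (auto simp: box_content_def)
        show "c \<in> {- leg D k..arm D k}" using h al unfolding mem by (auto simp: arm_def leg_def)
      next
        fix c assume c: "c \<in> {- leg D k..arm D k}"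
        show "c \<in> box_content ` {b \<in> D. g b = k}"
        proof (cases "c \<ge> 0")
          case True
          then have "(Suc k, nat (c + int (Suc k))) \<in> {b \<in> D. g b = k}" unfolding mem
            using c by (auto simp: arm_def)
          moreover have "box_content (Suc k, nat (c + int (Suc k))) = c" using True by (simp add: box_content_def)
          ultimately show ?thesis by (intro image_eqI) simp_all
        next
          case False
          then have "(nat (int (Suc k) - c), Suc k) \<in> {b \<in> D. g b = k}" unfolding mem
            using c by (auto simp: leg_def)
          moreover have "box_content (nat (int (Suc k) - c), Suc k) = c" using False by (simp add: box_content_def)
          ultimately show ?thesis by (intro image_eqI) simp_all
        qed
      qed
    qed
    show "sum (\<lambda>b. f (box_content b)) {b \<in> D. g b = k} = (\<Sum>c\<in>{- leg D k..arm D k}. f c)"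
      by (rule sum.reindex_bij_betw[OF bij])
  qed simp
  finally show ?thesis .
qed

lemma sum_telescope_int:
  fixes F :: "real \<Rightarrow> real"
  assumes "a \<le> b + 1"
  shows "(\<Sum>c\<in>{a..b}. F (real_of_int c + 1/2) - F (real_of_int c - 1/2)) = F (real_of_int b + 1/2) - F (real_of_int a - 1/2)"
proof -
  have "a - 1 \<le> b" using assms by simp
  then show ?thesis
  proof (induction b rule: int_ge_induct)
    case base
    then show ?case by simp
  next
    case (step i)
    have "{a..i + 1} = insert (i + 1) {a..i}" using step by auto
    then show ?case using step by (simp add: add.commute)
  qed
qed

text \<open>On each hook the sum telescopes. The half-integer shift is what makes the relation
  between content sums and modified Frobenius coordinates exact.\<close>

lemma sum_telescope_hooks:
  fixes F :: "real \<Rightarrow> real"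
  assumes D: "young D"
  shows "(\<Sum>b\<in>D. F (real_of_int (box_content b) + 1/2) - F (real_of_int (box_content b) - 1/2))
    = (\<Sum>k<diag_len D. F (real_of_int (arm D k) + 1/2) - F (- (real_of_int (leg D k) + 1/2)))"
proof -
  have "(\<Sum>b\<in>D. F (real_of_int (box_content b) + 1/2) - F (real_of_int (box_content b) - 1/2))
    = (\<Sum>k<diag_len D. \<Sum>c\<in>{- leg D k..arm D k}. F (real_of_int c + 1/2) - F (real_of_int c - 1/2))"
    by (rule sum_content_hooks[OF D])
  also have "\<dots> = (\<Sum>k<diag_len D. F (real_of_int (arm D k) + 1/2) - F (- (real_of_int (leg D k) + 1/2)))"
  proof (rule sum.cong)
    fix k assume "k \<in> {..<diag_len D}"
    then have "- leg D k \<le> arm D k + 1" using arm_leg_nonneg[OF D, of k] by simp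
    then show "(\<Sum>c\<in>{- leg D k..arm D k}. F (real_of_int c + 1/2) - F (real_of_int c - 1/2))
      = F (real_of_int (arm D k) + 1/2) - F (- (real_of_int (leg D k) + 1/2))"
      by (subst sum_telescope_int) (auto simp: algebra_simps)
  qed simp
  finally show ?thesis .
qed

text \<open>Reading the level off the diagram gives one function \<open>f (emb D)\<close> on all
  diagrams, which can be followed along the down chain through different levels.\<close>

definition emb :: "(nat \<times> nat) set \<Rightarrow> thoma" where
  "emb D = iota (card D) D"

lemma emb_eq:
  "fst (emb D) k = (if k < diag_len D then (real_of_int (arm D k) + 1/2) / real (card D) else 0)"
  "snd (emb D) k = (if k < diag_len D then (real_of_int (leg D k) + 1/2) / real (card D) else 0)"
  by (simp_all add: emb_def iota_def arm_def leg_def)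

lemma emb_nonneg:
  assumes "young D"
  shows "0 \<le> fst (emb D) k" "0 \<le> snd (emb D) k"
  using arm_leg_nonneg[OF assms, of k] by (auto simp: emb_eq)

text \<open>\<open>sum_telescope_hooks\<close> for the identity function counts the boxes.\<close>

lemma sum_emb:
  assumes D: "young D" "D \<noteq> {}"
  shows "(\<Sum>k<diag_len D. fst (emb D) k + snd (emb D) k) = 1"
proof -
  have c: "real (card D) > 0" using D young_finite[of D] by (simp add: card_gt_0_iff)
  have "real (card D) = (\<Sum>b\<in>D. (real_of_int (box_content b) + 1/2) - (real_of_int (box_content b) - 1/2))" by simp
  also have "\<dots> = (\<Sum>k<diag_len D. (real_of_int (arm D k) + 1/2) - (- (real_of_int (leg D k) + 1/2)))"
    using sum_telescope_hooks[OF D(1), of "\<lambda>x. x"] .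
  also have "\<dots> = (\<Sum>k<diag_len D. (fst (emb D) k + snd (emb D) k) * real (card D))"
    using c by (intro sum.cong) (auto simp: emb_eq field_simps)
  finally have "real (card D) = (\<Sum>k<diag_len D. fst (emb D) k + snd (emb D) k) * real (card D)"
    by (simp add: sum_distrib_right)
  then show ?thesis using c by simp
qed

lemma row_len_antimono:
  assumes "young D" "1 \<le> i" "i \<le> i'"
  shows "row_len D i' \<le> row_len D i" "col_len D i' \<le> col_len D i"
proof -
  show "row_len D i' \<le> row_len D i"
  proof (cases "row_len D i' = 0")
    case False
    then have "(i', row_len D i') \<in> D" using row_iff[OF assms(1), of i'] assms by auto
    then have "(i, row_len D i') \<in> D" by (rule youngD(3)[OF assms(1)]) (use assms False in auto)
    then show ?thesis using row_iff[OF assms(1), of i] assms by auto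
  qed simp
  show "col_len D i' \<le> col_len D i"
  proof (cases "col_len D i' = 0")
    case False
    then have "(col_len D i', i') \<in> D" using col_iff[OF assms(1), of i'] assms by auto
    then have "(col_len D i', i) \<in> D" by (rule youngD(3)[OF assms(1)]) (use assms False in auto)
    then show ?thesis using col_iff[OF assms(1), of i] assms by auto
  qed simp
qed

lemma emb_in_Thoma:
  assumes D: "young D"
  shows "emb D \<in> Thoma"
proof -
  have anti: "fst (emb D) k' \<le> fst (emb D) k" "snd (emb D) k' \<le> snd (emb D) k" if "k \<le> k'" for k k'
  proof -
    have "arm D k' \<le> arm D k" "leg D k' \<le> leg D k"
      using row_len_antimono[OF D, of "Suc k" "Suc k'"] that by (auto simp: arm_def leg_def)
    then show "fst (emb D) k' \<le> fst (emb D) k" "snd (emb D) k' \<le> snd (emb D) k"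
      using that emb_nonneg[OF D, of k] by (auto simp: emb_eq divide_right_mono)
  qed
  have "(\<Sum>i<m. fst (emb D) i + snd (emb D) i) \<le> 1" for m
  proof (cases "D = {}")
    case True
    then show ?thesis by (simp add: emb_eq)
  next
    case False
    have "(\<Sum>i<m. fst (emb D) i + snd (emb D) i) \<le> (\<Sum>i<max m (diag_len D). fst (emb D) i + snd (emb D) i)"
      using emb_nonneg[OF D] by (intro sum_mono2) auto
    also have "\<dots> = (\<Sum>i<diag_len D. fst (emb D) i + snd (emb D) i)"
      by (rule sum.mono_neutral_right) (auto simp: emb_eq)
    also have "\<dots> = 1" using sum_emb[OF D False] .
    finally show ?thesis .
  qed
  moreover have "antimono (fst (emb D))" "antimono (snd (emb D))" using anti by (auto intro!: antimonoI)
  ultimately show ?thesis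
    unfolding Thoma_def using emb_nonneg[OF D] by (auto simp: case_prod_unfold)
qed


section \<open>Continuous functions on the Thoma simplex\<close>

text \<open>The bound \<open>1 / (i + 1)\<close> holds because the first \<open>i + 1\<close> terms
  of a nonincreasing sequence are at least the last of them and their sum is at most
  \<open>1\<close>. It gives the uniform convergence of the series below.\<close>

lemma ThomaD:
  assumes "\<omega> \<in> Thoma"
  shows "0 \<le> fst \<omega> i" "0 \<le> snd \<omega> i" "fst \<omega> i \<le> 1 / real (Suc i)" "snd \<omega> i \<le> 1 / real (Suc i)"
    "fst \<omega> i \<le> 1" "snd \<omega> i \<le> 1" "i \<le> j \<Longrightarrow> fst \<omega> j \<le> fst \<omega> i" "i \<le> j \<Longrightarrow> snd \<omega> j \<le> snd \<omega> i"
    "(\<Sum>i<m. fst \<omega> i + snd \<omega> i) \<le> 1"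
proof -
  obtain a b where ab: "\<omega> = (a, b)" by fastforce
  have h: "\<And>i. 0 \<le> a i" "\<And>i. 0 \<le> b i" "antimono a" "antimono b" "\<And>m. (\<Sum>i<m. a i + b i) \<le> 1"
    using assms unfolding ab Thoma_def by auto
  have a: "a i \<le> 1 / real (Suc i)" for i
  proof -
    have "real (Suc i) * a i = (\<Sum>j<Suc i. a i)" by simp
    also have "\<dots> \<le> (\<Sum>j<Suc i. a j + b j)"
      using h(2) antimonoD[OF h(3)] by (intro sum_mono) (simp add: add_increasing2)
    also have "\<dots> \<le> 1" by (rule h(5))
    finally show ?thesis by (simp add: field_simps)
  qed
  have b: "b i \<le> 1 / real (Suc i)" for i
  proof -
    have "real (Suc i) * b i = (\<Sum>j<Suc i. b i)" by simp
    also have "\<dots> \<le> (\<Sum>j<Suc i. a j + b j)"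
      using h(1) antimonoD[OF h(4)] by (intro sum_mono) (simp add: add_increasing)
    also have "\<dots> \<le> 1" by (rule h(5))
    finally show ?thesis by (simp add: field_simps)
  qed
  show "0 \<le> fst \<omega> i" "0 \<le> snd \<omega> i" "fst \<omega> i \<le> 1 / real (Suc i)" "snd \<omega> i \<le> 1 / real (Suc i)"
    "(\<Sum>i<m. fst \<omega> i + snd \<omega> i) \<le> 1" using a b h by (simp_all add: ab)
  have "1 / real (Suc i) \<le> 1" by (simp add: field_simps)
  then show "fst \<omega> i \<le> 1" "snd \<omega> i \<le> 1" using a[of i] b[of i] unfolding ab fst_conv snd_conv by (meson order.trans)+
  show "i \<le> j \<Longrightarrow> fst \<omega> j \<le> fst \<omega> i" "i \<le> j \<Longrightarrow> snd \<omega> j \<le> snd \<omega> i"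
    using antimonoD[OF h(3)] antimonoD[OF h(4)] by (simp_all add: ab)
qed

lemma continuous_on_coords:
  "continuous_on UNIV (\<lambda>\<omega>::thoma. fst \<omega> i)" "continuous_on UNIV (\<lambda>\<omega>::thoma. snd \<omega> i)"
  by (rule continuous_on_product_then_coordinatewise, intro continuous_intros)+

lemma compact_Thoma: "compact Thoma"
proof -
  define S :: "(nat \<Rightarrow> real) set" where "S = PiE UNIV (\<lambda>_. {0..1})"
  have "compactin (product_topology (\<lambda>_. euclidean) UNIV) S"
    unfolding S_def compactin_PiE by simp
  then have "compact S" by (simp add: euclidean_product_topology)
  then have c: "compact (S \<times> S)" by (intro compact_Times)
  define A where "A = (\<Inter>i. {\<omega>::thoma. 0 \<le> fst \<omega> i}) \<inter> (\<Inter>i. {\<omega>::thoma. 0 \<le> snd \<omega> i})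
    \<inter> (\<Inter>i. \<Inter>j. {\<omega>::thoma. i \<le> j \<longrightarrow> fst \<omega> j \<le> fst \<omega> i}) \<inter> (\<Inter>i. \<Inter>j. {\<omega>::thoma. i \<le> j \<longrightarrow> snd \<omega> j \<le> snd \<omega> i})
    \<inter> (\<Inter>m. {\<omega>::thoma. (\<Sum>i<m. fst \<omega> i + snd \<omega> i) \<le> 1})"
  have "closed A" unfolding A_def
    by (intro closed_Int closed_INT ballI closed_Collect_imp closed_Collect_le open_Collect_const
        continuous_intros continuous_on_coords)
  have "Thoma = (S \<times> S) \<inter> A"
  proof (intro equalityI subsetI)
    fix \<omega> assume "\<omega> \<in> Thoma"
    note T = ThomaD[OF this]
    have "fst \<omega> \<in> S" "snd \<omega> \<in> S" using T by (auto simp: S_def)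
    then show "\<omega> \<in> (S \<times> S) \<inter> A" using T unfolding A_def by (auto simp: mem_Times_iff)
  next
    fix \<omega> assume "\<omega> \<in> (S \<times> S) \<inter> A"
    then show "\<omega> \<in> Thoma" unfolding A_def Thoma_def by (auto simp: case_prod_unfold intro!: antimonoI)
  qed
  then show ?thesis using compact_Int_closed[OF c \<open>closed A\<close>] by simp
qed

text \<open>The integral of \<open>x * w x\<close> against the Thoma measure, which has masses
  \<open>\<alpha>\<close> at the points \<open>\<alpha>\<close>, \<open>\<beta>\<close> at the
  points \<open>- \<beta>\<close>, and the missing mass at \<open>0\<close>, where the integrand
  vanishes. For \<open>w x = x^m\<close> it is the power sum of degree \<open>m + 2\<close>.\<close>

definition pw :: "(real \<Rightarrow> real) \<Rightarrow> thoma \<Rightarrow> real" where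
  "pw w \<omega> = (\<Sum>i. (fst \<omega> i)\<^sup>2 * w (fst \<omega> i) - (snd \<omega> i)\<^sup>2 * w (- snd \<omega> i))"

lemma pw_term_bound:
  assumes "\<omega> \<in> Thoma" "\<And>x. \<bar>x\<bar> \<le> 1 \<Longrightarrow> \<bar>w x\<bar> \<le> B"
  shows "\<bar>(fst \<omega> i)\<^sup>2 * w (fst \<omega> i) - (snd \<omega> i)\<^sup>2 * w (- snd \<omega> i)\<bar> \<le> B * ((fst \<omega> i)\<^sup>2 + (snd \<omega> i)\<^sup>2)"
proof -
  note T = ThomaD[OF assms(1)]
  have "\<bar>(fst \<omega> i)\<^sup>2 * w (fst \<omega> i)\<bar> \<le> (fst \<omega> i)\<^sup>2 * B"
    unfolding abs_mult using T by (intro mult_mono) (auto intro!: assms(2))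
  moreover have "\<bar>(snd \<omega> i)\<^sup>2 * w (- snd \<omega> i)\<bar> \<le> (snd \<omega> i)\<^sup>2 * B"
    unfolding abs_mult using T by (intro mult_mono) (auto intro!: assms(2))
  ultimately show ?thesis by (simp add: algebra_simps)
qed

lemma pw_term_bound':
  assumes "\<omega> \<in> Thoma" "\<And>x. \<bar>x\<bar> \<le> 1 \<Longrightarrow> \<bar>w x\<bar> \<le> B"
  shows "\<bar>(fst \<omega> i)\<^sup>2 * w (fst \<omega> i) - (snd \<omega> i)\<^sup>2 * w (- snd \<omega> i)\<bar> \<le> 2 * B * (1 / real (Suc i) ^ 2)"
proof -
  note T = ThomaD[OF assms(1)]
  have B: "B \<ge> 0" using assms(2)[of 0] by simp
  have "(fst \<omega> i)\<^sup>2 \<le> (1 / real (Suc i))\<^sup>2" "(snd \<omega> i)\<^sup>2 \<le> (1 / real (Suc i))\<^sup>2"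
    using T by (auto intro!: power_mono)
  then have "B * ((fst \<omega> i)\<^sup>2 + (snd \<omega> i)\<^sup>2) \<le> B * (2 * (1 / real (Suc i) ^ 2))"
    using B by (intro mult_left_mono) (auto simp: power_divide)
  then show ?thesis using pw_term_bound[of \<omega> w B i, OF assms] by (simp add: mult.commute)
qed

lemma summable_inverse_squares_Suc: "summable (\<lambda>i. B * (1 / real (Suc i) ^ 2))"
proof -
  have "summable (\<lambda>i. 1 / real i ^ 2)" using inverse_power_summable[of 2] by (simp add: field_simps)
  then have "summable (\<lambda>i. 1 / real (Suc i) ^ 2)" by (subst summable_Suc_iff)
  then show ?thesis by (rule summable_mult)
qed

lemma continuous_bounded_on_unit:
  assumes "continuous_on UNIV w"
  obtains B where "\<And>x::real. \<bar>x\<bar> \<le> 1 \<Longrightarrow> \<bar>w x :: real\<bar> \<le> B"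
proof -
  have "compact (w ` {-1..1})" using assms by (intro compact_continuous_image continuous_on_subset[OF assms]) auto
  then have "bounded (w ` {-1..1})" by (rule compact_imp_bounded)
  then obtain B where "\<forall>x\<in>w ` {-1..1}. norm x \<le> B" using bounded_iff by blast
  then have "\<bar>w x\<bar> \<le> B" if "\<bar>x\<bar> \<le> 1" for x using that by (auto simp: abs_le_iff)
  then show thesis using that by blast
qed

lemma pw_summable:
  assumes "\<omega> \<in> Thoma" "continuous_on UNIV w"
  shows "summable (\<lambda>i. (fst \<omega> i)\<^sup>2 * w (fst \<omega> i) - (snd \<omega> i)\<^sup>2 * w (- snd \<omega> i))"
proof -
  obtain B where B: "\<And>x. \<bar>x\<bar> \<le> 1 \<Longrightarrow> \<bar>w x\<bar> \<le> B" using continuous_bounded_on_unit[OF assms(2)] by blast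
  show ?thesis
    by (rule summable_comparison_test'[OF summable_inverse_squares_Suc[of "2 * B"]])
      (use pw_term_bound'[OF assms(1) B] in auto)
qed

text \<open>The terms are continuous in finitely many coordinates, and by \<open>ThomaD\<close> they
  are dominated by a multiple of \<open>1 / (i + 1)^2\<close>, uniformly on the simplex.\<close>

lemma pw_continuous:
  assumes "continuous_on UNIV w"
  shows "continuous_on Thoma (pw w)"
proof -
  obtain B where B: "\<And>x. \<bar>x\<bar> \<le> 1 \<Longrightarrow> \<bar>w x\<bar> \<le> B" using continuous_bounded_on_unit[OF assms] by blast
  have "uniform_limit Thoma (\<lambda>n \<omega>. \<Sum>i<n. (fst \<omega> i)\<^sup>2 * w (fst \<omega> i) - (snd \<omega> i)\<^sup>2 * w (- snd \<omega> i))
     (\<lambda>\<omega>. \<Sum>i. (fst \<omega> i)\<^sup>2 * w (fst \<omega> i) - (snd \<omega> i)\<^sup>2 * w (- snd \<omega> i)) sequentially"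
    by (rule Weierstrass_m_test[OF _ summable_inverse_squares_Suc[of "2 * B"]])
      (use pw_term_bound'[OF _ B] in auto)
  then show ?thesis unfolding pw_def[abs_def]
  proof (rule uniform_limit_theorem[rotated])
    have "continuous_on Thoma (\<lambda>\<omega>. \<Sum>i<n. (fst \<omega> i)\<^sup>2 * w (fst \<omega> i) - (snd \<omega> i)\<^sup>2 * w (- snd \<omega> i))" for n
      by (intro continuous_intros continuous_on_compose2[OF assms] continuous_on_subset[OF continuous_on_coords(1)]
          continuous_on_subset[OF continuous_on_coords(2)]) auto
    then show "\<forall>\<^sub>F n in sequentially. continuous_on Thoma (\<lambda>\<omega>. \<Sum>i<n. (fst \<omega> i)\<^sup>2 * w (fst \<omega> i) - (snd \<omega> i)\<^sup>2 * w (- snd \<omega> i))"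
      by (intro always_eventually) blast
  qed simp
qed

lemma pw_add:
  assumes "\<omega> \<in> Thoma" "continuous_on UNIV w" "continuous_on UNIV v"
  shows "pw (\<lambda>x. w x + v x) \<omega> = pw w \<omega> + pw v \<omega>"
  unfolding pw_def using suminf_add[OF pw_summable[OF assms(1,2)] pw_summable[OF assms(1,3)]]
  by (simp add: algebra_simps)

lemma pw_cmult:
  assumes "\<omega> \<in> Thoma" "continuous_on UNIV w"
  shows "pw (\<lambda>x. c * w x) \<omega> = c * pw w \<omega>"
  unfolding pw_def using suminf_mult[OF pw_summable[OF assms(1,2)], of c]
  by (simp add: algebra_simps)

text \<open>Since coordinates are at most \<open>1\<close>, their squares are bounded by the
  coordinates themselves, whose total is at most \<open>1\<close>. Uniform approximation of
  \<open>w\<close> therefore becomes uniform approximation of \<open>pw w\<close>.\<close>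

lemma pw_le:
  assumes T: "\<omega> \<in> Thoma" and w: "continuous_on UNIV w" and e: "\<And>x. \<bar>x\<bar> \<le> 1 \<Longrightarrow> \<bar>w x\<bar> \<le> e"
  shows "\<bar>pw w \<omega>\<bar> \<le> e"
proof -
  define f where "f i = (fst \<omega> i)\<^sup>2 * w (fst \<omega> i) - (snd \<omega> i)\<^sup>2 * w (- snd \<omega> i)" for i
  have e0: "e \<ge> 0" using e[of 0] by simp
  have "\<bar>\<Sum>i<n. f i\<bar> \<le> e" for n
  proof -
    have "\<bar>\<Sum>i<n. f i\<bar> \<le> (\<Sum>i<n. e * (fst \<omega> i + snd \<omega> i))"
    proof (rule order.trans[OF sum_abs sum_mono])
      fix i
      have "(fst \<omega> i)\<^sup>2 \<le> fst \<omega> i" "(snd \<omega> i)\<^sup>2 \<le> snd \<omega> i"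
        using ThomaD[OF T, of i] by (auto simp: power2_eq_square intro!: mult_left_le)
      then have "e * ((fst \<omega> i)\<^sup>2 + (snd \<omega> i)\<^sup>2) \<le> e * (fst \<omega> i + snd \<omega> i)" using e0 by (intro mult_left_mono) auto
      then show "\<bar>f i\<bar> \<le> e * (fst \<omega> i + snd \<omega> i)" unfolding f_def using pw_term_bound[of \<omega> w e i, OF T e] by linarith
    qed
    also have "\<dots> \<le> e * 1" unfolding sum_distrib_left[symmetric] using ThomaD(9)[OF T] e0 by (intro mult_left_mono) auto
    finally show ?thesis by simp
  qed
  moreover have "(\<lambda>n. \<bar>\<Sum>i<n. f i\<bar>) \<longlonglongrightarrow> \<bar>pw w \<omega>\<bar>"
    unfolding pw_def f_def by (intro tendsto_rabs summable_LIMSEQ pw_summable[OF T w])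
  ultimately show ?thesis by (intro LIMSEQ_le_const2) auto
qed

text \<open>For \<open>F x = x^(k + 1)\<close> the hooks give the power sum exactly as a sum of
  \<open>F (c + 1/2) - F (c - 1/2)\<close> over contents, divided by \<open>n^(k + 1)\<close>. Each
  term differs from \<open>(k + 1) * c^k\<close> by \<open>O(n^(k - 1))\<close>, and there are
  \<open>n\<close> of them.\<close>

lemma pw_monomial_approx:
  assumes k: "k \<ge> 1" and D: "young D" "D \<noteq> {}"
  shows "\<bar>pw (\<lambda>x. x ^ (k - 1)) (emb D) - (real k + 1) * scaled_sum k D\<bar> \<le> 2 ^ (k + 2) / real (card D)"
proof -
  define n where "n = real (card D)"
  define F :: "real \<Rightarrow> real" where "F x = x ^ (k + 1)" for x
  obtain m where m: "k = Suc m" using k by (cases k) auto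
  have n: "n \<ge> 1" using D young_finite[of D] by (simp add: n_def Suc_leI card_gt_0_iff)
  have "pw (\<lambda>x. x ^ (k - 1)) (emb D) = (\<Sum>i<diag_len D. (fst (emb D) i)\<^sup>2 * (fst (emb D) i) ^ (k - 1) - (snd (emb D) i)\<^sup>2 * (- snd (emb D) i) ^ (k - 1))"
    unfolding pw_def by (rule suminf_finite) (auto simp: emb_eq)
  also have "\<dots> = (\<Sum>i<diag_len D. (F (real_of_int (arm D i) + 1/2) - F (- (real_of_int (leg D i) + 1/2))) / n ^ (k + 1))"
  proof (rule sum.cong)
    fix i assume i: "i \<in> {..<diag_len D}"
    define a where "a = real_of_int (arm D i) + 1/2"
    define b where "b = real_of_int (leg D i) + 1/2"
    have e: "fst (emb D) i = a / n" "snd (emb D) i = b / n" using i by (auto simp: emb_eq a_def b_def n_def)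
    have 1: "(a / n)\<^sup>2 * (a / n) ^ m = a ^ (m + 2) / n ^ (m + 2)"
      by (simp add: power_add power_divide power2_eq_square)
    have 2: "(b / n)\<^sup>2 * (- (b / n)) ^ m = (- b) ^ (m + 2) / n ^ (m + 2)"
    proof -
      have "- (b / n) = (- b) / n" by simp
      then show ?thesis by (simp only: power_divide power_add) (simp add: power2_eq_square mult_ac)
    qed
    show "(fst (emb D) i)\<^sup>2 * (fst (emb D) i) ^ (k - 1) - (snd (emb D) i)\<^sup>2 * (- snd (emb D) i) ^ (k - 1)
      = (F (real_of_int (arm D i) + 1/2) - F (- (real_of_int (leg D i) + 1/2))) / n ^ (k + 1)"
      unfolding e F_def a_def[symmetric] b_def[symmetric] using 1 2 by (simp add: m diff_divide_distrib)
  qed simp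
  also have "\<dots> = (\<Sum>b\<in>D. F (real_of_int (box_content b) + 1/2) - F (real_of_int (box_content b) - 1/2)) / n ^ (k + 1)"
    unfolding sum_telescope_hooks[OF D(1)] sum_divide_distrib ..
  finally have 1: "pw (\<lambda>x. x ^ (k - 1)) (emb D)
    = (\<Sum>b\<in>D. F (real_of_int (box_content b) + 1/2) - F (real_of_int (box_content b) - 1/2)) / n ^ (k + 1)" .
  have 2: "(real k + 1) * scaled_sum k D = (\<Sum>b\<in>D. (real k + 1) * real_of_int (box_content b) ^ k) / n ^ (k + 1)"
    by (simp add: scaled_sum_def content_sum_def n_def sum_distrib_left)
  have "\<bar>\<Sum>b\<in>D. (F (real_of_int (box_content b) + 1/2) - F (real_of_int (box_content b) - 1/2)) - (real k + 1) * real_of_int (box_content b) ^ k\<bar>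
     \<le> (\<Sum>b\<in>D. 2 ^ (k + 2) * n ^ m)"
  proof (rule order.trans[OF sum_abs sum_mono])
    fix b assume "b \<in> D"
    define c where "c = real_of_int (box_content b)"
    have c: "\<bar>c\<bar> \<le> n" using real_content_less_card[OF D(1) \<open>b \<in> D\<close>] by (simp add: c_def n_def)
    \<comment> \<open>The quadratic term, equal for the shifts \<open>1/2\<close> and
      \<open>- 1/2\<close>; it drops out of the difference.\<close>
    define r where "r = (k + 1 choose 2) * c ^ (k + 1 - 2) / 4"
    have "\<bar>F (c + 1/2) - F c - (real k + 1) * c ^ k / 2 - r\<bar> \<le> 2 ^ (k + 1) * n ^ (k + 1 - 3)"
      using binomial_remainder[OF n c, of "1/2" "k + 1"] by (simp add: F_def r_def power2_eq_square algebra_simps add_divide_distrib)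
    moreover have "\<bar>F (c - 1/2) - F c + (real k + 1) * c ^ k / 2 - r\<bar> \<le> 2 ^ (k + 1) * n ^ (k + 1 - 3)"
      using binomial_remainder[OF n c, of "-1/2" "k + 1"] by (simp add: F_def r_def power2_eq_square algebra_simps add_divide_distrib)
    ultimately have "\<bar>F (c + 1/2) - F (c - 1/2) - (real k + 1) * c ^ k\<bar> \<le> 2 ^ (k + 2) * n ^ (k + 1 - 3)" by simp
    also have "\<dots> \<le> 2 ^ (k + 2) * n ^ m" using n m by (intro mult_left_mono power_increasing) auto
    finally show "\<bar>F (real_of_int (box_content b) + 1/2) - F (real_of_int (box_content b) - 1/2) - (real k + 1) * real_of_int (box_content b) ^ k\<bar> \<le> 2 ^ (k + 2) * n ^ m"
      by (simp add: c_def)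
  qed
  also have "\<dots> = 2 ^ (k + 2) * n ^ k" by (simp add: n_def m)
  finally have "\<bar>(\<Sum>b\<in>D. (F (real_of_int (box_content b) + 1/2) - F (real_of_int (box_content b) - 1/2)) - (real k + 1) * real_of_int (box_content b) ^ k)\<bar> / n ^ (k + 1)
     \<le> 2 ^ (k + 2) * n ^ k / n ^ (k + 1)" using n by (intro divide_right_mono) auto
  moreover have "2 ^ (k + 2) * n ^ k / n ^ (k + 1) = 2 ^ (k + 2) / n" using n by simp
  moreover have "pw (\<lambda>x. x ^ (k - 1)) (emb D) - (real k + 1) * scaled_sum k D
    = (\<Sum>b\<in>D. (F (real_of_int (box_content b) + 1/2) - F (real_of_int (box_content b) - 1/2)) - (real k + 1) * real_of_int (box_content b) ^ k) / n ^ (k + 1)"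
    unfolding 1 2 by (simp add: sum_subtractf diff_divide_distrib)
  ultimately show ?thesis using n by (simp add: n_def)
qed

lemma down_stable_pw_monomial: "down_stable (\<lambda>D. pw (\<lambda>x. x ^ m) (emb D))"
proof (rule down_stable_approx)
  fix e :: real assume e: "e > 0"
  define k where "k = Suc m"
  have k: "k \<ge> 1" "m = k - 1" by (auto simp: k_def)
  have st: "down_stable (\<lambda>D. (real k + 1) * scaled_sum k D)"
    by (rule down_stable_mult[where B = "real k + 1", OF down_stable_const down_stable_scaled_sum[OF k(1)]])
      (use scaled_sum_le_1[of _ k] in \<open>auto simp: add_increasing\<close>)
  obtain n0 where n0: "real n0 > 2 ^ (k + 2) / e" using reals_Archimedean2 by blast
  have "\<bar>pw (\<lambda>x. x ^ m) (emb D) - (real k + 1) * scaled_sum k D\<bar> \<le> e" if D: "young D" "n0 + 1 \<le> card D" for D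
  proof -
    have "\<bar>pw (\<lambda>x. x ^ m) (emb D) - (real k + 1) * scaled_sum k D\<bar> \<le> 2 ^ (k + 2) / real (card D)"
      unfolding k(2) by (rule pw_monomial_approx) (use D k in auto)
    also have "\<dots> \<le> e"
    proof -
      have "2 ^ (k + 2) / e \<le> real (card D)" using n0 D by linarith
      then show ?thesis using e D by (simp add: field_simps)
    qed
    finally show ?thesis .
  qed
  then show "\<exists>G n0. down_stable G \<and> (\<forall>D. young D \<longrightarrow> n0 \<le> card D \<longrightarrow> \<bar>pw (\<lambda>x. x ^ m) (emb D) - G D\<bar> \<le> e)"
    using st by blast
qed

lemma down_stable_cong:
  assumes "\<And>D. young D \<Longrightarrow> F D = G D" "down_stable G"
  shows "down_stable F"
  by (rule down_stable_approx) (use assms in \<open>auto intro!: exI[of _ G]\<close>)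

text \<open>Weierstrass approximation of \<open>w\<close> on \<open>{-1..1}\<close>, an interval
  containing all points at which \<open>pw\<close> evaluates the weight, reduces the claim to
  monomials.\<close>

lemma down_stable_pw:
  assumes w: "continuous_on UNIV w"
  shows "down_stable (\<lambda>D. pw w (emb D))"
proof (rule down_stable_approx)
  fix e :: real assume e: "e > 0"
  obtain g where g: "real_polynomial_function g" "\<And>x. x \<in> {-1..1} \<Longrightarrow> \<bar>w x - g x\<bar> < e"
    using Stone_Weierstrass_real_polynomial_function[of "{-1..1::real}" w e] e continuous_on_subset[OF w] by auto
  obtain a n where an: "g = (\<lambda>x. \<Sum>i\<le>n. a i * x ^ i)" using g(1) real_polynomial_function_iff_sum by blast
  have cont: "continuous_on UNIV (\<lambda>x::real. \<Sum>i\<le>n. a i * x ^ i)" for n by (intro continuous_intros)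
  have st: "down_stable (\<lambda>D. pw (\<lambda>x. \<Sum>i\<le>n. a i * x ^ i) (emb D))" for n
  proof (induction n)
    have mono: "down_stable (\<lambda>D. pw (\<lambda>x. a i * x ^ i) (emb D))" for i
    proof (rule down_stable_cong)
      fix D assume "young D"
      then show "pw (\<lambda>x. a i * x ^ i) (emb D) = a i * pw (\<lambda>x. x ^ i) (emb D)"
        by (intro pw_cmult emb_in_Thoma continuous_intros)
    next
      show "down_stable (\<lambda>D. a i * pw (\<lambda>x. x ^ i) (emb D))"
      proof (rule down_stable_mult[OF down_stable_const down_stable_pw_monomial, where B = "max \<bar>a i\<bar> 1"])
        fix D assume "young D"
        then have "\<bar>pw (\<lambda>x. x ^ i) (emb D)\<bar> \<le> 1"
          by (intro pw_le emb_in_Thoma continuous_intros) (auto simp: power_abs intro: power_le_one)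
        then show "\<bar>pw (\<lambda>x. x ^ i) (emb D)\<bar> \<le> max \<bar>a i\<bar> 1" by simp
      qed simp
    qed
    case 0
    show ?case using mono[of 0] by simp
    case (Suc n)
    show ?case
    proof (rule down_stable_cong)
      fix D assume "young D"
      then show "pw (\<lambda>x. \<Sum>i\<le>Suc n. a i * x ^ i) (emb D) = pw (\<lambda>x. \<Sum>i\<le>n. a i * x ^ i) (emb D) + pw (\<lambda>x. a (Suc n) * x ^ Suc n) (emb D)"
        unfolding sum.atMost_Suc by (intro pw_add emb_in_Thoma continuous_intros)
    next
      show "down_stable (\<lambda>D. pw (\<lambda>x. \<Sum>i\<le>n. a i * x ^ i) (emb D) + pw (\<lambda>x. a (Suc n) * x ^ Suc n) (emb D))"
        by (intro down_stable_add Suc mono)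
    qed
  qed
  have gc: "continuous_on UNIV g" unfolding an by (rule cont)
  have "\<bar>pw w (emb D) - pw g (emb D)\<bar> \<le> e" if D: "young D" for D
  proof -
    have "pw w (emb D) = pw (\<lambda>x. (w x - g x) + g x) (emb D)" by simp
    also have "\<dots> = pw (\<lambda>x. w x - g x) (emb D) + pw g (emb D)"
      by (intro pw_add emb_in_Thoma D continuous_intros w gc)
    finally have "pw w (emb D) - pw g (emb D) = pw (\<lambda>x. w x - g x) (emb D)" by simp
    also have "\<bar>\<dots>\<bar> \<le> e"
      by (intro pw_le emb_in_Thoma D continuous_intros w gc less_imp_le[OF g(2)]) auto
    finally show ?thesis .
  qed
  then show "\<exists>G n0. down_stable G \<and> (\<forall>D. young D \<longrightarrow> n0 \<le> card D \<longrightarrow> \<bar>pw w (emb D) - G D\<bar> \<le> e)"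
    using st[of n] unfolding an by blast
qed

text \<open>General continuous weights make separation elementary. The positive part of
  \<open>x - fst \<omega>' i\<close> ignores the second sequences and, by monotonicity, all entries
  of \<open>\<omega>'\<close> from index \<open>i\<close> on; the earlier entries agree, and entry
  \<open>i\<close> of \<open>\<omega>\<close> contributes a positive amount.\<close>

lemma pw_separates_aux:
  assumes T: "\<omega> \<in> Thoma" "\<omega>' \<in> Thoma" and eq: "\<And>j. j < i \<Longrightarrow> fst \<omega> j = fst \<omega>' j" and gt: "fst \<omega> i > fst \<omega>' i"
  shows "\<exists>w. continuous_on UNIV w \<and> pw w \<omega> \<noteq> pw w \<omega>'"
proof -
  note t = ThomaD[OF T(1)] and t' = ThomaD[OF T(2)]
  define w where "w x = max 0 (x - fst \<omega>' i)" for x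
  have cw: "continuous_on UNIV w" unfolding w_def[abs_def] by (intro continuous_intros)
  have wn: "w (- x) = 0" if "x \<ge> 0" for x using that t'(1)[of i] by (simp add: w_def)
  have s: "summable (\<lambda>j. (fst \<omega> j)\<^sup>2 * w (fst \<omega> j))"
    using pw_summable[OF T(1) cw] wn[OF t(2)] by simp
  have p: "pw w \<omega> = (\<Sum>j. (fst \<omega> j)\<^sup>2 * w (fst \<omega> j))" "pw w \<omega>' = (\<Sum>j. (fst \<omega>' j)\<^sup>2 * w (fst \<omega>' j))"
    unfolding pw_def using wn[OF t(2)] wn[OF t'(2)] by simp_all
  have "pw w \<omega>' = (\<Sum>j<i. (fst \<omega>' j)\<^sup>2 * w (fst \<omega>' j))" unfolding p
  proof (rule suminf_finite)
    fix j assume "j \<notin> {..<i}"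
    then have "fst \<omega>' j \<le> fst \<omega>' i" using t'(7) by simp
    then show "(fst \<omega>' j)\<^sup>2 * w (fst \<omega>' j) = 0" by (simp add: w_def)
  qed simp
  also have "\<dots> = (\<Sum>j<i. (fst \<omega> j)\<^sup>2 * w (fst \<omega> j))" using eq by simp
  also have "\<dots> < (\<Sum>j<Suc i. (fst \<omega> j)\<^sup>2 * w (fst \<omega> j))"
  proof -
    have "fst \<omega> i > 0" using gt t'(1)[of i] by linarith
    then have "(fst \<omega> i)\<^sup>2 * w (fst \<omega> i) > 0" using gt by (intro mult_pos_pos) (auto simp: w_def)
    then show ?thesis by simp
  qed
  also have "\<dots> \<le> pw w \<omega>" unfolding p
    by (rule sum_le_suminf[OF s]) (auto simp: w_def)
  finally show ?thesis using cw by (metis less_irrefl)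
qed

lemma Thoma_swap:
  assumes "\<omega> \<in> Thoma"
  shows "(snd \<omega>, fst \<omega>) \<in> Thoma"
  using assms by (auto simp: Thoma_def add.commute)

text \<open>If the first sequences agree, exchange the two sequences; reflecting the weight,
  \<open>v x = w (- x)\<close>, undoes the exchange up to sign.\<close>

lemma pw_separates:
  assumes T: "\<omega> \<in> Thoma" "\<omega>' \<in> Thoma" and ne: "\<omega> \<noteq> \<omega>'"
  shows "\<exists>w. continuous_on UNIV w \<and> pw w \<omega> \<noteq> pw w \<omega>'"
proof -
  have main: "\<exists>w. continuous_on UNIV w \<and> pw w \<omega> \<noteq> pw w \<omega>'"
    if T: "\<omega> \<in> Thoma" "\<omega>' \<in> Thoma" and ne: "fst \<omega> \<noteq> fst \<omega>'" for \<omega> \<omega>'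
  proof -
    have ex: "\<exists>i. fst \<omega> i \<noteq> fst \<omega>' i" using ne by auto
    define i where "i = (LEAST i. fst \<omega> i \<noteq> fst \<omega>' i)"
    have i: "fst \<omega> i \<noteq> fst \<omega>' i" unfolding i_def using ex by (rule LeastI_ex)
    have j: "fst \<omega> j = fst \<omega>' j" if "j < i" for j using not_less_Least[of j "\<lambda>i. fst \<omega> i \<noteq> fst \<omega>' i"] that unfolding i_def by blast
    consider "fst \<omega> i > fst \<omega>' i" | "fst \<omega>' i > fst \<omega> i" using i by linarith
    then show ?thesis
    proof cases
      case 1 then show ?thesis using pw_separates_aux[OF T, of i] j by blast
    next
      case 2 then show ?thesis using pw_separates_aux[OF T(2,1), of i] j by metis
    qed
  qed
  show ?thesis
  proof (cases "fst \<omega> = fst \<omega>'")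
    case False
    then show ?thesis using main[OF T] by blast
  next
    case True
    then have "snd \<omega> \<noteq> snd \<omega>'" using ne by (simp add: prod_eq_iff)
    then obtain w where w: "continuous_on UNIV w" "pw w (snd \<omega>, fst \<omega>) \<noteq> pw w (snd \<omega>', fst \<omega>')"
      using main[of "(snd \<omega>, fst \<omega>)" "(snd \<omega>', fst \<omega>')"] T Thoma_swap by auto
    define v where "v x = w (- x)" for x
    have v: "continuous_on UNIV v" unfolding v_def[abs_def] by (intro continuous_on_compose2[OF w(1)] continuous_intros) auto
    have "pw v \<eta> = - pw w (snd \<eta>, fst \<eta>)" if "\<eta> \<in> Thoma" for \<eta>
      unfolding pw_def v_def using suminf_minus[OF pw_summable[OF Thoma_swap[OF that] w(1)]] by simp
    then show ?thesis using w(2) v T by (metis neg_equal_iff_equal)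
  qed
qed

text \<open>The continuous functions with stable pull-back form an algebra with constants, where
  boundedness for products comes from compactness. It contains every \<open>pw w\<close> and so
  separates points.\<close>

theorem down_stable_continuous:
  assumes f: "continuous_on Thoma f"
  shows "down_stable (\<lambda>D. f (emb D))"
proof (rule down_stable_approx)
  fix e :: real assume e: "e > 0"
  define P where "P g \<longleftrightarrow> continuous_on Thoma g \<and> down_stable (\<lambda>D. g (emb D))" for g
  have "\<exists>g. P g \<and> (\<forall>x\<in>Thoma. \<bar>f x - g x\<bar> < e)"
  proof (rule Stone_Weierstrass_HOL[OF compact_Thoma])
    show "P (\<lambda>x. c)" for c by (simp add: P_def down_stable_const)
    show "P g \<Longrightarrow> continuous_on Thoma g" for g by (simp add: P_def)
    show "P g \<and> P h \<Longrightarrow> P (\<lambda>x. g x + h x)" for g h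
      unfolding P_def by (auto intro!: continuous_intros down_stable_add)
    show "P g \<and> P h \<Longrightarrow> P (\<lambda>x. g x * h x)" for g h
    proof -
      assume gh: "P g \<and> P h"
      have "bounded (g ` Thoma)" "bounded (h ` Thoma)"
        using gh compact_Thoma by (auto simp: P_def intro!: compact_imp_bounded compact_continuous_image)
      then obtain B1 B2 where B: "\<forall>x\<in>g ` Thoma. norm x \<le> B1" "\<forall>x\<in>h ` Thoma. norm x \<le> B2"
        using bounded_iff by metis
      have "down_stable (\<lambda>D. g (emb D) * h (emb D))"
        by (rule down_stable_mult[where B = "max B1 B2"])
          (use gh B emb_in_Thoma in \<open>auto simp: P_def le_max_iff_disj\<close>)
      then show ?thesis using gh unfolding P_def by (auto intro!: continuous_intros)
    qed
    show "x \<in> Thoma \<and> y \<in> Thoma \<and> x \<noteq> y \<Longrightarrow> \<exists>g. P g \<and> g x \<noteq> g y" for x y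
      using pw_separates[of x y] unfolding P_def by (metis pw_continuous down_stable_pw)
  qed (use f e in auto)
  then obtain g where g: "P g" "\<forall>x\<in>Thoma. \<bar>f x - g x\<bar> < e" by blast
  then show "\<exists>G n0. down_stable G \<and> (\<forall>D. young D \<longrightarrow> n0 \<le> card D \<longrightarrow> \<bar>f (emb D) - G D\<bar> \<le> e)"
    unfolding P_def using emb_in_Thoma by (intro exI[of _ "\<lambda>D. g (emb D)"] exI[of _ 0]) (auto intro!: less_imp_le)
qed


section \<open>Density of Young diagrams in the Thoma simplex\<close>

text \<open>As long as \<open>A \<noteq> B\<close>, a box of \<open>B - A\<close> with the smallest
  coordinate sum has its upper and left neighbours in \<open>A\<close>, so it can be added.\<close>

lemma young_between:
  assumes "young A" "young B" "A \<subseteq> B" "card A \<le> n" "n \<le> card B"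
  obtains D where "young D" "A \<subseteq> D" "D \<subseteq> B" "card D = n"
proof -
  have "\<exists>D. young D \<and> A \<subseteq> D \<and> D \<subseteq> B \<and> card D = n"
    using assms
  proof (induction "n - card A" arbitrary: A)
    case 0
    then show ?case by (intro exI[of _ A]) auto
  next
    case (Suc d)
    have fin: "finite B" "finite A" using Suc.prems by (auto simp: young_finite)
    have "A \<noteq> B" using Suc by auto
    then have ne: "B - A \<noteq> {}" using Suc.prems by auto
    define m where "m = Min ((\<lambda>b. fst b + snd b) ` (B - A))"
    have "m \<in> (\<lambda>b. fst b + snd b) ` (B - A)" unfolding m_def using ne fin by (intro Min_in) auto
    then obtain i j where ij: "(i, j) \<in> B - A" "i + j = m" by auto
    have min: "m \<le> i' + j'" if "(i', j') \<in> B - A" for i' j'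
      unfolding m_def using fin that by (intro Min_le) (auto intro!: image_eqI[of _ _ "(i', j')"])
    have 1: "1 \<le> i" "1 \<le> j" using youngD(1,2)[OF Suc.prems(2), of i j] ij by auto
    have "i = 1 \<or> (i - 1, j) \<in> A"
    proof (rule ccontr)
      assume h: "\<not> ?thesis"
      then have "(i - 1, j) \<in> B" using youngD(3)[OF Suc.prems(2), of i j "i - 1" j] ij 1 by auto
      then show False using min[of "i - 1" j] h ij 1 by auto
    qed
    moreover have "j = 1 \<or> (i, j - 1) \<in> A"
    proof (rule ccontr)
      assume h: "\<not> ?thesis"
      then have "(i, j - 1) \<in> B" using youngD(3)[OF Suc.prems(2), of i j i "j - 1"] ij 1 by auto
      then show False using min[of i "j - 1"] h ij 1 by auto
    qed
    ultimately have b: "(i, j) \<in> addable A" unfolding addable_iff[OF Suc.prems(1)] using ij 1 by blast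
    have c: "card (insert (i, j) A) = Suc (card A)" using card_addable[OF Suc.prems(1) b] .
    have "d = n - card (insert (i, j) A)" "card (insert (i, j) A) \<le> n" using Suc.hyps(2) c by linarith+
    then obtain D where "young D" "insert (i, j) A \<subseteq> D" "D \<subseteq> B" "card D = n"
      using Suc.hyps(1)[of "insert (i, j) A"] addable_young[OF b] Suc.prems ij by blast
    then show ?case by blast
  qed
  then show thesis using that by blast
qed

lemma young_rows:
  fixes r :: "nat \<Rightarrow> nat"
  assumes r: "antimono r"
  shows "young (SIGMA x:{1..s}. {1..r (x - 1)})"
proof (rule youngI)
  fix i j i' j' assume h: "(i, j) \<in> (SIGMA x:{1..s}. {1..r (x - 1)})" "1 \<le> i'" "i' \<le> i" "1 \<le> j'" "j' \<le> j"
  have "r (i - 1) \<le> r (i' - 1)" using h by (intro antimonoD[OF r]) auto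
  then show "(i', j') \<in> (SIGMA x:{1..s}. {1..r (x - 1)})" using h by auto
qed auto

lemma card_rows:
  fixes r :: "nat \<Rightarrow> nat" and s :: nat
  shows "card (SIGMA x:{1..s}. {1..r (x - 1)}) = (\<Sum>i<s. r i)"
proof -
  have "card (SIGMA x:{1..s}. {1..r (x - 1)}) = (\<Sum>x\<in>{1..s}. r (x - 1))"
    by (subst card_SigmaI) auto
  also have "\<dots> = (\<Sum>i<s. r i)" by (rule sum.reindex_bij_witness[of _ Suc "\<lambda>x. x - 1"]) auto
  finally show ?thesis .
qed

lemma young_swap: "young D \<Longrightarrow> young (prod.swap ` D)"
proof (rule youngI)
  assume D: "young D"
  show "finite (prod.swap ` D)" using D by (simp add: young_finite)
  show "1 \<le> i \<and> 1 \<le> j" if "(i, j) \<in> prod.swap ` D" for i j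
    using youngD(1,2)[OF D, of j i] that by auto
  show "(i', j') \<in> prod.swap ` D" if "(i, j) \<in> prod.swap ` D" "1 \<le> i'" "i' \<le> i" "1 \<le> j'" "j' \<le> j" for i j i' j'
  proof -
    have "(j', i') \<in> D" using youngD(3)[OF D, of j i j' i'] that by auto
    then show ?thesis by (intro image_eqI[of _ _ "(j', i')"]) auto
  qed
qed

text \<open>Take about \<open>sqrt n\<close> rows of length
  \<open>\<lfloor>n * \<alpha>\<rfloor>\<close> and columns of length
  \<open>\<lfloor>n * \<beta>\<rfloor>\<close>; their union has at most \<open>n\<close> boxes
  because the coordinates sum to at most \<open>1\<close>. The missing boxes come from a square of
  side about \<open>sqrt n\<close>, which changes each row and column by \<open>o(n)\<close>
  only.\<close>

lemma Thoma_approx_quantitative: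
  assumes T: "\<omega> \<in> Thoma" and n: "n \<ge> 1"
  obtains D where "D \<in> YD n"
    "\<And>k. real k < sqrt (real n) \<Longrightarrow> \<bar>fst (iota n D) k - fst \<omega> k\<bar> \<le> (sqrt (real n) + real k + 3) / real n"
    "\<And>k. real k < sqrt (real n) \<Longrightarrow> \<bar>snd (iota n D) k - snd \<omega> k\<bar> \<le> (sqrt (real n) + real k + 3) / real n"
proof -
  note t = ThomaD[OF T]
  \<comment> \<open>The least integer whose square is surely at least \<open>n\<close>, so the
    square alone has enough boxes for the filling.\<close>
  define s where "s = nat \<lceil>sqrt (real n)\<rceil>"
  have s: "sqrt (real n) \<le> real s" "real s \<le> sqrt (real n) + 1"
  proof -
    have "0 \<le> sqrt (real n)" by simp
    then show "sqrt (real n) \<le> real s" "real s \<le> sqrt (real n) + 1" unfolding s_def by linarith+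
  qed
  define r where "r i = nat \<lfloor>real n * fst \<omega> i\<rfloor>" for i
  define c where "c i = nat \<lfloor>real n * snd \<omega> i\<rfloor>" for i
  have rb: "real (r i) \<le> real n * fst \<omega> i" "real n * fst \<omega> i \<le> real (r i) + 1" for i
  proof -
    have "0 \<le> real n * fst \<omega> i" using t(1) by simp
    then show "real (r i) \<le> real n * fst \<omega> i" "real n * fst \<omega> i \<le> real (r i) + 1" unfolding r_def by linarith+
  qed
  have cb: "real (c i) \<le> real n * snd \<omega> i" "real n * snd \<omega> i \<le> real (c i) + 1" for i
  proof -
    have "0 \<le> real n * snd \<omega> i" using t(2) by simp
    then show "real (c i) \<le> real n * snd \<omega> i" "real n * snd \<omega> i \<le> real (c i) + 1" unfolding c_def by linarith+
  qed
  have ra: "antimono r" unfolding r_def[abs_def] using t(7) by (intro antimonoI nat_mono floor_mono mult_left_mono) auto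
  have ca: "antimono c" unfolding c_def[abs_def] using t(8) by (intro antimonoI nat_mono floor_mono mult_left_mono) auto
  define R where "R = (SIGMA x:{1..s}. {1..r (x - 1)})"
  define C where "C = prod.swap ` (SIGMA x:{1..s}. {1..c (x - 1)})"
  define Q where "Q = (SIGMA x:{1..s}. {1..s})"
  have y: "young R" "young C" "young Q"
    using young_rows[OF ra, of s] young_swap[OF young_rows[OF ca, of s]] young_rows[of "\<lambda>_. s" s]
    by (auto simp: R_def C_def Q_def antimono_def)
  have cR: "card R = (\<Sum>i<s. r i)" unfolding R_def by (rule card_rows)
  have cC: "card C = (\<Sum>i<s. c i)" unfolding C_def card_rows[symmetric] by (rule card_image) (auto simp: inj_on_def)
  have "real (card (R \<union> C)) \<le> real (card R) + real (card C)" using card_Un_le[of R C] by (simp flip: of_nat_add)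
  also have "\<dots> = (\<Sum>i<s. real (r i) + real (c i))" by (simp add: cR cC sum.distrib)
  also have "\<dots> \<le> (\<Sum>i<s. real n * (fst \<omega> i + snd \<omega> i))"
    using rb cb by (intro sum_mono) (simp add: distrib_left add_mono)
  also have "\<dots> \<le> real n * 1" unfolding sum_distrib_left[symmetric] using t(9) by (intro mult_left_mono) auto
  finally have le: "card (R \<union> C) \<le> n" by simp
  have "real n = sqrt (real n) * sqrt (real n)" by simp
  also have "\<dots> \<le> real s * real s" using s by (intro mult_mono) auto
  finally have "n \<le> s * s" by (simp flip: of_nat_mult)
  also have "s * s = card Q" unfolding Q_def by simp
  also have "\<dots> \<le> card (R \<union> C \<union> Q)" using y by (intro card_mono) (auto simp: young_finite)
  finally have ge: "n \<le> card (R \<union> C \<union> Q)" .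
  obtain D where D: "young D" "R \<union> C \<subseteq> D" "D \<subseteq> R \<union> C \<union> Q" "card D = n"
    using young_between[OF young_Un[OF y(1,2)] young_Un[OF young_Un[OF y(1,2)] y(3)] _ le ge] by blast
  have row: "r k \<le> row_len D (Suc k)" "row_len D (Suc k) \<le> max (r k) s" if k: "k < s" for k
  proof -
    show "r k \<le> row_len D (Suc k)"
    proof (cases "r k = 0")
      case False
      then have "(Suc k, r k) \<in> R" using k by (auto simp: R_def)
      then show ?thesis using D(2) row_iff[OF D(1), of "Suc k" "r k"] by auto
    qed simp
    show "row_len D (Suc k) \<le> max (r k) s"
    proof (cases "row_len D (Suc k) = 0")
      case False
      then have "(Suc k, row_len D (Suc k)) \<in> D" using row_iff[OF D(1), of "Suc k"] by auto
      then have "(Suc k, row_len D (Suc k)) \<in> R \<union> C \<union> Q" using D(3) by blast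
      then show ?thesis by (auto simp: R_def C_def Q_def)
    qed simp
  qed
  have col: "c k \<le> col_len D (Suc k)" "col_len D (Suc k) \<le> max (c k) s" if k: "k < s" for k
  proof -
    show "c k \<le> col_len D (Suc k)"
    proof (cases "c k = 0")
      case False
      then have "(c k, Suc k) \<in> C" using k unfolding C_def by (intro image_eqI[of _ _ "(Suc k, c k)"]) auto
      then show ?thesis using D(2) col_iff[OF D(1), of "Suc k" "c k"] by auto
    qed simp
    show "col_len D (Suc k) \<le> max (c k) s"
    proof (cases "col_len D (Suc k) = 0")
      case False
      then have "(col_len D (Suc k), Suc k) \<in> D" using col_iff[OF D(1), of "Suc k"] by auto
      then have "(col_len D (Suc k), Suc k) \<in> R \<union> C \<union> Q" using D(3) by blast
      then show ?thesis by (auto simp: R_def C_def Q_def)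
    qed simp
  qed
  \<comment> \<open>Past the diagonal \<open>iota\<close> is \<open>0\<close> by definition; there
    \<open>l \<le> k\<close>, so the target \<open>n * v\<close> is at most \<open>k + 1\<close> and
    within the error.\<close>
  have est: "\<bar>(if k < diag_len D then (real l - real (Suc k) + 1/2) / real n else 0) - v\<bar> \<le> (sqrt (real n) + real k + 3) / real n"
    if k: "k < s" and l: "q \<le> l" "l \<le> max q s" and q: "real q \<le> real n * v" "real n * v \<le> real q + 1"
      and v: "0 \<le> v" and diag: "\<not> k < diag_len D \<Longrightarrow> l \<le> k" for k l q v
  proof -
    define u where "u = (if k < diag_len D then real l - real (Suc k) + 1/2 else 0)"
    have "real l \<le> real q + real s" "real q \<le> real l" using l by linarith+
    then have "\<bar>u - real n * v\<bar> \<le> sqrt (real n) + real k + 3"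
    proof (cases "k < diag_len D")
      case True
      then show ?thesis using q s(2) \<open>real l \<le> real q + real s\<close> \<open>real q \<le> real l\<close> unfolding u_def by simp
    next
      case False
      then have "real l \<le> real k" using diag by simp
      moreover have "0 \<le> real n * v" "0 \<le> sqrt (real n)" using v by auto
      moreover have "u = 0" using False by (simp add: u_def)
      ultimately show ?thesis using q \<open>real q \<le> real l\<close> by linarith
    qed
    then have "\<bar>u - real n * v\<bar> / real n \<le> (sqrt (real n) + real k + 3) / real n" by (rule divide_right_mono) simp
    moreover have "\<bar>u - real n * v\<bar> / real n = \<bar>u / real n - v\<bar>" 
    proof -
      have "u / real n - v = (u - real n * v) / real n" using n by (simp add: field_simps)
      then show ?thesis by (simp add: abs_divide)
    qed
    ultimately show ?thesis unfolding u_def by (simp split: if_splits)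
  qed
  have ks: "k < s" if "real k < sqrt (real n)" for k using that s(1) by simp
  show thesis
  proof (rule that)
    show "D \<in> YD n" using D by (simp add: YD_def)
    fix k assume k: "real k < sqrt (real n)"
    have dg: "row_len D (Suc k) \<le> k" "col_len D (Suc k) \<le> k" if "\<not> k < diag_len D"
    proof -
      have "(Suc k, Suc k) \<notin> D" using diag_iff[OF D(1), of "Suc k"] that by simp
      then show "row_len D (Suc k) \<le> k" "col_len D (Suc k) \<le> k"
        using row_iff[OF D(1), of "Suc k" "Suc k"] col_iff[OF D(1), of "Suc k" "Suc k"] by auto
    qed
    show "\<bar>fst (iota n D) k - fst \<omega> k\<bar> \<le> (sqrt (real n) + real k + 3) / real n"
      using est[OF ks[OF k] row[OF ks[OF k]] rb t(1) dg(1)] by (simp add: iota_def)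
    show "\<bar>snd (iota n D) k - snd \<omega> k\<bar> \<le> (sqrt (real n) + real k + 3) / real n"
      using est[OF ks[OF k] col[OF ks[OF k]] cb t(2) dg(2)] by (simp add: iota_def)
  qed
qed

lemma tendsto_fun_iff:
  fixes f :: "'a \<Rightarrow> nat \<Rightarrow> real"
  shows "(f \<longlongrightarrow> l) F \<longleftrightarrow> (\<forall>k. ((\<lambda>x. f x k) \<longlongrightarrow> l k) F)"
  using limitin_componentwise[of "\<lambda>_. euclidean" UNIV f l F]
  by (simp add: euclidean_product_topology)

text \<open>There is one diagram at every level \<open>n \<ge> 1\<close>, not just along a
  subsequence. The semigroup is controlled only on the images of \<open>iota n\<close> as
  \<open>n\<close> grows, and continuity then carries the control to every point.\<close>

lemma Thoma_approx:
  assumes T: "\<omega> \<in> Thoma"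
  obtains D where "\<And>n. n \<ge> 1 \<Longrightarrow> D n \<in> YD n" "(\<lambda>n. iota n (D n)) \<longlonglongrightarrow> \<omega>"
proof -
  define P where "P n D \<longleftrightarrow> D \<in> YD n \<and>
    (\<forall>k. real k < sqrt (real n) \<longrightarrow> \<bar>fst (iota n D) k - fst \<omega> k\<bar> \<le> (sqrt (real n) + real k + 3) / real n \<and>
     \<bar>snd (iota n D) k - snd \<omega> k\<bar> \<le> (sqrt (real n) + real k + 3) / real n)" for n D
  have "\<exists>D. P n D" if n: "n \<ge> 1" for n
  proof -
    obtain D where "D \<in> YD n"
      "\<And>k. real k < sqrt (real n) \<Longrightarrow> \<bar>fst (iota n D) k - fst \<omega> k\<bar> \<le> (sqrt (real n) + real k + 3) / real n"
      "\<And>k. real k < sqrt (real n) \<Longrightarrow> \<bar>snd (iota n D) k - snd \<omega> k\<bar> \<le> (sqrt (real n) + real k + 3) / real n"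
      using Thoma_approx_quantitative[OF T n] by blast
    then show ?thesis unfolding P_def by blast
  qed
  then obtain D where D: "\<And>n. n \<ge> 1 \<Longrightarrow> P n (D n)" by metis
  have ev: "\<forall>\<^sub>F n in sequentially. n \<ge> 1 \<and> real k < sqrt (real n)" for k
  proof (rule eventually_conj)
    show "\<forall>\<^sub>F n in sequentially. n \<ge> 1" by (rule eventually_ge_at_top)
    have "filterlim (\<lambda>n. sqrt (real n)) at_top sequentially" by real_asymp
    then show "\<forall>\<^sub>F n in sequentially. real k < sqrt (real n)" by (simp add: filterlim_at_top_dense)
  qed
  have lim: "(\<lambda>n. (sqrt (real n) + real k + 3) / real n) \<longlonglongrightarrow> 0" for k by real_asymp
  have cf: "(\<lambda>n. fst (iota n (D n)) k - fst \<omega> k) \<longlonglongrightarrow> 0" for k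
    by (rule Lim_null_comparison[OF _ lim[of k]], rule eventually_mono[OF ev[of k]]) (use D in \<open>auto simp: P_def\<close>)
  have 1: "(\<lambda>n. fst (iota n (D n))) \<longlonglongrightarrow> fst \<omega>"
    unfolding tendsto_fun_iff using LIM_zero_cancel[OF cf] by simp
  have cs: "(\<lambda>n. snd (iota n (D n)) k - snd \<omega> k) \<longlonglongrightarrow> 0" for k
    by (rule Lim_null_comparison[OF _ lim[of k]], rule eventually_mono[OF ev[of k]]) (use D in \<open>auto simp: P_def\<close>)
  have 2: "(\<lambda>n. snd (iota n (D n))) \<longlonglongrightarrow> snd \<omega>"
    unfolding tendsto_fun_iff using LIM_zero_cancel[OF cs] by simp
  have "(\<lambda>n. iota n (D n)) \<longlonglongrightarrow> \<omega>" using tendsto_Pair[OF 1 2] by simp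
  then show thesis using that[of D] D unfolding P_def by blast
qed


section \<open>The up-down chain\<close>

definition box_weight :: "complex \<Rightarrow> complex \<Rightarrow> int \<Rightarrow> real" where
  "box_weight z z' c = Re ((z + of_int c) * (z' + of_int c))"

text \<open>In the principal series the product is \<open>\<bar>z + c\<bar>^2\<close> with
  \<open>Im z \<noteq> 0\<close>. In the complementary series no integer lies between the two
  parameters, so both factors have the same sign.\<close>

lemma box_weight_props:
  assumes "admissible_zz z z'"
  shows "(z + of_int c) * (z' + of_int c) = of_real (box_weight z z' c)" "box_weight z z' c > 0"
proof -
  have "Im ((z + of_int c) * (z' + of_int c)) = 0 \<and> box_weight z z' c > 0"
    using assms unfolding admissible_zz_def
  proof
    assume h: "Im z \<noteq> 0 \<and> z' = cnj z"
    have "(Re z + of_int c)\<^sup>2 + (Im z)\<^sup>2 > 0" using h by (simp add: add_nonneg_pos)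
    then show ?thesis using h by (simp add: box_weight_def power2_eq_square algebra_simps)
  next
    assume "\<exists>N::int. Im z = 0 \<and> Im z' = 0 \<and> of_int N < Re z \<and> Re z < of_int N + 1
               \<and> of_int N < Re z' \<and> Re z' < of_int N + 1"
    then obtain N :: int where N: "Im z = 0" "Im z' = 0" "of_int N < Re z" "Re z < of_int N + 1"
      "of_int N < Re z'" "Re z' < of_int N + 1" by blast
    have "(Re z + of_int c) * (Re z' + of_int c) > 0"
    proof (cases "N + c \<ge> 0")
      case True
      then have "real_of_int N + of_int c \<ge> 0" by (simp flip: of_int_add)
      then show ?thesis using N by (intro mult_pos_pos) linarith+
    next
      case False
      then have "N + c + 1 \<le> 0" by simp
      then have "real_of_int N + of_int c + 1 \<le> 0" by (metis of_int_1 of_int_add of_int_le_0_iff)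
      then show ?thesis using N by (intro mult_neg_neg) linarith+
    qed
    then show ?thesis using N by (simp add: box_weight_def)
  qed
  then show "(z + of_int c) * (z' + of_int c) = of_real (box_weight z z' c)" "box_weight z z' c > 0"
    by (auto simp: box_weight_def complex_eq_iff)
qed

lemma box_weight_second_diff:
  "box_weight z z' (c + 1) + box_weight z z' (c - 1) - 2 * box_weight z z' c = 2"
proof -
  have "box_weight z z' (c + 1) + box_weight z z' (c - 1) - 2 * box_weight z z' c
    = Re ((z + of_int (c + 1)) * (z' + of_int (c + 1)) + (z + of_int (c - 1)) * (z' + of_int (c - 1)) - 2 * ((z + of_int c) * (z' + of_int c)))"
    by (simp add: box_weight_def)
  also have "(z + of_int (c + 1)) * (z' + of_int (c + 1)) + (z + of_int (c - 1)) * (z' + of_int (c - 1)) - 2 * ((z + of_int c) * (z' + of_int c)) = 2"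
    by (simp add: algebra_simps)
  finally show ?thesis by simp
qed

locale zz_params =
  fixes z z' :: complex
  assumes adm: "admissible_zz z z'"
begin

definition w :: "int \<Rightarrow> real" where "w = box_weight z z'"

definition t :: real where "t = w 0"

lemma w_pos: "w c > 0" and t_pos: "t > 0"
  using box_weight_props(2)[OF adm] by (auto simp: w_def t_def)

lemma zz_eq: "z * z' = of_real t"
  using box_weight_props(1)[OF adm, of 0] by (simp add: t_def w_def)

text \<open>The weight is a monic quadratic in the content, so each second difference is
  \<open>2\<close> and the diagonal term becomes a function of the size alone. Everything that
  follows about the chain rests on this.\<close>

lemma up_down_w:
  assumes "young D"
  shows "up w (down g) D = (t + 2 * real (card D)) * g D + down (up w g) D"
  unfolding up_down[OF assms] by (simp add: w_def box_weight_second_diff t_def)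

text \<open>Commuting past \<open>k + 1\<close> down steps collects the sum of
  \<open>t + 2 * (n - i)\<close> over \<open>i \<le> k\<close>, which is
  \<open>(k + 1) * (t + 2 * n - k)\<close>.\<close>

lemma up_down_pow:
  assumes "young D" "k \<le> card D"
  shows "up w ((down ^^ Suc k) h) D
    = (real k + 1) * (t + 2 * real (card D) - real k) * (down ^^ k) h D + (down ^^ Suc k) (up w h) D"
  using assms
proof (induction k arbitrary: D)
  case 0
  then show ?case by (simp add: up_down_w)
next
  case (Suc k)
  define n where "n = real (card D)"
  have IH: "up w ((down ^^ Suc k) h) (D - {b})
    = (real k + 1) * (t + 2 * (n - 1) - real k) * (down ^^ k) h (D - {b}) + (down ^^ Suc k) (up w h) (D - {b})"
    if b: "b \<in> removable D" for b
  proof -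
    have "card (D - {b}) = card D - 1" using card_removable[OF Suc.prems(1) b] .
    moreover have "real (card D - 1) = n - 1" using Suc.prems(2) by (simp add: n_def of_nat_diff)
    ultimately show ?thesis using Suc.IH[of "D - {b}"] removable_young[OF b] Suc.prems(2) by simp
  qed
  have "down (up w ((down ^^ Suc k) h)) D
    = down (\<lambda>E. (real k + 1) * (t + 2 * (n - 1) - real k) * (down ^^ k) h E + (down ^^ Suc k) (up w h) E) D"
    by (rule down_cong) (rule IH)
  also have "\<dots> = (real k + 1) * (t + 2 * (n - 1) - real k) * (down ^^ Suc k) h D + (down ^^ Suc (Suc k)) (up w h) D"
    unfolding down_add down_cmult by simp
  finally have 1: "down (up w ((down ^^ Suc k) h)) D
    = (real k + 1) * (t + 2 * (n - 1) - real k) * (down ^^ Suc k) h D + (down ^^ Suc (Suc k)) (up w h) D" .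
  have "up w ((down ^^ Suc (Suc k)) h) D = up w (down ((down ^^ Suc k) h)) D" by simp
  also have "\<dots> = (t + 2 * n) * (down ^^ Suc k) h D + down (up w ((down ^^ Suc k) h)) D"
    unfolding n_def by (rule up_down_w[OF Suc.prems(1)])
  also have "\<dots> = (real (Suc k) + 1) * (t + 2 * n - real (Suc k)) * (down ^^ Suc k) h D + (down ^^ Suc (Suc k)) (up w h) D"
    unfolding 1 by (simp add: algebra_simps del: funpow.simps)
  finally show ?case by (simp only: n_def)
qed

text \<open>The sum of \<open>t + 2 * i\<close> over \<open>i \<le> n\<close>, by
  \<open>up_down_w\<close> and induction. It is the normalisation in \<open>p_up\<close>: the up
  transition probabilities sum to \<open>1\<close>.\<close>

lemma up_one:
  assumes "young D"
  shows "up w (\<lambda>_. 1) D = (t + real (card D)) * (real (card D) + 1)"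
  using assms
proof (induction "card D" arbitrary: D rule: less_induct)
  case less
  have "up w (\<lambda>_. 1) D = up w (down (\<lambda>_. 1)) D"
    by (rule up_cong) (simp add: down_const addable_young)
  also have "\<dots> = (t + 2 * real (card D)) + down (up w (\<lambda>_. 1)) D"
    by (simp add: up_down_w[OF less.prems])
  also have "down (up w (\<lambda>_. 1)) D = (t + real (card D) - 1) * real (card D)"
  proof (cases "D = {}")
    case True
    then show ?thesis by simp
  next
    case False
    then have c: "card D > 0" using less.prems by (simp add: young_finite card_gt_0_iff)
    have "down (up w (\<lambda>_. 1)) D = down (\<lambda>_. (t + real (card D) - 1) * real (card D)) D"
    proof (rule down_cong)
      fix b assume b: "b \<in> removable D"
      have cb: "card (D - {b}) = card D - 1" using card_removable[OF less.prems b] .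
      then show "up w (\<lambda>_. 1) (D - {b}) = (t + real (card D) - 1) * real (card D)"
        using less.hyps[of "D - {b}"] c removable_young[OF b] by (simp add: of_nat_diff)
    qed
    then show ?thesis using down_const[OF less.prems False] by simp
  qed
  finally show ?case by (simp add: algebra_simps)
qed

section \<open>The chain Tn in terms of the up and down operators\<close>

lemma poch_diag_insert:
  assumes "b \<notin> D"
  shows "poch_diag y (insert b D - D) = y + of_int (box_content b)"
proof -
  have "insert b D - D = {b}" using assms by auto
  then show ?thesis by (simp add: poch_diag_def box_content_def case_prod_unfold)
qed

lemma covers_iff:
  assumes "young D" "young E"
  shows "covers D E \<longleftrightarrow> (\<exists>b\<in>addable D. E = insert b D)"
proof
  assume c: "covers D E"
  have fin: "finite D" "finite E" using assms by (simp_all add: young_finite)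
  have "card (E - D) = 1" using c fin by (simp add: covers_def card_Diff_subset)
  then obtain b where b: "E - D = {b}" by (auto simp: card_1_singleton_iff)
  have "E = insert b D" "b \<notin> D" using b c unfolding covers_def by auto
  then show "\<exists>b\<in>addable D. E = insert b D" 
    using assms by (intro bexI[of _ b]) (auto simp: addable_def)
next
  assume "\<exists>b\<in>addable D. E = insert b D"
  then show "covers D E" using card_addable[OF assms(1)] by (auto simp: covers_def)
qed

lemma p_up_insert:
  assumes D: "D \<in> YD n" and b: "b \<in> addable D"
  shows "p_up z z' n D (insert b D) = w (box_content b) / ((t + real n) * (real n + 1)) * (real (dimY (insert b D)) / real (dimY D))"
proof -
  have y: "young D" "b \<notin> D" using D b by (auto simp: YD_def addable_def)
  have c: "covers D (insert b D)" using covers_iff[OF y(1) addable_young[OF b]] b by blast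
  have "poch_diag z (insert b D - D) * poch_diag z' (insert b D - D) / (z * z' + of_nat n)
    = of_real (w (box_content b) / (t + real n))"
    unfolding poch_diag_insert[OF y(2)] box_weight_props(1)[OF adm] zz_eq w_def by simp
  then have "Re (poch_diag z (insert b D - D) * poch_diag z' (insert b D - D) / (z * z' + of_nat n)) = w (box_content b) / (t + real n)"
    by simp
  then show ?thesis unfolding p_up_def using c by (simp add: add.commute)
qed

lemma down_eq_sum:
  assumes E: "E \<in> YD (Suc n)"
  shows "(\<Sum>D\<in>YD n. p_down E D * g D) = down g E"
proof -
  have y: "young E" "card E = Suc n" using E by (auto simp: YD_def)
  have "down g E = (\<Sum>D\<in>(\<lambda>b. E - {b}) ` removable E. p_down E D * g D)"
  proof (subst sum.reindex)
    show "inj_on (\<lambda>b. E - {b}) (removable E)" by (auto simp: inj_on_def removable_def)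
    show "down g E = sum ((\<lambda>D. p_down E D * g D) \<circ> (\<lambda>b. E - {b})) (removable E)"
      unfolding down_def comp_def
    proof (rule sum.cong)
      fix b assume b: "b \<in> removable E"
      have "covers (E - {b}) E" using b card_removable[OF y(1) b] y by (auto simp: covers_def)
      then show "real (dimY (E - {b})) / real (dimY E) * g (E - {b}) = p_down E (E - {b}) * g (E - {b})"
        by (simp add: p_down_def)
    qed simp
  qed
  also have "\<dots> = (\<Sum>D\<in>YD n. p_down E D * g D)"
  proof (rule sum.mono_neutral_left[OF finite_YD])
    show "(\<lambda>b. E - {b}) ` removable E \<subseteq> YD n"
      using y card_removable[OF y(1)] removable_young by (auto simp: YD_def)
    show "\<forall>D\<in>YD n - (\<lambda>b. E - {b}) ` removable E. p_down E D * g D = 0"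
    proof
      fix D assume D: "D \<in> YD n - (\<lambda>b. E - {b}) ` removable E"
      have "\<not> covers D E"
      proof
        assume "covers D E"
        then obtain b where b: "b \<in> addable D" "E = insert b D" using covers_iff[of D E] D y by (auto simp: YD_def)
        then have "b \<in> removable E" "D = E - {b}" using D removable_insert by (auto simp: YD_def addable_def)
        then show False using D by blast
      qed
      then show "p_down E D * g D = 0" by (simp add: p_down_def)
    qed
  qed
  finally show ?thesis ..
qed

lemma Tn_eq:
  assumes D: "D \<in> YD n"
  shows "Tn z z' n g D = up w (down g) D / ((t + real n) * (real n + 1))"
proof -
  have y: "young D" "card D = n" using D by (auto simp: YD_def)
  have "up w (down g) D / ((t + real n) * (real n + 1)) = (\<Sum>b\<in>addable D. p_up z z' n D (insert b D) * down g (insert b D))"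
    unfolding up_def sum_divide_distrib by (rule sum.cong) (auto simp: p_up_insert[OF D])
  also have "\<dots> = (\<Sum>E\<in>(\<lambda>b. insert b D) ` addable D. p_up z z' n D E * down g E)"
    by (subst sum.reindex) (auto simp: inj_on_def addable_def)
  also have "\<dots> = (\<Sum>E\<in>YD (Suc n). p_up z z' n D E * down g E)"
  proof (rule sum.mono_neutral_left[OF finite_YD])
    show "(\<lambda>b. insert b D) ` addable D \<subseteq> YD (Suc n)"
      using y card_addable[OF y(1)] addable_young by (auto simp: YD_def)
    show "\<forall>E\<in>YD (Suc n) - (\<lambda>b. insert b D) ` addable D. p_up z z' n D E * down g E = 0"
    proof
      fix E assume E: "E \<in> YD (Suc n) - (\<lambda>b. insert b D) ` addable D"
      then have "\<not> covers D E" using covers_iff[of D E] y by (auto simp: YD_def)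
      then show "p_up z z' n D E * down g E = 0" by (simp add: p_up_def)
    qed
  qed
  also have "\<dots> = Tn z z' n g D"
    unfolding Tn_def by (rule sum.cong) (auto simp: down_eq_sum)
  finally show ?thesis ..
qed

lemma Tn_cong:
  assumes "\<And>D. D \<in> YD n \<Longrightarrow> f D = g D"
  shows "Tn z z' n f D = Tn z z' n g D"
  unfolding Tn_def using assms by (intro sum.cong arg_cong2[where f = "(*)"] refl) auto

text \<open>Both \<open>down\<close> and the normalised \<open>up w\<close> are averages: their
  coefficients are nonnegative, as \<open>w_pos\<close> ensures for \<open>up w\<close>, and sum to
  \<open>1\<close> by \<open>down_weights\<close> and \<open>up_one\<close>.\<close>

lemma Tn_diff_le:
  assumes D: "D \<in> YD n" and e: "\<And>E. E \<in> YD n \<Longrightarrow> \<bar>f E - g E\<bar> \<le> e"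
  shows "\<bar>Tn z z' n f D - Tn z z' n g D\<bar> \<le> e"
proof -
  have y: "young D" "card D = n" using D by (auto simp: YD_def)
  define N where "N = (t + real n) * (real n + 1)"
  have N: "N > 0" using t_pos by (simp add: N_def)
  have "\<bar>down f E - down g E\<bar> \<le> e" if E: "young E" "card E = Suc n" for E
  proof -
    have ne: "E \<noteq> {}" using E by auto
    have mem: "E - {b} \<in> YD n" if "b \<in> removable E" for b
      using card_removable[OF E(1) that] removable_young[OF that] E by (simp add: YD_def)
    have "down f E \<le> down (\<lambda>D. g D + e) E" using e[OF mem] by (intro down_mono) fastforce
    moreover have "down g E \<le> down (\<lambda>D. f D + e) E" using e[OF mem] by (intro down_mono) fastforce
    ultimately show ?thesis unfolding down_add down_const[OF E(1) ne] by simp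
  qed
  then have *: "\<bar>down f (insert b D) - down g (insert b D)\<bar> \<le> e" if "b \<in> addable D" for b
    using card_addable[OF y(1) that] addable_young[OF that] y by simp
  have "\<bar>up w (down f) D - up w (down g) D\<bar>
     = \<bar>\<Sum>b\<in>addable D. w (box_content b) * (real (dimY (insert b D)) / real (dimY D)) * (down f (insert b D) - down g (insert b D))\<bar>"
    unfolding up_def sum_subtractf[symmetric] by (simp add: right_diff_distrib)
  also have "\<dots> \<le> (\<Sum>b\<in>addable D. w (box_content b) * (real (dimY (insert b D)) / real (dimY D)) * e)"
  proof (rule order.trans[OF sum_abs sum_mono])
    fix b assume b: "b \<in> addable D"
    have p: "w (box_content b) * (real (dimY (insert b D)) / real (dimY D)) \<ge> 0" using w_pos[of "box_content b"] by simp
    show "\<bar>w (box_content b) * (real (dimY (insert b D)) / real (dimY D)) * (down f (insert b D) - down g (insert b D))\<bar>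
      \<le> w (box_content b) * (real (dimY (insert b D)) / real (dimY D)) * e"
      unfolding abs_mult[of "w (box_content b) * _"] abs_of_nonneg[OF p] using *[OF b] p by (rule mult_left_mono)
  qed
  also have "\<dots> = up w (\<lambda>_. 1) D * e" by (simp add: up_def sum_distrib_right)
  also have "\<dots> = N * e" using up_one[OF y(1)] y by (simp add: N_def)
  finally have "\<bar>up w (down f) D - up w (down g) D\<bar> / N \<le> N * e / N" using N by (intro divide_right_mono) auto
  then have "\<bar>up w (down f) D / N - up w (down g) D / N\<bar> \<le> e" using N by (simp add: diff_divide_distrib[symmetric])
  then show ?thesis unfolding Tn_eq[OF D] N_def .
qed

lemma Tn_pow_diff_le:
  assumes "D \<in> YD n" "\<And>E. E \<in> YD n \<Longrightarrow> \<bar>f E - g E\<bar> \<le> e"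
  shows "\<bar>(Tn z z' n ^^ j) f D - (Tn z z' n ^^ j) g D\<bar> \<le> e"
  using assms(1) by (induction j arbitrary: D) (auto simp: assms(2) intro: Tn_diff_le)

lemma Tn_const:
  assumes "D \<in> YD n"
  shows "Tn z z' n (\<lambda>_. c) D = c"
proof -
  have y: "young D" "card D = n" using assms by (auto simp: YD_def)
  have "up w (down (\<lambda>_. c)) D = up w (\<lambda>_. c * 1) D"
    by (rule up_cong) (simp add: down_const addable_young)
  also have "\<dots> = c * ((t + real n) * (real n + 1))" unfolding up_cmult up_one[OF y(1)] y(2) by simp
  finally show ?thesis using t_pos unfolding Tn_eq[OF assms] by simp
qed

lemma Tn_pow_const:
  assumes "D \<in> YD n"
  shows "(Tn z z' n ^^ j) (\<lambda>_. c) D = c"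
  using assms
proof (induction j arbitrary: D)
  case 0
  then show ?case by simp
next
  case (Suc j)
  have "(Tn z z' n ^^ Suc j) (\<lambda>_. c) D = Tn z z' n ((Tn z z' n ^^ j) (\<lambda>_. c)) D" by simp
  also have "\<dots> = Tn z z' n (\<lambda>_. c) D" by (rule Tn_cong) (rule Suc.IH)
  finally show ?case using Tn_const[OF Suc.prems] by simp
qed

text \<open>The up-down chain preserves the functions that factor through a fixed level \<open>m\<close> of the down
  chain, and acts on them by a step \<open>1 + e A\<close> with \<open>A\<close> independent of \<open>n\<close>.\<close>

definition level_rate :: "nat \<Rightarrow> real" where
  "level_rate m = real m * (real m - 1 + t)"

definition level_step :: "nat \<Rightarrow> real \<Rightarrow> ((nat \<times> nat) set \<Rightarrow> real) \<Rightarrow> (nat \<times> nat) set \<Rightarrow> real" where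
  "level_step m e h D = h D + e * (down (up w h) D - level_rate m * h D)"

text \<open>With \<open>k = n - m\<close> the coefficient \<open>(k + 1) * (t + 2 * n - k)\<close>
  of \<open>up_down_pow\<close> equals \<open>(t + n) * (n + 1) - level_rate m\<close>; the
  dependence on \<open>n\<close> is confined to the normalisation, and \<open>level_rate m\<close>
  is minus the diagonal coefficient of the generator in degree \<open>m\<close>.\<close>

lemma Tn_down_pow:
  assumes D: "D \<in> YD n" and m: "m \<le> n"
  shows "Tn z z' n ((down ^^ (n - m)) h) D = (down ^^ (n - m)) (level_step m (1 / ((t + real n) * (real n + 1))) h) D"
proof -
  have y: "young D" "card D = n" using D by (auto simp: YD_def)
  define k where "k = n - m"
  define N where "N = (t + real n) * (real n + 1)"
  have N: "N > 0" using t_pos by (simp add: N_def)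
  have km: "real k = real n - real m" using m by (simp add: k_def of_nat_diff)
  have "up w (down ((down ^^ k) h)) D = (real k + 1) * (t + 2 * real n - real k) * (down ^^ k) h D + (down ^^ Suc k) (up w h) D"
    using up_down_pow[OF y(1), of k h] y(2) by (simp add: k_def)
  also have "(real k + 1) * (t + 2 * real n - real k) = N - level_rate m"
    unfolding km N_def level_rate_def by (simp add: algebra_simps)
  finally have 1: "up w (down ((down ^^ k) h)) D = (N - level_rate m) * (down ^^ k) h D + (down ^^ k) (down (up w h)) D"
    by (simp add: funpow_swap1)
  have "level_step m (1 / N) h = (\<lambda>E. h E + (1 / N * down (up w h) E + (- (level_rate m / N)) * h E))"
    by (simp add: level_step_def[abs_def] algebra_simps fun_eq_iff)
  then have "(down ^^ k) (level_step m (1 / N) h) D = (down ^^ k) h D + (1 / N * (down ^^ k) (down (up w h)) D + (- (level_rate m / N)) * (down ^^ k) h D)"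
    by (simp only: down_pow_add down_pow_cmult)
  also have "\<dots> = up w (down ((down ^^ k) h)) D / N" unfolding 1 using N by (simp add: field_simps)
  finally show ?thesis unfolding Tn_eq[OF D] N_def k_def by simp
qed

lemma Tn_pow_down_pow:
  assumes D: "D \<in> YD n" and m: "m \<le> n"
  shows "(Tn z z' n ^^ j) ((down ^^ (n - m)) h) D
    = (down ^^ (n - m)) ((level_step m (1 / ((t + real n) * (real n + 1))) ^^ j) h) D"
  using D
proof (induction j arbitrary: D)
  case 0
  then show ?case by simp
next
  case (Suc j)
  have "(Tn z z' n ^^ Suc j) ((down ^^ (n - m)) h) D
    = Tn z z' n ((down ^^ (n - m)) ((level_step m (1 / ((t + real n) * (real n + 1))) ^^ j) h)) D"
    unfolding funpow.simps comp_apply by (rule Tn_cong) (rule Suc.IH)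
  also have "\<dots> = (down ^^ (n - m)) ((level_step m (1 / ((t + real n) * (real n + 1))) ^^ Suc j) h) D"
    by (subst Tn_down_pow[OF Suc.prems m]) simp
  finally show ?case .
qed

text \<open>Removing a box and adding one returns to level \<open>m\<close>, so the step on level
  \<open>m\<close> sees only values on that level.\<close>

lemma level_step_cong:
  assumes D: "D \<in> YD m" and eq: "\<And>E. E \<in> YD m \<Longrightarrow> f E = g E"
  shows "level_step m e f D = level_step m e g D"
proof -
  have y: "young D" "card D = m" using D by (auto simp: YD_def)
  have "down (up w f) D = down (up w g) D"
  proof (intro down_cong up_cong)
    fix b x assume b: "b \<in> removable D" and x: "x \<in> addable (D - {b})"
    have "card D > 0" using b y young_finite[of D] by (auto simp: removable_def card_gt_0_iff)
    then have "card (insert x (D - {b})) = m"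
      using card_addable[OF removable_young[OF b] x] card_removable[OF y(1) b] y by simp
    then show "f (insert x (D - {b})) = g (insert x (D - {b}))"
      using addable_young[OF x] by (intro eq) (simp add: YD_def)
  qed
  then show ?thesis by (simp add: level_step_def eq[OF D])
qed

text \<open>The commutator on level \<open>m\<close> is \<open>t + 2 * m\<close>, which is
  \<open>level_rate (Suc m) - level_rate m\<close>; it shifts the rate from one level to the next
  lower one.\<close>

lemma up_level_step:
  assumes D: "D \<in> YD m"
  shows "up w (level_step (Suc m) e h) D = level_step m e (up w h) D"
proof -
  have y: "young D" "card D = m" using D by (auto simp: YD_def)
  have "level_step (Suc m) e h = (\<lambda>E. h E + (e * down (up w h) E + (- (e * level_rate (Suc m))) * h E))"
    by (simp add: level_step_def[abs_def] algebra_simps fun_eq_iff)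
  then have "up w (level_step (Suc m) e h) D = up w h D + (e * up w (down (up w h)) D + (- (e * level_rate (Suc m))) * up w h D)"
    by (simp only: up_add up_cmult)
  also have "\<dots> = level_step m e (up w h) D"
    unfolding up_down_w[OF y(1)] y(2) level_step_def level_rate_def by (simp add: algebra_simps)
  finally show ?thesis .
qed

lemma up_level_step_pow:
  assumes D: "D \<in> YD m"
  shows "up w ((level_step (Suc m) e ^^ j) h) D = (level_step m e ^^ j) (up w h) D"
  using D
proof (induction j arbitrary: D)
  case 0
  then show ?case by simp
next
  case (Suc j)
  have "up w ((level_step (Suc m) e ^^ Suc j) h) D = level_step m e (up w ((level_step (Suc m) e ^^ j) h)) D"
    by (simp add: up_level_step[OF Suc.prems])
  also have "\<dots> = level_step m e ((level_step m e ^^ j) (up w h)) D"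
    by (rule level_step_cong[OF Suc.prems]) (rule Suc.IH)
  finally show ?case by simp
qed

lemma level_rate_mono: "level_rate m \<le> level_rate (Suc m)"
  using t_pos by (simp add: level_rate_def algebra_simps)

lemma level_rate_ge: "t \<le> level_rate (Suc m)"
  using t_pos by (simp add: level_rate_def algebra_simps)

text \<open>On level \<open>m + 1\<close> the deviation from \<open>c\<close> is multiplied by
  \<open>1 - e * a\<close> and driven by \<open>down (up w f) - c'\<close>, which the previous level
  controls through the intertwining. The constants must not depend on \<open>e\<close> or
  \<open>j\<close>, because later \<open>e\<close> is of order \<open>1 / n^2\<close> while
  \<open>j\<close> is of order \<open>n^2\<close>.\<close>

lemma level_step_converges:
  "\<exists>c C. C \<ge> 0 \<and> (\<forall>e j D. 0 \<le> e \<longrightarrow> e * level_rate m \<le> 1 \<longrightarrow> D \<in> YD m \<longrightarrow>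
     \<bar>(level_step m e ^^ j) h D - c\<bar> \<le> C * (1 - t / 2 * e) ^ j)"
proof (induction m arbitrary: h)
  case 0
  have Y0: "YD 0 = {{}}" by (auto simp: YD_def young_finite)
  \<comment> \<open>At the empty diagram both the rate and \<open>down\<close> are \<open>0\<close>,
    so the step is the identity.\<close>
  have "(level_step 0 e ^^ j) h {} = h {}" for e j
    by (induction j) (simp_all add: level_step_def level_rate_def)
  then show ?case by (intro exI[of _ "h {}"] exI[of _ 0]) (auto simp: Y0)
next
  case (Suc m)
  obtain c' C' where C': "C' \<ge> 0" "\<And>e j D. 0 \<le> e \<Longrightarrow> e * level_rate m \<le> 1 \<Longrightarrow> D \<in> YD m \<Longrightarrow>
     \<bar>(level_step m e ^^ j) (up w h) D - c'\<bar> \<le> C' * (1 - t / 2 * e) ^ j"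
    using Suc.IH[of "up w h"] by blast
  define a where "a = level_rate (Suc m)"
  have a: "a \<ge> t" "a > 0" using level_rate_ge[of m] t_pos by (auto simp: a_def)
  \<comment> \<open>The fixed point of \<open>x \<mapsto> x + e * (c' - a * x)\<close>, the limiting
    recursion on this level.\<close>
  define c where "c = c' / a"
  define B where "B = (\<Sum>D\<in>YD (Suc m). \<bar>h D - c\<bar>)"
  have B: "\<bar>h D - c\<bar> \<le> B" if "D \<in> YD (Suc m)" for D
    unfolding B_def by (rule member_le_sum[OF that]) (auto simp: finite_YD)
  have B0: "B \<ge> 0" unfolding B_def by (intro sum_nonneg) auto
  \<comment> \<open>\<open>B\<close> covers \<open>j = 0\<close>. The other summand gives
    \<open>C' \<le> C * (a - t / 2)\<close>, which absorbs the driving term: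
    \<open>(1 - e * a) * C + e * C' \<le> C * (1 - e * t / 2)\<close>. Here \<open>a \<ge> t\<close>
    makes the denominator positive.\<close>
  define C where "C = B + C' / (a - t / 2)"
  have at: "a - t / 2 > 0" using a t_pos by linarith
  have C: "C \<ge> 0" "C \<ge> B" "C' \<le> C * (a - t / 2)"
  proof -
    have *: "C' / (a - t / 2) \<ge> 0" using C'(1) at by simp
    then show "C \<ge> 0" "C \<ge> B" using B0 by (simp_all add: C_def)
    have "C * (a - t / 2) = B * (a - t / 2) + C'" using at by (simp add: C_def distrib_right)
    then show "C' \<le> C * (a - t / 2)" using B0 at by simp
  qed
  have "\<bar>(level_step (Suc m) e ^^ j) h D - c\<bar> \<le> C * (1 - t / 2 * e) ^ j"
    if e: "0 \<le> e" "e * level_rate (Suc m) \<le> 1" and D: "D \<in> YD (Suc m)" for e j D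
    using D
  proof (induction j arbitrary: D)
    case 0
    then show ?case using B C(2) by fastforce
  next
    case (Suc j)
    define q where "q = (1 - t / 2 * e) ^ j"
    define f where "f = (level_step (Suc m) e ^^ j) h"
    have y: "young D" "card D = Suc m" "D \<noteq> {}" using Suc.prems by (auto simp: YD_def)
    have em: "e * level_rate m \<le> 1"
      using mult_left_mono[OF level_rate_mono[of m] e(1)] e(2) by linarith
    have ea: "e * a \<le> 1" using e(2) by (simp add: a_def)
    have "t / 2 * e \<le> 1"
    proof -
      have "e * (t / 2) \<le> e * a" using a t_pos e(1) by (intro mult_left_mono) auto
      then show ?thesis using ea by (simp add: mult.commute)
    qed
    then have q0: "q \<ge> 0" by (simp add: q_def)
    have "\<bar>up w f E - c'\<bar> \<le> C' * q" if "E \<in> YD m" for E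
      unfolding f_def up_level_step_pow[OF that] q_def by (rule C'(2)[OF e(1) em that])
    moreover have "D - {b} \<in> YD m" if "b \<in> removable D" for b
      using card_removable[OF y(1) that] removable_young[OF that] y by (simp add: YD_def)
    ultimately have ub: "\<bar>up w f (D - {b}) - c'\<bar> \<le> C' * q" if "b \<in> removable D" for b using that by blast
    have "down (up w f) D \<le> down (\<lambda>_. c' + C' * q) D" using ub by (intro down_mono) fastforce
    moreover have "down (\<lambda>_. c' - C' * q) D \<le> down (up w f) D" using ub by (intro down_mono) fastforce
    ultimately have dn: "\<bar>down (up w f) D - c'\<bar> \<le> C' * q"
      unfolding down_const[OF y(1,3)] by (simp add: abs_le_iff)
    have "(level_step (Suc m) e ^^ Suc j) h D - c = (1 - e * a) * (f D - c) + e * (down (up w f) D - c')"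
      using a(2) by (simp add: f_def[symmetric] level_step_def a_def[symmetric] c_def field_simps)
    also have "\<bar>\<dots>\<bar> \<le> (1 - e * a) * (C * q) + e * (C' * q)"
    proof (rule order.trans[OF abs_triangle_ineq add_mono])
      have "\<bar>f D - c\<bar> \<le> C * q" unfolding f_def q_def by (rule Suc.IH[OF Suc.prems])
      then show "\<bar>(1 - e * a) * (f D - c)\<bar> \<le> (1 - e * a) * (C * q)"
        using ea by (simp add: abs_mult mult_left_mono)
      show "\<bar>e * (down (up w f) D - c')\<bar> \<le> e * (C' * q)" using dn e(1) by (simp add: abs_mult mult_left_mono)
    qed
    also have "\<dots> \<le> (1 - e * a) * (C * q) + e * ((C * (a - t / 2)) * q)"
      using C(3) q0 e(1) by (intro add_left_mono mult_left_mono mult_right_mono) auto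
    also have "\<dots> = C * ((1 - t / 2 * e) * q)" by (simp add: algebra_simps)
    also have "\<dots> = C * (1 - t / 2 * e) ^ Suc j" by (simp add: q_def)
    finally show ?case .
  qed
  then show ?case using C(1) by blast
qed

text \<open>The level \<open>m\<close> is chosen from stability, once for the tolerance
  \<open>e\<close>; then \<open>c\<close> and \<open>C\<close> belong to the restriction of
  \<open>f\<close> to level \<open>m\<close> and are the same for all \<open>n\<close>. Replacing
  the test function costs \<open>e\<close> for all powers, by contractivity.\<close>

lemma Tn_pow_uniform_convergence:
  assumes f: "continuous_on Thoma f" and e: "e > 0"
  shows "\<exists>c C m. C \<ge> 0 \<and> (\<forall>n D j. m \<le> n \<longrightarrow> D \<in> YD n \<longrightarrow>
       \<bar>(Tn z z' n ^^ j) (\<lambda>E. f (iota n E)) D - c\<bar> \<le> e + C * exp (- (t / 2) / ((t + real n) * (real n + 1)) * real j))"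
proof -
  obtain m where m: "\<And>D. young D \<Longrightarrow> m \<le> card D \<Longrightarrow> (down ^^ (card D - m)) (\<lambda>E. \<bar>f (emb E) - f (emb D)\<bar>) D \<le> e"
    using down_stable_continuous[OF f] e unfolding down_stable_def by (meson order_refl)
  define h where "h = (\<lambda>E. f (emb E))"
  obtain c C where C: "C \<ge> 0" "\<And>e j D. 0 \<le> e \<Longrightarrow> e * level_rate m \<le> 1 \<Longrightarrow> D \<in> YD m \<Longrightarrow>
     \<bar>(level_step m e ^^ j) h D - c\<bar> \<le> C * (1 - t / 2 * e) ^ j"
    using level_step_converges[of m h] by blast
  have "\<bar>(Tn z z' n ^^ j) (\<lambda>E. f (iota n E)) D - c\<bar> \<le> e + C * exp (- (t / 2) / ((t + real n) * (real n + 1)) * real j)"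
    if n: "m \<le> n" and D: "D \<in> YD n" for n D j
  proof -
    define k where "k = n - m"
    define N where "N = (t + real n) * (real n + 1)"
    define d where "d = t / 2 * (1 / N)"
    have N: "N > 0" using t_pos by (simp add: N_def)
    have y: "young D" "card D = n" using D by (auto simp: YD_def)
    have lr: "level_rate m \<le> N"
    proof (cases m)
      case 0
      then show ?thesis using N by (simp add: level_rate_def)
    next
      case (Suc m')
      have "real m * (real m - 1 + t) \<le> (real n + 1) * (t + real n)"
        using Suc n t_pos by (intro mult_mono) auto
      then show ?thesis by (simp add: level_rate_def N_def mult.commute)
    qed
    \<comment> \<open>The pull-back \<open>(down ^^ k) h E\<close> is the mean of \<open>h\<close>
      at the level-\<open>m\<close> end of the down chain from \<open>E\<close>; its distance to
      \<open>h E\<close> is at most the mean deviation.\<close>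
    have approx: "\<bar>f (iota n E) - (down ^^ k) h E\<bar> \<le> e" if E: "E \<in> YD n" for E
    proof -
      have yE: "young E" "card E = n" using E by (auto simp: YD_def)
      have le: "k \<le> card E" using yE by (simp add: k_def)
      have dev: "(down ^^ k) (\<lambda>F. \<bar>h F - h E\<bar>) E \<le> e" using m[OF yE(1)] yE(2) n by (simp add: k_def h_def)
      have "(down ^^ k) h E \<le> (down ^^ k) (\<lambda>F. h E + \<bar>h F - h E\<bar>) E"
        using le by (intro down_pow_mono[OF yE(1)]) auto
      moreover have "(down ^^ k) (\<lambda>_. h E) E \<le> (down ^^ k) (\<lambda>F. h F + \<bar>h F - h E\<bar>) E"
        using le by (intro down_pow_mono[OF yE(1)]) auto
      moreover have "h E = f (iota n E)" using yE by (simp add: h_def emb_def)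
      ultimately show ?thesis using dev unfolding down_pow_add down_pow_const[OF yE(1) le] by simp
    qed
    have d1: "d \<le> 1"
    proof -
      have "t * 1 \<le> (t + real n) * (real n + 1)" using t_pos by (intro mult_mono) auto
      then have "t / 2 \<le> N" using t_pos by (simp add: N_def)
      then show ?thesis using N by (simp add: d_def)
    qed
    have "\<bar>(level_step m (1 / N) ^^ j) h E - c\<bar> \<le> C * (1 - d) ^ j" if "E \<in> YD m" for E
      unfolding d_def by (rule C(2)[OF _ _ that]) (use N lr in \<open>auto simp: field_simps\<close>)
    then have lv: "\<bar>(level_step m (1 / N) ^^ j) h E - c\<bar> \<le> C * (1 - d) ^ j" if "young E" "card E = card D - k" for E
      using that y n by (simp add: YD_def k_def)
    have le: "k \<le> card D" using y by (simp add: k_def)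
    have "(down ^^ k) ((level_step m (1 / N) ^^ j) h) D \<le> (down ^^ k) (\<lambda>_. c + C * (1 - d) ^ j) D"
      using lv by (intro down_pow_mono[OF y(1) le]) fastforce
    moreover have "(down ^^ k) (\<lambda>_. c - C * (1 - d) ^ j) D \<le> (down ^^ k) ((level_step m (1 / N) ^^ j) h) D"
      using lv by (intro down_pow_mono[OF y(1) le]) fastforce
    ultimately have "\<bar>(Tn z z' n ^^ j) ((down ^^ k) h) D - c\<bar> \<le> C * (1 - d) ^ j"
      unfolding k_def Tn_pow_down_pow[OF D n] down_pow_const[OF y(1) le[unfolded k_def]] N_def by (simp add: abs_le_iff)
    moreover have "\<bar>(Tn z z' n ^^ j) (\<lambda>E. f (iota n E)) D - (Tn z z' n ^^ j) ((down ^^ k) h) D\<bar> \<le> e"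
      using D approx by (rule Tn_pow_diff_le)
    moreover have "C * (1 - d) ^ j \<le> C * exp (- (t / 2) / N * real j)"
    proof (intro mult_left_mono C(1))
      have "(1 - d) ^ j \<le> exp (- d) ^ j" using d1 exp_ge_add_one_self[of "- d"] by (intro power_mono) auto
      also have "\<dots> = exp (- (t / 2) / N * real j)" by (simp add: d_def exp_of_nat_mult[symmetric] mult.commute)
      finally show "(1 - d) ^ j \<le> exp (- (t / 2) / N * real j)" .
    qed
    ultimately show ?thesis unfolding N_def by linarith
  qed
  then show ?thesis using C(1) by blast
qed

end


section \<open>Probability measures on the Thoma simplex\<close>

lemma iota_in_Thoma: "D \<in> YD n \<Longrightarrow> iota n D \<in> Thoma"
  using emb_in_Thoma[of D] by (auto simp: YD_def emb_def)

lemma Thoma_nonempty: "Thoma \<noteq> {}"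
  using emb_in_Thoma[of "{}"] by auto

lemma prob_on_ThomaD:
  assumes "prob_on_Thoma Q"
  shows "prob_space Q" "sets Q = sets (restrict_space borel Thoma)" "space Q = Thoma"
  using assms sets_eq_imp_space_eq[of Q "restrict_space borel Thoma"]
  by (auto simp: prob_on_Thoma_def space_restrict_space)

lemma continuous_on_Thoma_bounded:
  assumes "continuous_on Thoma f"
  obtains B where "B \<ge> 0" "\<And>x. x \<in> Thoma \<Longrightarrow> \<bar>f x :: real\<bar> \<le> B"
proof -
  have "bounded (f ` Thoma)" using assms compact_Thoma by (intro compact_imp_bounded compact_continuous_image)
  then obtain B where B: "\<forall>x\<in>f ` Thoma. norm x \<le> B" using bounded_iff by blast
  then have "\<bar>f x\<bar> \<le> max B 0" if "x \<in> Thoma" for x using that by auto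
  then show thesis using that[of "max B 0"] by simp
qed

lemma continuous_on_Thoma_integrable:
  assumes Q: "prob_on_Thoma Q" and f: "continuous_on Thoma f"
  shows "integrable Q (f :: thoma \<Rightarrow> real)"
proof -
  interpret prob_space Q using prob_on_ThomaD(1)[OF Q] .
  obtain B where B: "\<And>x. x \<in> Thoma \<Longrightarrow> \<bar>f x\<bar> \<le> B" using continuous_on_Thoma_bounded[OF f] by blast
  have "f \<in> borel_measurable (restrict_space borel Thoma)" by (rule borel_measurable_continuous_on_restrict[OF f])
  then have m: "f \<in> borel_measurable Q" using prob_on_ThomaD(2)[OF Q] by (simp cong: measurable_cong_sets)
  show ?thesis
    by (rule integrable_const_bound[where B = B]) (use m B prob_on_ThomaD(3)[OF Q] in auto)
qed

lemma integral_close: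
  assumes Q: "prob_on_Thoma Q" and f: "continuous_on Thoma f" and b: "\<And>x. x \<in> Thoma \<Longrightarrow> \<bar>f x - c\<bar> \<le> b"
  shows "\<bar>integral\<^sup>L Q f - c\<bar> \<le> (b::real)"
proof -
  interpret prob_space Q using prob_on_ThomaD(1)[OF Q] .
  have i: "integrable Q f" using continuous_on_Thoma_integrable[OF Q f] .
  have s: "c - b \<le> f x" "f x \<le> c + b" if "x \<in> space Q" for x
    using b[of x] that prob_on_ThomaD(3)[OF Q] by (auto simp: abs_le_iff)
  have "integral\<^sup>L Q f \<le> c + b" by (rule integral_le_const[OF i]) (use s in auto)
  moreover have "c - b \<le> integral\<^sup>L Q f" by (rule integral_ge_const[OF i]) (use s in auto)
  ultimately show ?thesis by (simp add: abs_le_iff)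
qed

text \<open>Both measures are transported to the whole space. There the indicator of a closed set is
  the limit of the continuous functions \<open>max 0 (1 - n * infdist x F)\<close>, and closed sets
  are an intersection-stable generator of the Borel sets.\<close>

lemma prob_on_Thoma_eqI:
  assumes P: "prob_on_Thoma P" and Q: "prob_on_Thoma Q"
    and eq: "\<And>f::thoma \<Rightarrow> real. continuous_on Thoma f \<Longrightarrow> integral\<^sup>L Q f = integral\<^sup>L P f"
  shows "Q = P"
proof -
  have id: "(\<lambda>x. x) \<in> measurable R borel" if "prob_on_Thoma R" for R :: "thoma measure"
    using prob_on_ThomaD(2)[OF that] by (simp add: measurable_restrict_space1 cong: measurable_cong_sets)
  define E where "E R = distr R borel (\<lambda>x. x)" for R :: "thoma measure"
  have ps: "prob_space (E R)" if "prob_on_Thoma R" for R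
    unfolding E_def by (rule prob_space.prob_space_distr[OF prob_on_ThomaD(1)[OF that] id[OF that]])
  have int: "integral\<^sup>L (E R) f = integral\<^sup>L R f" if "prob_on_Thoma R" "f \<in> borel_measurable borel" for R and f :: "thoma \<Rightarrow> real"
    unfolding E_def by (rule integral_distr[OF id[OF that(1)] that(2)])
  have em: "emeasure (E R) A = emeasure R (A \<inter> Thoma)" if "prob_on_Thoma R" "A \<in> sets borel" for R A
    unfolding E_def using emeasure_distr[OF id[OF that(1)] that(2)] prob_on_ThomaD(3)[OF that(1)] by (simp add: vimage_def)
  have closed_eq: "emeasure (E Q) F = emeasure (E P) F" if F: "closed F" for F
  proof (cases "F = {}")
    case True
    then show ?thesis by simp
  next
    case False
    interpret EP: prob_space "E P" by (rule ps[OF P])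
    interpret EQ: prob_space "E Q" by (rule ps[OF Q])
    define f where "f n x = max 0 (1 - real n * infdist x F)" for n and x :: thoma
    have fc: "continuous_on UNIV (f n)" for n unfolding f_def[abs_def] by (intro continuous_intros)
    have fm: "f n \<in> borel_measurable borel" for n using fc by (rule borel_measurable_continuous_onI)
    have lim: "(\<lambda>n. f n x) \<longlonglongrightarrow> indicator F x" for x
    proof (cases "x \<in> F")
      case True
      then have "infdist x F = 0" using in_closed_iff_infdist_zero[OF F False] by simp
      then show ?thesis using True by (simp add: f_def)
    next
      case nF: False
      define d where "d = infdist x F"
      have d: "d > 0" unfolding d_def by (rule infdist_pos_not_in_closed[OF F False nF])
      obtain n0 where n0: "real n0 > 1 / d" using reals_Archimedean2 by blast
      have "f n x = 0" if "n \<ge> n0" for n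
      proof -
        have "1 / d \<le> real n" using n0 that by linarith
        then have "1 \<le> real n * d" using d by (simp add: field_simps)
        then show ?thesis by (simp add: f_def d_def)
      qed
      then have "eventually (\<lambda>n. f n x = 0) sequentially" by (auto simp: eventually_sequentially)
      then have "(\<lambda>n. f n x) \<longlonglongrightarrow> 0" by (rule tendsto_eventually)
      then show ?thesis using nF by simp
    qed
    have conv: "(\<lambda>n. integral\<^sup>L R (f n)) \<longlonglongrightarrow> measure (E R) F" if R: "prob_on_Thoma R" for R
    proof -
      interpret ER: prob_space "E R" by (rule ps[OF R])
      have "(\<lambda>n. integral\<^sup>L (E R) (f n)) \<longlonglongrightarrow> integral\<^sup>L (E R) (indicator F)"
      proof (rule integral_dominated_convergence[where w = "\<lambda>_. 1"])
        show "(indicator F :: thoma \<Rightarrow> real) \<in> borel_measurable (E R)" using F by (simp add: E_def)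
        show "f n \<in> borel_measurable (E R)" for n using fm by (simp add: E_def)
        show "AE x in E R. (\<lambda>n. f n x) \<longlonglongrightarrow> indicator F x" using lim by simp
        show "AE x in E R. norm (f n x) \<le> 1" for n by (intro AE_I2) (simp add: f_def infdist_nonneg)
      qed simp
      moreover have "integral\<^sup>L (E R) (indicator F) = measure (E R) F" by (simp add: E_def)
      ultimately show ?thesis using int[OF R fm] by simp
    qed
    have "integral\<^sup>L Q (f n) = integral\<^sup>L P (f n)" for n by (rule eq) (rule continuous_on_subset[OF fc], simp)
    then have "measure (E Q) F = measure (E P) F" using conv[OF P] conv[OF Q] LIMSEQ_unique by simp
    then show ?thesis by (simp add: EP.emeasure_eq_measure EQ.emeasure_eq_measure)
  qed
  have EE: "E Q = E P"
  proof (rule measure_eqI_generator_eq[where E = "Collect closed" and \<Omega> = UNIV and A = "\<lambda>_. UNIV"])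
    show "Int_stable (Collect closed :: thoma set set)" by (auto simp: Int_stable_def)
    show "sets (E Q) = sigma_sets UNIV (Collect closed)" "sets (E P) = sigma_sets UNIV (Collect closed)"
      by (simp_all add: E_def borel_eq_closed)
    interpret EQ: prob_space "E Q" by (rule ps[OF Q])
    show "emeasure (E Q) UNIV \<noteq> \<infinity>" using EQ.emeasure_space_1 by (simp add: E_def)
  qed (auto simp: closed_eq)
  show ?thesis
  proof (rule measure_eqI)
    show "sets Q = sets P" using prob_on_ThomaD(2)[OF P] prob_on_ThomaD(2)[OF Q] by simp
    fix A assume "A \<in> sets Q"
    then obtain B where B: "B \<in> sets borel" "A = Thoma \<inter> B"
      using prob_on_ThomaD(2)[OF Q] by (auto simp: sets_restrict_space)
    then show "emeasure Q A = emeasure P A" using em[OF P B(1)] em[OF Q B(1)] EE by (simp add: Int_commute)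
  qed
qed

section \<open>Reversibility and ergodicity\<close>

context zz_params
begin

lemma zmeasure_eq:
  "zmeasure z z' n D = (\<Prod>b\<in>D. w (box_content b)) / pochhammer t n * (real (dimY D))\<^sup>2 / fact n"
proof -
  have "poch_diag z D * poch_diag z' D = (\<Prod>b\<in>D. (z + of_int (box_content b)) * (z' + of_int (box_content b)))"
    unfolding poch_diag_def prod.distrib[symmetric]
    by (rule prod.cong) (auto simp: box_content_def case_prod_unfold algebra_simps)
  also have "\<dots> = of_real (\<Prod>b\<in>D. w (box_content b))"
    by (simp add: box_weight_props(1)[OF adm] w_def)
  finally have "poch_diag z D * poch_diag z' D / pochhammer (z * z') n = of_real ((\<Prod>b\<in>D. w (box_content b)) / pochhammer t n)"
    by (simp add: zz_eq pochhammer_of_real)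
  then have "Re (poch_diag z D * poch_diag z' D / pochhammer (z * z') n) = (\<Prod>b\<in>D. w (box_content b)) / pochhammer t n"
    by (simp only: Re_complex_of_real)
  then show ?thesis by (simp add: zmeasure_def)
qed

lemma zmeasure_nonneg: "0 \<le> zmeasure z z' n D"
  unfolding zmeasure_eq using t_pos w_pos
  by (intro divide_nonneg_nonneg mult_nonneg_nonneg prod_nonneg less_imp_le[OF pochhammer_pos]) (auto intro: less_imp_le)

text \<open>Passing from \<open>D\<close> to \<open>insert b D\<close> changes the z-measure by the
  weight of \<open>b\<close>, the factor \<open>t + n\<close> of the Pochhammer symbol, the factor
  \<open>n + 1\<close> of the factorial and the squared dimension ratio; these are the ingredients
  of \<open>p_up\<close>, with one dimension ratio left for \<open>p_down\<close>.\<close>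

lemma detailed_balance:
  assumes D: "D \<in> YD n" and E: "E \<in> YD (Suc n)"
  shows "zmeasure z z' n D * p_up z z' n D E = zmeasure z z' (Suc n) E * p_down E D"
proof (cases "covers D E")
  case False
  then show ?thesis by (simp add: p_up_def p_down_def)
next
  case True
  have y: "young D" "young E" using D E by (auto simp: YD_def)
  obtain b where b: "b \<in> addable D" "E = insert b D" using True covers_iff[OF y] by blast
  have bD: "b \<notin> D" "finite D" using b y by (auto simp: addable_def young_finite)
  have d: "real (dimY D) > 0" "real (dimY E) > 0" using dimY_pos y by auto
  have pt: "pochhammer t n > 0" "t + real n > 0" using t_pos by (auto intro: pochhammer_pos)
  have nn: "real n + 1 > 0" by simp
  define A where "A = (\<Prod>b\<in>D. w (box_content b))"
  have "(\<Prod>b\<in>E. w (box_content b)) = w (box_content b) * A" using bD by (simp add: b(2) A_def)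
  then have l: "zmeasure z z' (Suc n) E * p_down E D
     = (w (box_content b) * A) / (pochhammer t n * (t + real n)) * (real (dimY E))\<^sup>2 / ((real n + 1) * fact n) * (real (dimY D) / real (dimY E))"
    using True by (simp add: zmeasure_eq p_down_def pochhammer_Suc add.commute)
  have r: "zmeasure z z' n D * p_up z z' n D E
     = A / pochhammer t n * (real (dimY D))\<^sup>2 / fact n * (w (box_content b) / ((t + real n) * (real n + 1)) * (real (dimY E) / real (dimY D)))"
    unfolding b(2) p_up_insert[OF D b(1)] zmeasure_eq A_def by simp
  show ?thesis unfolding l r using d pt nn by (simp add: power2_eq_square divide_simps)
qed

text \<open>With respect to the z-measures on two successive levels, up and down are adjoint, so
  \<open>Tn\<close> is of the form adjoint times operator. The right side is visibly symmetric in
  \<open>f\<close> and \<open>g\<close>.\<close>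

lemma Tn_pairing:
  "(\<Sum>D\<in>YD n. zmeasure z z' n D * (Tn z z' n f D * g D))
    = (\<Sum>E\<in>YD (Suc n). zmeasure z z' (Suc n) E * ((\<Sum>D\<in>YD n. p_down E D * f D) * (\<Sum>D\<in>YD n. p_down E D * g D)))"
proof -
  define d where "d f E = (\<Sum>D\<in>YD n. p_down E D * f D)" for f E
  have "(\<Sum>D\<in>YD n. zmeasure z z' n D * (Tn z z' n f D * g D))
    = (\<Sum>D\<in>YD n. \<Sum>E\<in>YD (Suc n). (zmeasure z z' n D * p_up z z' n D E) * (d f E * g D))"
  proof (rule sum.cong)
    fix D
    have "Tn z z' n f D = (\<Sum>E\<in>YD (Suc n). p_up z z' n D E * d f E)" by (simp add: Tn_def d_def)
    then show "zmeasure z z' n D * (Tn z z' n f D * g D) = (\<Sum>E\<in>YD (Suc n). (zmeasure z z' n D * p_up z z' n D E) * (d f E * g D))"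
      by (simp only: sum_distrib_right sum_distrib_left mult.assoc)
  qed simp
  also have "\<dots> = (\<Sum>D\<in>YD n. \<Sum>E\<in>YD (Suc n). zmeasure z z' (Suc n) E * (d f E * (p_down E D * g D)))"
    by (intro sum.cong refl) (simp add: detailed_balance)
  also have "\<dots> = (\<Sum>E\<in>YD (Suc n). \<Sum>D\<in>YD n. zmeasure z z' (Suc n) E * (d f E * (p_down E D * g D)))"
    by (rule sum.swap)
  also have "\<dots> = (\<Sum>E\<in>YD (Suc n). zmeasure z z' (Suc n) E * (d f E * d g E))"
    by (simp add: d_def[of g] sum_distrib_left)
  finally show ?thesis unfolding d_def .
qed

lemma Tn_symmetric:
  "(\<Sum>D\<in>YD n. zmeasure z z' n D * (Tn z z' n f D * g D)) = (\<Sum>D\<in>YD n. zmeasure z z' n D * (f D * Tn z z' n g D))"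
  using Tn_pairing[of n f g] Tn_pairing[of n g f] by (simp add: mult.commute)

lemma Tn_pow_symmetric:
  "(\<Sum>D\<in>YD n. zmeasure z z' n D * ((Tn z z' n ^^ j) f D * g D)) = (\<Sum>D\<in>YD n. zmeasure z z' n D * (f D * (Tn z z' n ^^ j) g D))"
proof (induction j arbitrary: f)
  case 0
  then show ?case by simp
next
  case (Suc j)
  have "(\<Sum>D\<in>YD n. zmeasure z z' n D * ((Tn z z' n ^^ Suc j) f D * g D))
    = (\<Sum>D\<in>YD n. zmeasure z z' n D * ((Tn z z' n ^^ j) (Tn z z' n f) D * g D))" by (simp add: funpow_swap1)
  also have "\<dots> = (\<Sum>D\<in>YD n. zmeasure z z' n D * (Tn z z' n f D * (Tn z z' n ^^ j) g D))" by (rule Suc.IH)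
  also have "\<dots> = (\<Sum>D\<in>YD n. zmeasure z z' n D * (f D * (Tn z z' n ^^ Suc j) g D))" by (simp add: Tn_symmetric)
  finally show ?case .
qed

end

section \<open>Passage from the chains to the limit semigroup\<close>

locale zz_process = zz_params +
  fixes T :: "real \<Rightarrow> (thoma \<Rightarrow> real) \<Rightarrow> thoma \<Rightarrow> real" and P :: "thoma measure"
  assumes T: "is_zz_semigroup z z' T" and P: "is_boundary_zmeasure z z' P"
begin

definition gap :: "real \<Rightarrow> (thoma \<Rightarrow> real) \<Rightarrow> nat \<Rightarrow> real" where
  "gap s f n = Max ((\<lambda>D. \<bar>(Tn z z' n ^^ nat \<lfloor>real n ^ 2 * s\<rfloor>) (\<lambda>E. f (iota n E)) D - T s f (iota n D)\<bar>) ` YD n)"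

lemma T_continuous: "continuous_on Thoma f \<Longrightarrow> 0 \<le> s \<Longrightarrow> continuous_on Thoma (T s f)"
  using T by (simp add: is_zz_semigroup_def)

lemma gap_tendsto: "continuous_on Thoma f \<Longrightarrow> 0 \<le> s \<Longrightarrow> gap s f \<longlonglongrightarrow> 0"
  using T by (simp add: is_zz_semigroup_def gap_def[abs_def])

lemma gap_bound:
  "D \<in> YD n \<Longrightarrow> \<bar>(Tn z z' n ^^ nat \<lfloor>real n ^ 2 * s\<rfloor>) (\<lambda>E. f (iota n E)) D - T s f (iota n D)\<bar> \<le> gap s f n"
  unfolding gap_def by (rule Max_ge) (auto simp: finite_YD)

lemma P_prob: "prob_on_Thoma P"
  using P by (simp add: is_boundary_zmeasure_def)

lemma zmeasure_tendsto:
  "continuous_on Thoma f \<Longrightarrow> (\<lambda>n. \<Sum>D\<in>YD n. zmeasure z z' n D * f (iota n D)) \<longlonglongrightarrow> integral\<^sup>L P f"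
  using P by (simp add: is_boundary_zmeasure_def)

text \<open>A bound valid on all diagrams of level \<open>n\<close> passes to \<open>T s f\<close>
  on \<open>iota n D\<close> at the cost of \<open>gap s f n\<close>, and then to any point of the
  simplex by density and continuity.\<close>

lemma T_close:
  assumes f: "continuous_on Thoma f" and s: "0 \<le> s" and \<omega>: "\<omega> \<in> Thoma"
    and b: "\<And>n D. m \<le> n \<Longrightarrow> D \<in> YD n \<Longrightarrow> \<bar>(Tn z z' n ^^ nat \<lfloor>real n ^ 2 * s\<rfloor>) (\<lambda>E. f (iota n E)) D - c\<bar> \<le> b n"
    and lim: "b \<longlonglongrightarrow> B"
  shows "\<bar>T s f \<omega> - c\<bar> \<le> B"
proof -
  obtain D where D: "\<And>n. n \<ge> 1 \<Longrightarrow> D n \<in> YD n" "(\<lambda>n. iota n (D n)) \<longlonglongrightarrow> \<omega>" using Thoma_approx[OF \<omega>] by blast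
  have "(\<lambda>n. T s f (iota n (D n))) \<longlonglongrightarrow> T s f \<omega>"
  proof (rule continuous_on_tendsto_compose[OF T_continuous[OF f s] D(2) \<omega>])
    show "\<forall>\<^sub>F n in sequentially. iota n (D n) \<in> Thoma"
      using eventually_ge_at_top[of 1] by eventually_elim (use D(1) iota_in_Thoma in blast)
  qed
  then have 1: "(\<lambda>n. \<bar>T s f (iota n (D n)) - c\<bar>) \<longlonglongrightarrow> \<bar>T s f \<omega> - c\<bar>" by (intro tendsto_intros)
  have 2: "(\<lambda>n. gap s f n + b n) \<longlonglongrightarrow> 0 + B" by (intro tendsto_add gap_tendsto f s lim)
  have "\<bar>T s f (iota n (D n)) - c\<bar> \<le> gap s f n + b n" if "n \<ge> max 1 m" for n
    using gap_bound[OF D(1), of n s f] b[OF _ D(1), of n] that by simp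
  then have "\<bar>T s f \<omega> - c\<bar> \<le> 0 + B" by (intro LIMSEQ_le[OF 1 2]) blast
  then show ?thesis by simp
qed

lemma T_one: "0 \<le> s \<Longrightarrow> \<omega> \<in> Thoma \<Longrightarrow> T s (\<lambda>_. 1) \<omega> = 1"
  using T_close[of "\<lambda>_. 1" s \<omega> 0 1 "\<lambda>_. 0" 0] by (simp add: Tn_pow_const)

text \<open>About \<open>n^2 * s\<close> steps, each contracting at rate \<open>t / 2\<close>
  divided by \<open>(t + n) * (n + 1)\<close>, have total exponent \<open>- (t / 2) * s\<close> in
  the limit. Here \<open>c\<close> may depend on \<open>e\<close>; it is identified with the
  integral only in \<open>T_ergodic\<close>.\<close>

lemma T_decay:
  assumes f: "continuous_on Thoma f" and e: "e > 0"
  shows "\<exists>c C. C \<ge> 0 \<and> (\<forall>s \<omega>. 0 \<le> s \<longrightarrow> \<omega> \<in> Thoma \<longrightarrow> \<bar>T s f \<omega> - c\<bar> \<le> e + C * exp (- (t / 2) * s))"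
proof -
  obtain c C m where C: "C \<ge> 0"
    "\<And>n D j. m \<le> n \<Longrightarrow> D \<in> YD n \<Longrightarrow>
       \<bar>(Tn z z' n ^^ j) (\<lambda>E. f (iota n E)) D - c\<bar> \<le> e + C * exp (- (t / 2) / ((t + real n) * (real n + 1)) * real j)"
    using Tn_pow_uniform_convergence[OF f e] by blast
  have "\<bar>T s f \<omega> - c\<bar> \<le> e + C * exp (- (t / 2) * s)" if s: "0 \<le> s" and \<omega>: "\<omega> \<in> Thoma" for s \<omega>
  proof (rule T_close[OF f s \<omega>])
    \<comment> \<open>The \<open>- 1\<close> accounts for the floor in the number of steps; it
      disappears in the limit.\<close>
    define b where "b n = e + C * exp (- (t / 2) * ((real n ^ 2 * s - 1) / ((t + real n) * (real n + 1))))" for n :: nat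
    have "(\<lambda>n. (real n ^ 2 * s - 1) / ((t + real n) * (real n + 1))) \<longlonglongrightarrow> s" by real_asymp
    then show "b \<longlonglongrightarrow> e + C * exp (- (t / 2) * s)" unfolding b_def[abs_def] by (intro tendsto_intros)
    fix n D assume nD: "m \<le> n" "D \<in> YD n"
    define j where "j = nat \<lfloor>real n ^ 2 * s\<rfloor>"
    have "0 \<le> real n ^ 2 * s" using s by simp
    then have j: "real n ^ 2 * s - 1 \<le> real j" unfolding j_def by linarith
    have N: "(t + real n) * (real n + 1) > 0" using t_pos by simp
    have "\<bar>(Tn z z' n ^^ j) (\<lambda>E. f (iota n E)) D - c\<bar> \<le> e + C * exp (- (t / 2) / ((t + real n) * (real n + 1)) * real j)"
      by (rule C(2)[OF nD])
    also have "\<dots> \<le> b n" unfolding b_def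
    proof (intro add_left_mono mult_left_mono C(1))
      have "(real n ^ 2 * s - 1) / ((t + real n) * (real n + 1)) \<le> real j / ((t + real n) * (real n + 1))"
        using j N by (intro divide_right_mono) auto
      then have "(t / 2) * ((real n ^ 2 * s - 1) / ((t + real n) * (real n + 1))) \<le> (t / 2) * (real j / ((t + real n) * (real n + 1)))"
        using t_pos by (intro mult_left_mono) auto
      then show "exp (- (t / 2) / ((t + real n) * (real n + 1)) * real j) \<le> exp (- (t / 2) * ((real n ^ 2 * s - 1) / ((t + real n) * (real n + 1))))"
        by simp
    qed
    finally show "\<bar>(Tn z z' n ^^ nat \<lfloor>real n ^ 2 * s\<rfloor>) (\<lambda>E. f (iota n E)) D - c\<bar> \<le> b n" unfolding j_def .
  qed
  then show ?thesis using C(1) by blast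
qed

text \<open>Replacing the power of \<open>Tn\<close> by \<open>T s f\<close> costs at most the total
  mass times \<open>gap s f n\<close> times a bound for \<open>g\<close>; the total masses converge,
  by the test function \<open>1\<close>. For the remaining sums the convergence to \<open>P\<close>
  applies, since \<open>T s f * g\<close> is continuous.\<close>

lemma pairing_tendsto:
  assumes f: "continuous_on Thoma f" and g: "continuous_on Thoma g" and s: "0 \<le> s"
  shows "(\<lambda>n. \<Sum>D\<in>YD n. zmeasure z z' n D * ((Tn z z' n ^^ nat \<lfloor>real n ^ 2 * s\<rfloor>) (\<lambda>E. f (iota n E)) D * g (iota n D)))
    \<longlonglongrightarrow> integral\<^sup>L P (\<lambda>\<omega>. T s f \<omega> * g \<omega>)" (is "?a \<longlonglongrightarrow> _")
proof -
  define a where "a n = (\<Sum>D\<in>YD n. zmeasure z z' n D * (T s f (iota n D) * g (iota n D)))" for n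
  have a: "a \<longlonglongrightarrow> integral\<^sup>L P (\<lambda>\<omega>. T s f \<omega> * g \<omega>)"
    unfolding a_def[abs_def] by (intro zmeasure_tendsto continuous_intros T_continuous f g s)
  obtain B where B: "B \<ge> 0" "\<And>x. x \<in> Thoma \<Longrightarrow> \<bar>g x\<bar> \<le> B" using continuous_on_Thoma_bounded[OF g] by blast
  define M where "M n = (\<Sum>D\<in>YD n. zmeasure z z' n D * 1)" for n
  have M: "M \<longlonglongrightarrow> integral\<^sup>L P (\<lambda>_. 1)" unfolding M_def[abs_def] by (rule zmeasure_tendsto) simp
  have "(\<lambda>n. M n * (gap s f n * B)) \<longlonglongrightarrow> integral\<^sup>L P (\<lambda>_. 1) * (0 * B)"
    by (intro tendsto_intros M gap_tendsto f s)
  then have lim: "(\<lambda>n. M n * (gap s f n * B)) \<longlonglongrightarrow> 0" by simp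
  have "\<bar>?a n - a n\<bar> \<le> M n * (gap s f n * B)" for n
  proof -
    have "?a n - a n = (\<Sum>D\<in>YD n. zmeasure z z' n D * (((Tn z z' n ^^ nat \<lfloor>real n ^ 2 * s\<rfloor>) (\<lambda>E. f (iota n E)) D - T s f (iota n D)) * g (iota n D)))"
      unfolding a_def sum_subtractf[symmetric] by (simp add: algebra_simps)
    also have "\<bar>\<dots>\<bar> \<le> (\<Sum>D\<in>YD n. zmeasure z z' n D * (gap s f n * B))"
    proof (rule order.trans[OF sum_abs sum_mono])
      fix D assume D: "D \<in> YD n"
      show "\<bar>zmeasure z z' n D * (((Tn z z' n ^^ nat \<lfloor>real n ^ 2 * s\<rfloor>) (\<lambda>E. f (iota n E)) D - T s f (iota n D)) * g (iota n D))\<bar>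
        \<le> zmeasure z z' n D * (gap s f n * B)"
        unfolding abs_mult abs_of_nonneg[OF zmeasure_nonneg]
        using gap_bound[OF D, of s f] B(2)[OF iota_in_Thoma[OF D]] zmeasure_nonneg
        by (intro mult_left_mono mult_mono) (auto intro: order.trans[OF abs_ge_zero])
    qed
    also have "\<dots> = M n * (gap s f n * B)" by (simp add: M_def sum_distrib_right)
    finally show ?thesis .
  qed
  then have "(\<lambda>n. ?a n - a n) \<longlonglongrightarrow> 0" by (intro Lim_null_comparison[OF _ lim]) simp
  from tendsto_add[OF this a] show ?thesis by simp
qed

lemma T_symmetric:
  assumes f: "continuous_on Thoma f" and g: "continuous_on Thoma g" and s: "0 \<le> s"
  shows "integral\<^sup>L P (\<lambda>\<omega>. T s f \<omega> * g \<omega>) = integral\<^sup>L P (\<lambda>\<omega>. f \<omega> * T s g \<omega>)"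
proof -
  have "(\<lambda>n. \<Sum>D\<in>YD n. zmeasure z z' n D * ((Tn z z' n ^^ nat \<lfloor>real n ^ 2 * s\<rfloor>) (\<lambda>E. f (iota n E)) D * g (iota n D)))
    \<longlonglongrightarrow> integral\<^sup>L P (\<lambda>\<omega>. T s g \<omega> * f \<omega>)"
  proof -
    have "(\<Sum>D\<in>YD n. zmeasure z z' n D * ((Tn z z' n ^^ j) (\<lambda>E. f (iota n E)) D * g (iota n D)))
      = (\<Sum>D\<in>YD n. zmeasure z z' n D * ((Tn z z' n ^^ j) (\<lambda>E. g (iota n E)) D * f (iota n D)))" for n j
      unfolding Tn_pow_symmetric[of n j _ "\<lambda>D. g (iota n D)"] by (simp only: mult.commute[of "f _"])
    then show ?thesis using pairing_tendsto[OF g f s] by simp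
  qed
  from LIMSEQ_unique[OF this pairing_tendsto[OF f g s]] show ?thesis by (simp add: mult.commute)
qed

text \<open>Symmetry with \<open>g = 1\<close>, together with \<open>T_one\<close>.\<close>

lemma T_stationary:
  assumes f: "continuous_on Thoma f" and s: "0 \<le> s"
  shows "integral\<^sup>L P (T s f) = integral\<^sup>L P f"
proof -
  have "integral\<^sup>L P (T s f) = integral\<^sup>L P (\<lambda>\<omega>. T s f \<omega> * 1)" by simp
  also have "\<dots> = integral\<^sup>L P (\<lambda>\<omega>. f \<omega> * T s (\<lambda>_. 1) \<omega>)" by (rule T_symmetric[OF f _ s]) simp
  also have "\<dots> = integral\<^sup>L P f"
    by (rule Bochner_Integration.integral_cong) (auto simp: prob_on_ThomaD(3)[OF P_prob] T_one[OF s])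
  finally show ?thesis .
qed

text \<open>For large \<open>s\<close> the function \<open>T s f\<close> is within
  \<open>e / 2\<close> of an unidentified constant. Its integral against \<open>P\<close> is that of
  \<open>f\<close>, by stationarity, so the constant is within \<open>e / 2\<close> of this
  integral.\<close>

lemma T_ergodic:
  assumes f: "continuous_on Thoma f" and e: "e > 0"
  obtains s0 where "s0 \<ge> 0" "\<And>s \<omega>. s0 \<le> s \<Longrightarrow> \<omega> \<in> Thoma \<Longrightarrow> \<bar>T s f \<omega> - integral\<^sup>L P f\<bar> \<le> e"
proof -
  have e4: "e / 4 > 0" using e by simp
  obtain c C where C: "C \<ge> 0" "\<And>s \<omega>. 0 \<le> s \<Longrightarrow> \<omega> \<in> Thoma \<Longrightarrow> \<bar>T s f \<omega> - c\<bar> \<le> e / 4 + C * exp (- (t / 2) * s)"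
    using T_decay[OF f e4] by blast
  have "((\<lambda>s. C * exp (- (t / 2) * s)) \<longlongrightarrow> 0) at_top" using t_pos by real_asymp
  then have "\<forall>\<^sub>F s in at_top. C * exp (- (t / 2) * s) < e / 4" using e4 by (rule order_tendstoD(2))
  then obtain s1 where s1: "\<And>s. s \<ge> s1 \<Longrightarrow> C * exp (- (t / 2) * s) < e / 4" by (auto simp: eventually_at_top_linorder)
  have "\<bar>T s f \<omega> - integral\<^sup>L P f\<bar> \<le> e" if s: "max s1 0 \<le> s" and \<omega>: "\<omega> \<in> Thoma" for s \<omega>
  proof -
    have close: "\<bar>T s f \<eta> - c\<bar> \<le> e / 2" if "\<eta> \<in> Thoma" for \<eta> using C(2)[OF _ that, of s] s1[of s] s by simp
    have "\<bar>integral\<^sup>L P (T s f) - c\<bar> \<le> e / 2"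
      using s by (intro integral_close[OF P_prob T_continuous[OF f]] close) auto
    moreover have "integral\<^sup>L P (T s f) = integral\<^sup>L P f" using T_stationary[OF f, of s] s by simp
    ultimately show ?thesis using close[OF \<omega>] by linarith
  qed
  then show thesis using that[of "max s1 0"] by simp
qed

text \<open>Under a stationary \<open>Q\<close> the integral of \<open>f\<close> equals that of
  \<open>T s0 f\<close>, which is uniformly close to the integral of \<open>f\<close> under
  \<open>P\<close>.\<close>

lemma stationary_unique:
  assumes Q: "prob_on_Thoma Q"
    and st: "\<And>f s. continuous_on Thoma f \<Longrightarrow> 0 \<le> s \<Longrightarrow> integral\<^sup>L Q (T s f) = integral\<^sup>L Q f"
  shows "Q = P"
proof (rule prob_on_Thoma_eqI[OF P_prob Q])
  fix f :: "thoma \<Rightarrow> real" assume f: "continuous_on Thoma f"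
  have "\<bar>integral\<^sup>L Q f - integral\<^sup>L P f\<bar> \<le> e" if e: "e > 0" for e
  proof -
    obtain s0 where s0: "s0 \<ge> 0" "\<And>s \<omega>. s0 \<le> s \<Longrightarrow> \<omega> \<in> Thoma \<Longrightarrow> \<bar>T s f \<omega> - integral\<^sup>L P f\<bar> \<le> e"
      using T_ergodic[OF f e] by blast
    have "\<bar>integral\<^sup>L Q (T s0 f) - integral\<^sup>L P f\<bar> \<le> e"
      by (rule integral_close[OF Q T_continuous[OF f s0(1)]]) (use s0 in auto)
    then show ?thesis using st[OF f s0(1)] by simp
  qed
  then have "\<bar>integral\<^sup>L Q f - integral\<^sup>L P f\<bar> \<le> 0" using field_le_epsilon[of _ 0] by (metis add_0)
  then show "integral\<^sup>L Q f = integral\<^sup>L P f" by simp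
qed

lemma sup_norm_tendsto:
  assumes f: "continuous_on Thoma f"
  shows "((\<lambda>s. SUP \<omega>\<in>Thoma. \<bar>T s f \<omega> - integral\<^sup>L P f\<bar>) \<longlongrightarrow> 0) at_top"
proof (rule tendstoI)
  fix e :: real assume e: "e > 0"
  obtain s0 where s0: "s0 \<ge> 0" "\<And>s \<omega>. s0 \<le> s \<Longrightarrow> \<omega> \<in> Thoma \<Longrightarrow> \<bar>T s f \<omega> - integral\<^sup>L P f\<bar> \<le> e / 2"
    using T_ergodic[OF f, of "e / 2"] e by (metis half_gt_zero)
  show "\<forall>\<^sub>F s in at_top. dist (SUP \<omega>\<in>Thoma. \<bar>T s f \<omega> - integral\<^sup>L P f\<bar>) 0 < e"
    using eventually_ge_at_top[of s0]
  proof eventually_elim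
    case (elim s)
    have u: "(SUP \<omega>\<in>Thoma. \<bar>T s f \<omega> - integral\<^sup>L P f\<bar>) \<le> e / 2"
      using s0(2)[OF elim] by (intro cSUP_least Thoma_nonempty)
    \<comment> \<open>A real \<open>SUP\<close> is bounded below by its members only for a set
      bounded above; one point then shows that it is nonnegative.\<close>
    obtain \<omega> where \<omega>: "\<omega> \<in> Thoma" using Thoma_nonempty by blast
    have "\<bar>T s f \<omega> - integral\<^sup>L P f\<bar> \<le> (SUP \<omega>\<in>Thoma. \<bar>T s f \<omega> - integral\<^sup>L P f\<bar>)"
      using s0(2)[OF elim] by (intro cSUP_upper[OF \<omega>] bdd_aboveI2[where M = "e / 2"])
    then have "0 \<le> (SUP \<omega>\<in>Thoma. \<bar>T s f \<omega> - integral\<^sup>L P f\<bar>)" by (rule order.trans[OF abs_ge_zero])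
    then show ?case using u e by simp
  qed
qed

end


theorem theorem7p3:
  fixes z z' :: complex
    and T :: "real \<Rightarrow> (thoma \<Rightarrow> real) \<Rightarrow> thoma \<Rightarrow> real"
    and P :: "thoma measure"
  assumes zz: "admissible_zz z z'"
    and T: "is_zz_semigroup z z' T"
    and P: "is_boundary_zmeasure z z' P"
  shows
    "(\<forall>f t. continuous_on Thoma f \<and> 0 \<le> t \<longrightarrow>
        integral\<^sup>L P (T t f) = integral\<^sup>L P f)
     \<and> (\<forall>Q. prob_on_Thoma Q \<and>
          (\<forall>f t. continuous_on Thoma f \<and> 0 \<le> t \<longrightarrow> integral\<^sup>L Q (T t f) = integral\<^sup>L Q f)
          \<longrightarrow> Q = P)
     \<and> (\<forall>f g t. continuous_on Thoma f \<and> continuous_on Thoma g \<and> 0 \<le> t \<longrightarrow>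
          integral\<^sup>L P (\<lambda>w. T t f w * g w) = integral\<^sup>L P (\<lambda>w. f w * T t g w))
     \<and> (\<forall>f. continuous_on Thoma f \<longrightarrow>
          ((\<lambda>t. SUP w\<in>Thoma. \<bar>T t f w - integral\<^sup>L P f\<bar>) \<longlongrightarrow> 0) at_top)"
proof -
  interpret zz_process z z' T P
    by unfold_locales (fact zz T P)+
  show ?thesis
    by (intro conjI allI impI) (auto intro: T_stationary stationary_unique T_symmetric sup_norm_tendsto)
qed

end
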